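(* Let $1\le k\le n$, let $\mathbb{H}^n=\mathbb{W}\rtimes\mathbb{V}$ be a semidirect factorization of the Heisenberg group with $\mathbb{W}$ a vertical subgroup and $\mathbb{V}$ a $k$-dimensional horizontal subgroup. Let $d$ be a homogeneous distance on $\mathbb{H}^n$ that is either $(2n+1-k)$-vertically symmetric or multiradial. Let $\Sigma\subset\mathbb{H}^n$ be a parametrized $\mathbb{H}$-regular surface with respect to $(\mathbb{W},\mathbb{V})$, with parametrization $\phi:U\to\mathbb{V}$ ($U\subset\mathbb{W}$ open), graph map $\Phi(n)=n\phi(n)$ and defining function $f\in C^1_h(\Omega,\mathbb{R}^k)$. Let $(v_1,\dots,v_k)$ and $(w_{k+1},\dots,w_{2n},e_{2n+1})$ be orthonormal bases of $\mathbb{V}$ and $\mathbb{W}$, $V=v_1\wedge\cdots\wedge v_k$, $N=w_{k+1}\wedge\cdots\wedge w_{2n}\wedge e_{2n+1}$, and for Borel sets $B$ let $$\mu(B)=\|V\wedge N\|_g\int_{\Phi^{-1}(B)}\frac{J_Hf(\Phi(n))}{J_{\mathbb{V}}f(\Phi(n))}\,d\mathcal{H}^{2n+1-k}_E(n).$$ Then $$\mu=\omega_d(2n+1-k)\,\mathcal{S}^{2n+2-k}\llcorner\Sigma,$$ where $\omega_d(2n+1-k)$ is the constant value of the spherical factor on $(2n+1-k)$-dimensional vertical subgroups. Therefore, setting $\mathcal{S}_d^{2n+2-k}=\omega_d(2n+1-k)\,\mathcal{S}^{2n+2-k}$, $$\mathcal{S}_d^{2n+2-k}\llcorner\Sigma=\mu=\|V\wedge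 N\|_g\;\Phi_\sharp\Big(\Big(\frac{J_Hf}{J_{\mathbb{V}}f}\circ\Phi\Big)\,\mathcal{H}^{2n+1-k}_E\llcorner U\Big).$$
   Context: Heisenberg group: $\mathbb{H}^n=H_1\oplus H_2$ is a real vector space, $\dim H_1=2n$, $\dim H_2=1$, with a symplectic form $\omega$ on $H_1$ and a fixed $0\ne e_{2n+1}\in H_2$; $\pi_{H_1},\pi_{H_2}$ are the projections, $[p,q]=\omega(\pi_{H_1}p,\pi_{H_1}q)e_{2n+1}$ and $pq=p+q+\frac12[p,q]$ (identity $0$). Dilations: $\delta_t$ is linear with $\delta_t w=t^iw$ for $w\in H_i$, $t>0$. Fix a basis $(e_1,\dots,e_{2n})$ of $H_1$ with $\omega(e_i,e_{n+j})=\delta_{ij}$, $\omega(e_i,e_j)=\omega(e_{n+i},e_{n+j})=0$ for $1\le i,j\le n$, and the scalar product $\langle\cdot,\cdot\rangle$ (norm $|\cdot|$) making $(e_1,\dots,e_{2n+1})$ orthonormal; this identifies $\mathbb{H}^n$ with $\mathbb{R}^{2n+1}$. $\|\cdot\|_g$ on multivectors is the norm induced by $\langle\cdot,\cdot\rangle$. $\mathcal{H}^p_E$ is the $p$-dimensional Hausdorff measure for the Euclidean distance (normalized to agree with Lebesgue measure on $p$-dimensional subspaces). A homogeneous distance $d$ is a distance with $d(zx,zy)=d(x,y)$ and $d(\delta_tx,\delta_ty)=t\,d(x,y)$; $\|x\|=d(x,0)$; $\mathbb{B}(x,r)=\{y:d(x,y)\le r\}$. Homogeneous subgroups are Lie subgroups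 closed under all $\delta_t$; vertical ones contain $H_2$, horizontal ones are contained in $H_1$. $\mathbb{H}^n=\mathbb{W}\rtimes\mathbb{V}$ means $\mathbb{W}$ vertical, $\mathbb{V}$ horizontal, $\mathbb{H}^n=\mathbb{W}\mathbb{V}$, $\mathbb{W}\cap\mathbb{V}=\{0\}$; then $x=\pi_{\mathbb{W}}(x)\pi_{\mathbb{V}}(x)$ uniquely. Symmetric distances. Let $p\in\{1,\dots,2n\}$. A homogeneous distance $d$ is $p$-vertically symmetric if $p=1$, or $p\ge2$ and there is a family $\mathcal{F}\subset O(H_1)$ of linear isometries of $H_1$ such that for any two $(p-1)$-dimensional subspaces $S_1,S_2\subset H_1$ some $L\in\mathcal{F}$ satisfies $L(S_1)=S_2$, and, with $\mathcal{O}=\{T\in O(\mathbb{H}^n):T|_{H_2}=\mathrm{Id},\ T|_{H_1}\in\mathcal{F}\}$: (1) $\pi_{H_1}(\mathbb{B}(0,1))=\mathbb{B}(0,1)\cap H_1=\{h\in H_1:\theta(|h|)\le r_0\}$ for some monotone non-decreasing $\theta:[0,\infty)\to[0,\infty)$ and $r_0>0$; (2) $T(\mathbb{B}(0,1))=\mathbb{B}(0,1)$ for all $T\in\mathcal{O}$. $d$ is multiradial if $d(x,0)=\theta(|\pi_{H_1}(x)|,|\pi_{H_2}(x)|)$ for some continuous $\theta:[0,\infty)^2\to[0,\infty)$, monotone non-decreasing in each variable, with $\theta(x)\to+\infty$ as $|x|\to+\infty$. Spherical factor of a $p$-dimensional linear subspace $\Pi$: $\beta_d(\Pi)=\max_{z\in\mathbb{B}(0,1)}\mathcal{H}^p_E(\Pi\cap\mathbb{B}(z,1))$.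 It is known that if $d$ is $p$-vertically symmetric or multiradial then $\beta_d(S)$ has the same value for all $p$-dimensional vertical subgroups $S$; this value is denoted $\omega_d(p)$. An h-homomorphism is a homogeneous (commuting with dilations) group homomorphism; on $\mathbb{R}^k$ dilations are $y\mapsto ty$. For $\Omega\subset\mathbb{H}^n$ open, $f\in C^1_h(\Omega,\mathbb{R}^k)$ means that at each $x\in\Omega$ there is an h-homomorphism $Df(x):\mathbb{H}^n\to\mathbb{R}^k$ with $|f(xw)-f(x)-Df(x)(w)|=o(\|w\|)$ as $w\to0$, and $x\mapsto Df(x)$ is continuous. For scalar $f_i$, $\nabla_Hf_i(x)\in H_1$ is given by $Df_i(x)(z)=\langle\nabla_Hf_i(x),z\rangle$ for all $z$, and $\nabla_{\mathbb{V}}f_i(x)\in\mathbb{V}$ by the same identity for $z\in\mathbb{V}$. $J_Hf(x)=\|\nabla_Hf_1(x)\wedge\cdots\wedge\nabla_Hf_k(x)\|_g$, $J_{\mathbb{V}}f(x)=\|\nabla_{\mathbb{V}}f_1(x)\wedge\cdots\wedge\nabla_{\mathbb{V}}f_k(x)\|_g$. $\Sigma$ is a ($k$-codimensional) $\mathbb{H}$-regular surface if each $x\in\Sigma$ has an open neighbourhood $\Omega_x$ and $h\in C^1_h(\Omega_x,\mathbb{R}^k)$ with $\Sigma\cap\Omega_x=\{h=0\}$ and $\nabla_Hh_1\wedge\cdots\wedge\nabla_Hh_k\neq0$ on $\Omega_x$. For $\phi:U\to\mathbb{V}$, $U\subset\mathbb{W}$ open, $x\in\mathbb{H}^n$: $\sigma_x(w)=xw\,\pi_{\mathbb{V}}(x)^{-1}$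 on $\mathbb{W}$, and $\phi_x(w)=\pi_{\mathbb{V}}(x)\phi(\sigma_{x^{-1}}(w))$ for $w\in\sigma_x(U)$. With $\Phi(w)=w\phi(w)$, $\phi$ is uniformly intrinsic differentiable on $U$ if for each $\bar w\in U$ there is an h-homomorphism $d\phi_{\bar w}:\mathbb{W}\to\mathbb{V}$ with $\lim_{\delta\to0}\sup_{\|\bar w^{-1}w'\|<\delta}\sup_{0<\|w\|<\delta}d(d\phi_{\bar w}(w),\phi_{\Phi(w')^{-1}}(w))/\|w\|=0$. An $\mathbb{H}$-regular surface $\Sigma$ is a parametrized $\mathbb{H}$-regular surface with respect to $(\mathbb{W},\mathbb{V})$, with parametrization $\phi$, if $\mathbb{H}^n=\mathbb{W}\rtimes\mathbb{V}$ and $\Sigma=\{u\phi(u):u\in U\}$ with $U\subset\mathbb{W}$ open and $\phi:U\to\mathbb{V}$ uniformly intrinsic differentiable. A function $f\in C^1_h(\Omega,\mathbb{R}^k)$, $\Omega$ open, $\Sigma\subset\Omega$, is a defining function of $\Sigma$ if $f^{-1}(f(x_0))\cap U\mathbb{V}=\Sigma$ for some $x_0\in\Sigma$ and $Df(x)$ is surjective for all $x\in\Sigma$. Spherical measure: $\mathcal{S}^\alpha(A)=\sup_{\delta>0}\inf\{\sum_j2^{-\alpha}\mathrm{diam}(B_j)^\alpha: A\subset\bigcup_jB_j,\ B_j\text{ closed }d\text{-balls},\ \mathrm{diam}(B_j)\le\delta\}$. $\nu\llcorner A$ is the restriction $B\mapsto\nu(A\cap B)$; $\Phi_\sharp$ is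 push-forward. Equalities of measures are on Borel sets. *)

theory Defs
  imports "HOL-Analysis.Analysis" "HOL-Algebra.Coset"
begin

section \<open>The Heisenberg group\<close>

text \<open>
  With \<open>n = CARD('n)\<close>, the first factor is \<open>H\<^sub>1\<close> in the coordinates of the symplectic basis
  (\<open>(axis i 1, 0)\<close> is the basis vector number \<open>i\<close>, \<open>(0, axis i 1)\<close> is number \<open>n + i\<close>) and the second
  factor is the coefficient of the vertical basis vector. The scalar product of the product type is the
  one for which this basis is orthonormal.
\<close>
type_synonym 'n hvec = "(real^'n) \<times> (real^'n)"
type_synonym 'n heis = "'n hvec \<times> real"

definition symp :: "'n::finite hvec \<Rightarrow> 'n hvec \<Rightarrow> real" where
  "symp p q = fst p \<bullet> snd q - snd p \<bullet> fst q"

definition evert :: "'n::finite heis" where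
  "evert = (0, 1)"

definition bracket :: "'n::finite heis \<Rightarrow> 'n heis \<Rightarrow> 'n heis" where
  "bracket p q = symp (fst p) (fst q) *\<^sub>R evert"

definition heis_mult :: "'n::finite heis \<Rightarrow> 'n heis \<Rightarrow> 'n heis"  (infixl \<open>\<cdot>\<close> 70) where
  "p \<cdot> q = p + q + (1/2) *\<^sub>R bracket p q"

definition heis_group :: "'n::finite heis monoid" where
  "heis_group = \<lparr>carrier = UNIV, monoid.mult = (\<cdot>), one = 0\<rparr>"

abbreviation hinv :: "'n::finite heis \<Rightarrow> 'n heis" where
  "hinv x \<equiv> inv\<^bsub>heis_group\<^esub> x"

definition dil :: "real \<Rightarrow> 'n::finite heis \<Rightarrow> 'n heis" where
  "dil t p = (t *\<^sub>R fst p, t\<^sup>2 * snd p)"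

definition H1 :: "'n::finite heis set" where
  "H1 = {p. snd p = 0}"

definition H2 :: "'n::finite heis set" where
  "H2 = {p. fst p = 0}"

lemma heis_group_is_group: "group (heis_group :: 'n::finite heis monoid)"
proof (rule groupI)
  fix x :: "'n heis"
  show "\<exists>y\<in>carrier heis_group. y \<otimes>\<^bsub>heis_group\<^esub> x = \<one>\<^bsub>heis_group\<^esub>"
    by (rule bexI[of _ "- x"])
      (auto simp: heis_group_def heis_mult_def bracket_def symp_def inner_commute)
qed (auto simp: heis_group_def heis_mult_def bracket_def symp_def evert_def prod_eq_iff
      algebra_simps inner_add_left inner_add_right)

lemma hinv_eq: "hinv (x :: 'n::finite heis) = - x"
proof -
  interpret group "heis_group :: 'n heis monoid" by (rule heis_group_is_group)
  show ?thesis
    by (rule inv_equality)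
      (auto simp: heis_group_def heis_mult_def bracket_def symp_def inner_commute)
qed


section \<open>Homogeneous distances\<close>

definition homogeneous_distance :: "('n::finite heis \<Rightarrow> 'n heis \<Rightarrow> real) \<Rightarrow> bool" where
  "homogeneous_distance d \<longleftrightarrow>
     Metric_space UNIV d \<and>
     (\<forall>x y z. d (z \<cdot> x) (z \<cdot> y) = d x y) \<and>
     (\<forall>t>0. \<forall>x y. d (dil t x) (dil t y) = t * d x y)"

definition dball :: "('a \<Rightarrow> 'a \<Rightarrow> real) \<Rightarrow> 'a \<Rightarrow> real \<Rightarrow> 'a set" where
  "dball d x r = {y. d x y \<le> r}"

definition vertically_symmetric :: "nat \<Rightarrow> ('n::finite heis \<Rightarrow> 'n heis \<Rightarrow> real) \<Rightarrow> bool" where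
  "vertically_symmetric p d \<longleftrightarrow>
     1 \<le> p \<and> p \<le> 2 * CARD('n) \<and>
     (p = 1 \<or>
      (\<exists>F :: ('n hvec \<Rightarrow> 'n hvec) set.
         (\<forall>L\<in>F. orthogonal_transformation L) \<and>
         (\<forall>S1 S2. subspace S1 \<and> dim S1 = p - 1 \<and> subspace S2 \<and> dim S2 = p - 1 \<longrightarrow>
            (\<exists>L\<in>F. L ` S1 = S2)) \<and>
         (\<exists>(\<theta>::real \<Rightarrow> real) r0.
            mono_on {0..} \<theta> \<and> (\<forall>s\<ge>0. 0 \<le> \<theta> s) \<and> 0 < r0 \<and>
            fst ` dball d 0 1 = {h. (h, 0) \<in> dball d 0 1} \<and>
            {h. (h, 0) \<in> dball d 0 1} = {h. \<theta> (norm h) \<le> r0}) \<and>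
         (\<forall>T. orthogonal_transformation T \<and> (\<forall>s. T (0, s) = (0, s)) \<and>
              (\<exists>L\<in>F. \<forall>h. T (h, 0) = (L h, 0)) \<longrightarrow>
            T ` dball d 0 1 = dball d 0 1)))"

definition multiradial :: "('n::finite heis \<Rightarrow> 'n heis \<Rightarrow> real) \<Rightarrow> bool" where
  "multiradial d \<longleftrightarrow>
     (\<exists>\<theta> :: real \<times> real \<Rightarrow> real.
        continuous_on ({0..} \<times> {0..}) \<theta> \<and>
        (\<forall>z\<in>{0..} \<times> {0..}. 0 \<le> \<theta> z) \<and>
        (\<forall>b\<ge>0. mono_on {0..} (\<lambda>a. \<theta> (a, b))) \<and>
        (\<forall>a\<ge>0. mono_on {0..} (\<lambda>b. \<theta> (a, b))) \<and>
        filterlim \<theta> at_top (inf at_infinity (principal ({0..} \<times> {0..}))) \<and>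
        (\<forall>x. d x 0 = \<theta> (norm (fst x), \<bar>snd x\<bar>)))"


section \<open>Hausdorff and spherical measures\<close>

definition ediam :: "('a \<Rightarrow> 'a \<Rightarrow> real) \<Rightarrow> 'a set \<Rightarrow> ennreal" where
  "ediam d S = (SUP x\<in>S. SUP y\<in>S. ennreal (d x y))"

text \<open>
  The outer measure obtained from coverings by members of a family \<open>F\<close> of sets with gauge \<open>\<zeta>\<close>.
  The coverings are countable; empty members of the sequence do not count, which takes care of finite
  coverings.
\<close>
definition gauge_measure ::
    "('a \<Rightarrow> 'a \<Rightarrow> real) \<Rightarrow> 'a set set \<Rightarrow> ('a set \<Rightarrow> ennreal) \<Rightarrow> 'a set \<Rightarrow> ennreal" where
  "gauge_measure d F \<zeta> A =
     (SUP \<delta>\<in>{0<..}.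
        INF B\<in>{B :: nat \<Rightarrow> 'a set. range B \<subseteq> insert {} F \<and> A \<subseteq> (\<Union>j. B j) \<and>
                                   (\<forall>j. ediam d (B j) \<le> ennreal \<delta>)}.
          \<Sum>j. if B j = {} then 0 else \<zeta> (B j))"

text \<open>The factor \<open>unit_ball_vol p / 2 ^ p\<close> is the one for which the Hausdorff measure agrees with
  Lebesgue measure on \<open>p\<close>-dimensional subspaces.\<close>
definition hausdorff :: "nat \<Rightarrow> 'a::euclidean_space set \<Rightarrow> ennreal" where
  "hausdorff p = gauge_measure dist UNIV (\<lambda>S. ennreal (unit_ball_vol p / 2 ^ p) * ediam dist S ^ p)"

text \<open>By Caratheodory's criterion \<open>hausdorff p\<close> is countably additive on the Borel sets.\<close>
definition hausdorff_measure :: "nat \<Rightarrow> 'a::euclidean_space measure" where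
  "hausdorff_measure p = measure_of UNIV (sets borel) (hausdorff p)"

definition spherical :: "('a \<Rightarrow> 'a \<Rightarrow> real) \<Rightarrow> nat \<Rightarrow> 'a set \<Rightarrow> ennreal" where
  "spherical d \<alpha> =
     gauge_measure d {dball d x r |x r. 0 < r} (\<lambda>S. ediam d S ^ \<alpha> / 2 ^ \<alpha>)"

definition restr :: "('a set \<Rightarrow> ennreal) \<Rightarrow> 'a set \<Rightarrow> 'a set \<Rightarrow> ennreal" where
  "restr \<nu> A = (\<lambda>B. \<nu> (A \<inter> B))"


section \<open>Homogeneous subgroups and the spherical factor\<close>

text \<open>By the closed subgroup theorem, the (embedded) Lie subgroups are the closed subgroups. Subgroups
  that are invariant under dilations and vertical or horizontal are automatically closed: they are linear
  subspaces. Hence \<open>dim\<close> is the dimension of the group.\<close>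
definition homogeneous_subgroup :: "'n::finite heis set \<Rightarrow> bool" where
  "homogeneous_subgroup S \<longleftrightarrow>
     subgroup S heis_group \<and> closed S \<and> (\<forall>t>0. dil t ` S \<subseteq> S)"

definition vertical_subgroup :: "'n::finite heis set \<Rightarrow> bool" where
  "vertical_subgroup S \<longleftrightarrow> homogeneous_subgroup S \<and> H2 \<subseteq> S"

definition horizontal_subgroup :: "'n::finite heis set \<Rightarrow> bool" where
  "horizontal_subgroup S \<longleftrightarrow> homogeneous_subgroup S \<and> S \<subseteq> H1"

definition semidirect :: "'n::finite heis set \<Rightarrow> 'n heis set \<Rightarrow> bool" where
  "semidirect W V \<longleftrightarrow>
     vertical_subgroup W \<and> horizontal_subgroup V \<and>
     W <#>\<^bsub>heis_group\<^esub> V = UNIV \<and> W \<inter> V = {0}"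

definition projV :: "'n::finite heis set \<Rightarrow> 'n heis set \<Rightarrow> 'n heis \<Rightarrow> 'n heis" where
  "projV W V x = (THE v. v \<in> V \<and> (\<exists>w\<in>W. x = w \<cdot> v))"

text \<open>The supremum is attained.\<close>
definition spherical_factor ::
    "('n::finite heis \<Rightarrow> 'n heis \<Rightarrow> real) \<Rightarrow> nat \<Rightarrow> 'n heis set \<Rightarrow> ennreal" where
  "spherical_factor d p P = (SUP z\<in>dball d 0 1. hausdorff p (P \<inter> dball d z 1))"

definition omega_d :: "('n::finite heis \<Rightarrow> 'n heis \<Rightarrow> real) \<Rightarrow> nat \<Rightarrow> ennreal" where
  "omega_d d p =
     (THE c. \<forall>S. vertical_subgroup S \<and> dim S = p \<longrightarrow> spherical_factor d p S = c)"

text \<open>The dimension of a vertical subgroup is one less than its Hausdorff dimension \<open>\<alpha>\<close>.\<close>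
definition spherical_d :: "('n::finite heis \<Rightarrow> 'n heis \<Rightarrow> real) \<Rightarrow> nat \<Rightarrow> 'n heis set \<Rightarrow> ennreal" where
  "spherical_d d \<alpha> = (\<lambda>A. omega_d d (\<alpha> - 1) * spherical d \<alpha> A)"


section \<open>Multivectors\<close>

text \<open>The scalar product that \<open>\<bullet>\<close> induces on multivectors, on the simple multivectors given by two
  families of vectors. A simple multivector vanishes if and only if its norm does.\<close>
definition wedge_inner :: "('i::finite \<Rightarrow> 'a::real_inner) \<Rightarrow> ('i \<Rightarrow> 'a) \<Rightarrow> real" where
  "wedge_inner v w = det (\<chi> i j. v i \<bullet> w j)"

definition wedge_norm :: "('i::finite \<Rightarrow> 'a::real_inner) \<Rightarrow> real" where
  "wedge_norm v = sqrt (wedge_inner v v)"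

definition orthonormal_basis :: "('i::finite \<Rightarrow> 'a::real_inner) \<Rightarrow> 'a set \<Rightarrow> bool" where
  "orthonormal_basis v S \<longleftrightarrow>
     (\<forall>i j. v i \<bullet> v j = (if i = j then 1 else 0)) \<and> span (range v) = S"


section \<open>Differentiability on the Heisenberg group\<close>

definition h_hom :: "('n::finite heis \<Rightarrow> 'b::real_normed_vector) \<Rightarrow> bool" where
  "h_hom L \<longleftrightarrow>
     L \<in> hom heis_group \<lparr>carrier = UNIV, monoid.mult = (+), one = 0\<rparr> \<and>
     (\<forall>t>0. \<forall>w. L (dil t w) = t *\<^sub>R L w)"

definition h_hom_between ::
    "'n::finite heis set \<Rightarrow> 'n heis set \<Rightarrow> ('n heis \<Rightarrow> 'n heis) \<Rightarrow> bool" where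
  "h_hom_between W V L \<longleftrightarrow>
     L \<in> hom (heis_group\<lparr>carrier := W\<rparr>) (heis_group\<lparr>carrier := V\<rparr>) \<and>
     (\<forall>t>0. \<forall>w\<in>W. L (dil t w) = dil t (L w))"

definition has_h_derivative ::
    "('n::finite heis \<Rightarrow> 'n heis \<Rightarrow> real) \<Rightarrow> ('n heis \<Rightarrow> 'b::real_normed_vector) \<Rightarrow>
     ('n heis \<Rightarrow> 'b) \<Rightarrow> 'n heis \<Rightarrow> bool" where
  "has_h_derivative d f L x \<longleftrightarrow>
     h_hom L \<and> ((\<lambda>w. norm (f (x \<cdot> w) - f x - L w) / d w 0) \<longlongrightarrow> 0) (at 0)"

definition h_deriv ::
    "('n::finite heis \<Rightarrow> 'n heis \<Rightarrow> real) \<Rightarrow> ('n heis \<Rightarrow> 'b::real_normed_vector) \<Rightarrow>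
     'n heis \<Rightarrow> 'n heis \<Rightarrow> 'b" where
  "h_deriv d f x = (THE L. has_h_derivative d f L x)"

text \<open>Continuity of the differential is with respect to the topology of pointwise convergence. The
  h-homomorphisms form a finite-dimensional space, on which this is the usual topology.\<close>
definition C1h ::
    "('n::finite heis \<Rightarrow> 'n heis \<Rightarrow> real) \<Rightarrow> 'n heis set \<Rightarrow> ('n heis \<Rightarrow> 'b::real_normed_vector) \<Rightarrow> bool"
  where
  "C1h d \<Omega> f \<longleftrightarrow>
     open \<Omega> \<and> (\<forall>x\<in>\<Omega>. \<exists>L. has_h_derivative d f L x) \<and> continuous_on \<Omega> (h_deriv d f)"

definition grad_H ::
    "('n::finite heis \<Rightarrow> 'n heis \<Rightarrow> real) \<Rightarrow> ('n heis \<Rightarrow> real) \<Rightarrow> 'n heis \<Rightarrow> 'n heis" where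
  "grad_H d g x = (THE u. u \<in> H1 \<and> (\<forall>z. h_deriv d g x z = u \<bullet> z))"

definition grad_V ::
    "('n::finite heis \<Rightarrow> 'n heis \<Rightarrow> real) \<Rightarrow> 'n heis set \<Rightarrow> ('n heis \<Rightarrow> real) \<Rightarrow> 'n heis \<Rightarrow> 'n heis"
  where
  "grad_V d V g x = (THE u. u \<in> V \<and> (\<forall>z\<in>V. h_deriv d g x z = u \<bullet> z))"

definition J_H ::
    "('n::finite heis \<Rightarrow> 'n heis \<Rightarrow> real) \<Rightarrow> ('n heis \<Rightarrow> real^'k) \<Rightarrow> 'n heis \<Rightarrow> real" where
  "J_H d f x = wedge_norm (\<lambda>i. grad_H d (\<lambda>y. f y $ i) x)"

definition J_V ::
    "('n::finite heis \<Rightarrow> 'n heis \<Rightarrow> real) \<Rightarrow> 'n heis set \<Rightarrow> ('n heis \<Rightarrow> real^'k) \<Rightarrow> 'n heis \<Rightarrow> real"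
  where
  "J_V d V f x = wedge_norm (\<lambda>i. grad_V d V (\<lambda>y. f y $ i) x)"


section \<open>Regular surfaces\<close>

text \<open>The codimension is \<open>CARD('k)\<close>.\<close>
definition H_regular_surface ::
    "'k::finite itself \<Rightarrow> ('n::finite heis \<Rightarrow> 'n heis \<Rightarrow> real) \<Rightarrow> 'n heis set \<Rightarrow> bool" where
  "H_regular_surface _ d \<Sigma> \<longleftrightarrow>
     (\<forall>x\<in>\<Sigma>. \<exists>\<Omega> (h :: 'n heis \<Rightarrow> real^'k).
        x \<in> \<Omega> \<and> C1h d \<Omega> h \<and> \<Sigma> \<inter> \<Omega> = {y\<in>\<Omega>. h y = 0} \<and>
        (\<forall>y\<in>\<Omega>. wedge_norm (\<lambda>i. grad_H d (\<lambda>z. h z $ i) y) \<noteq> 0))"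

definition graph_map :: "('n::finite heis \<Rightarrow> 'n heis) \<Rightarrow> 'n heis \<Rightarrow> 'n heis" where
  "graph_map \<phi> w = w \<cdot> \<phi> w"

definition sigma_tr ::
    "'n::finite heis set \<Rightarrow> 'n heis set \<Rightarrow> 'n heis \<Rightarrow> 'n heis \<Rightarrow> 'n heis" where
  "sigma_tr W V x w = x \<cdot> w \<cdot> hinv (projV W V x)"

definition phi_tr ::
    "'n::finite heis set \<Rightarrow> 'n heis set \<Rightarrow> ('n heis \<Rightarrow> 'n heis) \<Rightarrow> 'n heis \<Rightarrow> 'n heis \<Rightarrow> 'n heis" where
  "phi_tr W V \<phi> x w = projV W V x \<cdot> \<phi> (sigma_tr W V (hinv x) w)"

text \<open>The inner supremum extends over those \<open>w\<close> at which the translated function is defined.\<close>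
definition unif_intrinsic_differentiable ::
    "('n::finite heis \<Rightarrow> 'n heis \<Rightarrow> real) \<Rightarrow> 'n heis set \<Rightarrow> 'n heis set \<Rightarrow> 'n heis set \<Rightarrow>
     ('n heis \<Rightarrow> 'n heis) \<Rightarrow> bool" where
  "unif_intrinsic_differentiable d W V U \<phi> \<longleftrightarrow>
     (\<forall>u\<in>U. \<exists>D. h_hom_between W V D \<and>
        ((\<lambda>\<delta>::real.
            SUP w'\<in>{w'\<in>U. d (hinv u \<cdot> w') 0 < \<delta>}.
            SUP w\<in>{w \<in> sigma_tr W V (hinv (graph_map \<phi> w')) ` U. 0 < d w 0 \<and> d w 0 < \<delta>}.
              ennreal (d (D w) (phi_tr W V \<phi> (hinv (graph_map \<phi> w')) w) / d w 0))
          \<longlongrightarrow> 0) (at_right 0))"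

definition parametrized_H_regular_surface ::
    "'k::finite itself \<Rightarrow> ('n::finite heis \<Rightarrow> 'n heis \<Rightarrow> real) \<Rightarrow> 'n heis set \<Rightarrow> 'n heis set \<Rightarrow>
     'n heis set \<Rightarrow> ('n heis \<Rightarrow> 'n heis) \<Rightarrow> 'n heis set \<Rightarrow> bool" where
  "parametrized_H_regular_surface K d W V U \<phi> \<Sigma> \<longleftrightarrow>
     H_regular_surface K d \<Sigma> \<and> semidirect W V \<and>
     openin (top_of_set W) U \<and> \<phi> ` U \<subseteq> V \<and>
     unif_intrinsic_differentiable d W V U \<phi> \<and> \<Sigma> = graph_map \<phi> ` U"

definition defining_function ::
    "('n::finite heis \<Rightarrow> 'n heis \<Rightarrow> real) \<Rightarrow> 'n heis set \<Rightarrow> 'n heis set \<Rightarrow> 'n heis set \<Rightarrow>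
     'n heis set \<Rightarrow> ('n heis \<Rightarrow> real^'k) \<Rightarrow> bool" where
  "defining_function d V U \<Sigma> \<Omega> f \<longleftrightarrow>
     C1h d \<Omega> f \<and> \<Sigma> \<subseteq> \<Omega> \<and>
     (\<exists>x0\<in>\<Sigma>. {x\<in>\<Omega>. f x = f x0} \<inter> (U <#>\<^bsub>heis_group\<^esub> V) = \<Sigma>) \<and>
     (\<forall>x\<in>\<Sigma>. surj (h_deriv d f x))"

end

theory Submission
  imports Defs
begin

text \<open>
  At \<open>x = \<Phi>(u)\<close> the graph is blown up: the map \<open>\<sigma>\<^sub>x\<close> is an affine shear of the vertical subgroup and
  preserves its Lebesgue measure, dilations scale that measure by \<open>t\<^bsup>2n+2-k\<^esup>\<close>, and by intrinsic
  differentiability the translated and rescaled graphs converge to the graph of the intrinsic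
  differential, which by the chain rule is the kernel of \<open>Df(x)\<close>. A determinant identity, obtained by
  pairing the basis of the splitting with the gradients of \<open>f\<close> and an orthonormal basis of the kernel,
  turns the Jacobian factor of \<open>\<mu>\<close> into the Euclidean measure on that kernel. So the upper
  density of \<open>\<mu>\<close> at \<open>x\<close> along closed balls that contain \<open>x\<close> and shrink to it is the spherical factor of a
  vertical subgroup, and by the symmetry of the distance it does not depend on \<open>x\<close>.

  A measure whose upper density along such balls is constant is that constant times the spherical
  measure: one inequality follows by an exhaustion by sets on which the density bound is uniform, the other from
  the \<open>5r\<close>-covering lemma and outer regularity.

  That the Hausdorff measure on a subspace is a multiple of Lebesgue measure with a positive finite factor
  is enough, because this factor cancels; no isodiametric inequality is needed.
\<close>

section \<open>Measures from coverings\<close>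

text \<open>Coverings for the spherical measure use balls centred anywhere, hence the density over
  all small balls that contain \<open>x\<close>. These are the balls of radius \<open>t\<close>
  about \<open>x \<cdot> dil t z\<close> with \<open>d z 0 \<le> 1\<close>, which is why the
  spherical factor is a supremum over centres \<open>z\<close> in the unit ball and not only the
  value at \<open>z = 0\<close>.

  The graph map of an intrinsically differentiable function need not be Euclidean Lipschitz, so the
  classical area formula is out of reach and only the blow-up at each point can be compared with a
  linear model. All volumes are computed in the isometric coordinates \<open>frame p\<close> of a
  vertical subgroup. There the translations, dilations, blow-ups and the passage to the kernel of
  the differential all have the form \<open>(a, s) \<mapsto> (A a, r s + g a)\<close> up to a
  constant translation, and the possibly nonlinear offset \<open>g\<close>, which carries the
  symplectic terms, does not affect Lebesgue measure.\<close>

definition gauge_pre ::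
    "('a \<Rightarrow> 'a \<Rightarrow> real) \<Rightarrow> 'a set set \<Rightarrow> ('a set \<Rightarrow> ennreal) \<Rightarrow> real \<Rightarrow> 'a set \<Rightarrow> ennreal" where
  "gauge_pre d F \<zeta> \<delta> A =
     (INF B\<in>{B :: nat \<Rightarrow> 'a set. range B \<subseteq> insert {} F \<and> A \<subseteq> (\<Union>j. B j) \<and>
                                   (\<forall>j. ediam d (B j) \<le> ennreal \<delta>)}.
          \<Sum>j. if B j = {} then 0 else \<zeta> (B j))"

lemma gauge_measure_eq_SUP: "gauge_measure d F \<zeta> A = (SUP \<delta>\<in>{0<..}. gauge_pre d F \<zeta> \<delta> A)"
  by (simp add: gauge_measure_def gauge_pre_def)

lemma ediam_empty [simp]: "ediam d {} = 0"
  by (simp add: ediam_def bot_ennreal)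

lemma ediam_mono: "A \<subseteq> B \<Longrightarrow> ediam d A \<le> ediam d B"
  unfolding ediam_def by (intro SUP_mono) (auto intro!: bexI SUP_mono)

lemma dist_le_ediam: "x \<in> A \<Longrightarrow> y \<in> A \<Longrightarrow> ennreal (d x y) \<le> ediam d A"
  unfolding ediam_def by (rule SUP_upper2[of x]) (auto intro: SUP_upper)

lemma ediam_le: "(\<And>x y. x \<in> A \<Longrightarrow> y \<in> A \<Longrightarrow> d x y \<le> r) \<Longrightarrow> ediam d A \<le> ennreal r"
  unfolding ediam_def by (intro SUP_least) (auto intro: ennreal_leI)

lemma gauge_pre_le:
  assumes "range B \<subseteq> insert {} F" "A \<subseteq> (\<Union>j. B j)" "\<And>j. ediam d (B j) \<le> ennreal \<delta>"
  shows "gauge_pre d F \<zeta> \<delta> A \<le> (\<Sum>j. if B j = {} then 0 else \<zeta> (B j))"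
  unfolding gauge_pre_def using assms by (intro INF_lower) auto

lemma gauge_pre_ge:
  assumes "\<And>B. range B \<subseteq> insert {} F \<Longrightarrow> A \<subseteq> (\<Union>j. B j) \<Longrightarrow> (\<And>j. ediam d (B j) \<le> ennreal \<delta>) \<Longrightarrow>
     c \<le> (\<Sum>j. if B j = {} then 0 else \<zeta> (B j))"
  shows "c \<le> gauge_pre d F \<zeta> \<delta> A"
  unfolding gauge_pre_def using assms by (intro INF_greatest) auto

lemma gauge_pre_approx:
  assumes "gauge_pre d F \<zeta> \<delta> A < c"
  obtains B where "range B \<subseteq> insert {} F" "A \<subseteq> (\<Union>j. B j)" "\<And>j. ediam d (B j) \<le> ennreal \<delta>"
     "(\<Sum>j. if B j = {} then 0 else \<zeta> (B j)) < c"
  using assms unfolding gauge_pre_def INF_less_iff by auto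

lemma gauge_pre_mono: "A \<subseteq> A' \<Longrightarrow> gauge_pre d F \<zeta> \<delta> A \<le> gauge_pre d F \<zeta> \<delta> A'"
  by (intro gauge_pre_ge gauge_pre_le) auto

lemma gauge_pre_antimono: "\<delta> \<le> \<delta>' \<Longrightarrow> gauge_pre d F \<zeta> \<delta>' A \<le> gauge_pre d F \<zeta> \<delta> A"
proof (rule gauge_pre_ge, rule gauge_pre_le)
  fix B j assume "\<delta> \<le> \<delta>'" and B: "\<And>j. ediam d (B j :: 'a set) \<le> ennreal \<delta>"
  then show "ediam d (B j) \<le> ennreal \<delta>'"
    by (intro order_trans[OF B] ennreal_leI)
qed

lemma gauge_pre_le_measure: "0 < \<delta> \<Longrightarrow> gauge_pre d F \<zeta> \<delta> A \<le> gauge_measure d F \<zeta> A"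
  unfolding gauge_measure_eq_SUP by (intro SUP_upper) auto

lemma gauge_pre_empty [simp]: "gauge_pre d F \<zeta> \<delta> {} = 0"
  using gauge_pre_le[of "\<lambda>_. {}" F "{}" d \<delta> \<zeta>] by simp

lemma gauge_measure_empty [simp]: "gauge_measure d F \<zeta> {} = 0"
  by (simp add: gauge_measure_eq_SUP)

lemma gauge_measure_mono: "A \<subseteq> A' \<Longrightarrow> gauge_measure d F \<zeta> A \<le> gauge_measure d F \<zeta> A'"
  unfolding gauge_measure_eq_SUP by (intro SUP_mono) (auto intro: gauge_pre_mono)

text \<open>Grid cells and Vitali families come with a countable index set instead of a sequence.
  Positions outside the image of the enumeration receive the empty set, which the gauge sum
  ignores.\<close>

lemma gauge_pre_le_countable:
  assumes "countable I" and C: "\<And>i. i \<in> I \<Longrightarrow> C i \<in> F" and A: "A \<subseteq> (\<Union>i\<in>I. C i)"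
    and \<delta>: "\<And>i. i \<in> I \<Longrightarrow> ediam d (C i) \<le> ennreal \<delta>"
  shows "gauge_pre d F \<zeta> \<delta> A \<le> (\<integral>\<^sup>+ i. \<zeta> (C i) \<partial>count_space I)"
proof -
  define N where "N = to_nat_on I ` I"
  define g where "g = from_nat_into I"
  have inj: "inj_on (to_nat_on I) I"
    using assms(1) by (rule inj_on_to_nat_on)
  have g: "g (to_nat_on I i) = i" if "i \<in> I" for i
    unfolding g_def using that assms(1) by simp
  have gI: "g j \<in> I" if "j \<in> N" for j
    using that g by (auto simp: N_def)
  define B where "B j = (if j \<in> N then C (g j) else {})" for j
  have "gauge_pre d F \<zeta> \<delta> A \<le> (\<Sum>j. if B j = {} then 0 else \<zeta> (B j))"
  proof (rule gauge_pre_le)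
    show "range B \<subseteq> insert {} F" using C gI by (auto simp: B_def)
    show "A \<subseteq> (\<Union>j. B j)"
    proof
      fix x assume "x \<in> A"
      then obtain i where "i \<in> I" "x \<in> C i" using A by auto
      then have "x \<in> B (to_nat_on I i)" by (auto simp: B_def N_def g)
      then show "x \<in> (\<Union>j. B j)" by blast
    qed
    show "ediam d (B j) \<le> ennreal \<delta>" for j using \<delta> gI by (auto simp: B_def)
  qed
  also have "\<dots> \<le> (\<Sum>j. \<zeta> (C (g j)) * indicator N j)"
    by (intro suminf_le) (auto simp: B_def)
  also have "\<dots> = (\<integral>\<^sup>+ j. \<zeta> (C (g j)) * indicator N j \<partial>count_space UNIV)"
    by (simp add: nn_integral_count_space_nat)
  also have "\<dots> = (\<integral>\<^sup>+ j. \<zeta> (C (g j)) \<partial>count_space N)"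
    by (simp add: nn_integral_count_space_indicator)
  also have "\<dots> = (\<integral>\<^sup>+ i. \<zeta> (C (g (to_nat_on I i))) \<partial>count_space I)"
    by (rule nn_integral_bij_count_space[symmetric]) (auto simp: N_def bij_betw_def inj)
  also have "\<dots> = (\<integral>\<^sup>+ i. \<zeta> (C i) \<partial>count_space I)"
    by (intro nn_integral_cong) (simp add: g)
  finally show ?thesis .
qed

lemma suminf_ennreal_half: "(\<Sum>i. ennreal (e * (1/2)^Suc i)) = ennreal e" if "0 \<le> e" for e
proof -
  have "(\<lambda>i. e * (1/2)^Suc i) sums (e * 1)"
    by (intro sums_mult power_half_series)
  then show ?thesis using that by (subst suminf_ennreal_eq) (auto simp: zero_le_mult_iff)
qed

text \<open>Merge coverings of the pieces that exceed their infima by at most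
  \<open>e * (1/2)^Suc i\<close>, which sum to \<open>e\<close>; the pairing of natural numbers
  lines them up in one sequence.\<close>

lemma gauge_pre_subadditive:
  "gauge_pre d F \<zeta> \<delta> (\<Union>i::nat. A i) \<le> (\<Sum>i. gauge_pre d F \<zeta> \<delta> (A i))"
proof (rule ennreal_le_epsilon)
  fix e :: real assume fin: "(\<Sum>i. gauge_pre d F \<zeta> \<delta> (A i)) < Orderings.top" and e: "0 < e"
  define Q where "Q i B \<longleftrightarrow> range B \<subseteq> insert {} F \<and> A i \<subseteq> (\<Union>j. B j) \<and>
     (\<forall>j. ediam d (B j) \<le> ennreal \<delta>) \<and>
     (\<Sum>j. if B j = {} then 0 else \<zeta> (B j)) < gauge_pre d F \<zeta> \<delta> (A i) + ennreal (e * (1/2)^Suc i)"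
    for i and B :: "nat \<Rightarrow> 'a set"
  have "\<exists>B. Q i B" for i
  proof -
    \<comment> \<open>A covering that nearly attains the infimum requires a finite infimum;
      \<open>ennreal_le_epsilon\<close> allows the sum to be taken finite.\<close>
    have "gauge_pre d F \<zeta> \<delta> (A i) \<noteq> Orderings.top"
      using ennreal_suminf_lessD[OF fin, of i] by simp
    then have "gauge_pre d F \<zeta> \<delta> (A i) < gauge_pre d F \<zeta> \<delta> (A i) + ennreal (e * (1/2)^Suc i)"
      using e by (simp add: ennreal_add_left_cancel_less less_top)
    then obtain B where "Q i B" unfolding Q_def by (rule gauge_pre_approx) blast
    then show ?thesis by blast
  qed
  then obtain B where Q: "\<And>i. Q i (B i)" using choice[of Q] by blast
  have B: "\<And>i::nat. range (B i) \<subseteq> insert {} F" "\<And>i. A i \<subseteq> (\<Union>j. B i j)"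
      "\<And>i j. ediam d (B i j) \<le> ennreal \<delta>"
      "\<And>i. (\<Sum>j. if B i j = {} then 0 else \<zeta> (B i j)) \<le>
              gauge_pre d F \<zeta> \<delta> (A i) + ennreal (e * (1/2)^Suc i)"
    using Q unfolding Q_def by (auto intro: less_imp_le)
  define f where "f = (\<lambda>(i, j). if B i j = {} then 0 else \<zeta> (B i j))"
  define C where "C n = (case prod_decode n of (i, j) \<Rightarrow> B i j)" for n
  have "gauge_pre d F \<zeta> \<delta> (\<Union>i. A i) \<le> (\<Sum>n. if C n = {} then 0 else \<zeta> (C n))"
  proof (rule gauge_pre_le)
    show "range C \<subseteq> insert {} F"
    proof -
      have "B i j \<in> insert {} F" for i j using B(1)[of i] by auto
      then show ?thesis unfolding C_def image_subset_iff by (simp split: prod.splits)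
    qed
    show "(\<Union>i. A i) \<subseteq> (\<Union>j. C j)"
    proof
      fix x assume "x \<in> (\<Union>i. A i)"
      then obtain i j where "x \<in> B i j" using B(2) by blast
      then have "x \<in> C (prod_encode (i, j))" by (simp add: C_def)
      then show "x \<in> (\<Union>j. C j)" by blast
    qed
    show "ediam d (C j) \<le> ennreal \<delta>" for j
      using B(3) by (auto simp: C_def split: prod.splits)
  qed
  also have "\<dots> = (\<Sum>n. f (prod_decode n))"
    by (intro suminf_cong) (auto simp: C_def f_def split: prod.splits)
  also have "\<dots> = (\<Sum>i. \<Sum>j. f (i, j))"
    by (rule suminf_ennreal_2dimen) simp
  also have "\<dots> \<le> (\<Sum>i. gauge_pre d F \<zeta> \<delta> (A i) + ennreal (e * (1/2)^Suc i))"
    using B(4) by (intro suminf_le) (auto simp: f_def)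
  also have "\<dots> = (\<Sum>i. gauge_pre d F \<zeta> \<delta> (A i)) + ennreal e"
    by (subst suminf_add[symmetric]) (simp_all only: suminf_ennreal_half[OF less_imp_le[OF e]] summableI)
  finally show "gauge_pre d F \<zeta> \<delta> (\<Union>i. A i) \<le> (\<Sum>i. gauge_pre d F \<zeta> \<delta> (A i)) + ennreal e" .
qed

lemma gauge_measure_subadditive:
  "gauge_measure d F \<zeta> (\<Union>i::nat. A i) \<le> (\<Sum>i. gauge_measure d F \<zeta> (A i))"
proof -
  have "gauge_pre d F \<zeta> \<delta> (\<Union>i. A i) \<le> (\<Sum>i. gauge_measure d F \<zeta> (A i))" if "\<delta> > 0" for \<delta>
  proof -
    note gauge_pre_subadditive
    also have "(\<Sum>i. gauge_pre d F \<zeta> \<delta> (A i)) \<le> (\<Sum>i. gauge_measure d F \<zeta> (A i))"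
      using that by (intro suminf_le gauge_pre_le_measure) auto
    finally show ?thesis .
  qed
  then show ?thesis by (subst gauge_measure_eq_SUP) (auto intro!: SUP_least)
qed

lemma gauge_measure_subadditive2:
  "gauge_measure d F \<zeta> (A \<union> B) \<le> gauge_measure d F \<zeta> A + gauge_measure d F \<zeta> B"
proof -
  have "gauge_measure d F \<zeta> (\<Union>i. binaryset A B i) \<le> (\<Sum>i. gauge_measure d F \<zeta> (binaryset A B i))"
    by (rule gauge_measure_subadditive)
  also have "\<dots> = gauge_measure d F \<zeta> A + gauge_measure d F \<zeta> B"
    by (rule suminf_binaryset_eq) simp
  finally show ?thesis by (simp add: UN_binaryset_eq)
qed

text \<open>A set of diameter at most \<open>\<delta>\<close> cannot meet both parts, so an
  admissible covering of the union splits into two subfamilies without common members, one for each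
  part.\<close>

lemma gauge_pre_separated:
  assumes F: "F = UNIV" and sep: "\<And>a b. a \<in> A \<Longrightarrow> b \<in> B \<Longrightarrow> \<eta> \<le> d a b" and \<delta>: "0 < \<delta>" "\<delta> < \<eta>"
  shows "gauge_pre d F \<zeta> \<delta> A + gauge_pre d F \<zeta> \<delta> B \<le> gauge_pre d F \<zeta> \<delta> (A \<union> B)"
proof (rule gauge_pre_ge)
  fix C :: "nat \<Rightarrow> 'a set" assume C: "A \<union> B \<subseteq> (\<Union>j. C j)" "\<And>j. ediam d (C j) \<le> ennreal \<delta>"
  define CA where "CA j = (if C j \<inter> A = {} then {} else C j)" for j
  define CB where "CB j = (if C j \<inter> B = {} then {} else C j)" for j
  have one: "C j \<inter> A = {} \<or> C j \<inter> B = {}" for j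
  proof (rule ccontr)
    assume "\<not> ?thesis"
    then obtain a b where ab: "a \<in> C j" "a \<in> A" "b \<in> C j" "b \<in> B" by blast
    have "ennreal (d a b) \<le> ennreal \<delta>"
      using dist_le_ediam[OF ab(1,3), of d] C(2)[of j] by (rule order_trans)
    then have "d a b \<le> \<delta>" using \<delta> by (simp add: ennreal_le_iff)
    then show False using sep[OF ab(2,4)] \<delta> by simp
  qed
  have "gauge_pre d F \<zeta> \<delta> A \<le> (\<Sum>j. if CA j = {} then 0 else \<zeta> (CA j))"
    using C by (intro gauge_pre_le) (auto simp: CA_def F, blast)
  moreover have "gauge_pre d F \<zeta> \<delta> B \<le> (\<Sum>j. if CB j = {} then 0 else \<zeta> (CB j))"
    using C by (intro gauge_pre_le) (auto simp: CB_def F, blast)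
  ultimately have "gauge_pre d F \<zeta> \<delta> A + gauge_pre d F \<zeta> \<delta> B \<le>
     (\<Sum>j. (if CA j = {} then 0 else \<zeta> (CA j)) + (if CB j = {} then 0 else \<zeta> (CB j)))"
    by (subst suminf_add[symmetric]) (auto intro: add_mono)
  also have "\<dots> \<le> (\<Sum>j. if C j = {} then 0 else \<zeta> (C j))"
    using one by (intro suminf_le) (auto simp: CA_def CB_def)
  finally show "gauge_pre d F \<zeta> \<delta> A + gauge_pre d F \<zeta> \<delta> B \<le> \<dots>" .
qed

lemma gauge_measure_separated:
  assumes sep: "\<And>a b. a \<in> A \<Longrightarrow> b \<in> B \<Longrightarrow> \<eta> \<le> d a b" and \<eta>: "0 < \<eta>"
  shows "gauge_measure d UNIV \<zeta> A + gauge_measure d UNIV \<zeta> B \<le> gauge_measure d UNIV \<zeta> (A \<union> B)"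
proof -
  have "gauge_pre d UNIV \<zeta> \<delta> A + gauge_pre d UNIV \<zeta> \<delta>' B \<le> gauge_measure d UNIV \<zeta> (A \<union> B)"
    if "0 < \<delta>" "0 < \<delta>'" for \<delta> \<delta>'
  proof -
    define e where "e = min (\<eta>/2) (min \<delta> \<delta>')"
    have e: "0 < e" "e < \<eta>" "e \<le> \<delta>" "e \<le> \<delta>'" using that \<eta> by (auto simp: e_def)
    have "gauge_pre d UNIV \<zeta> \<delta> A + gauge_pre d UNIV \<zeta> \<delta>' B \<le>
       gauge_pre d UNIV \<zeta> e A + gauge_pre d UNIV \<zeta> e B"
      using e by (intro add_mono gauge_pre_antimono)
    also have "\<dots> \<le> gauge_pre d UNIV \<zeta> e (A \<union> B)"
      using e sep by (intro gauge_pre_separated) auto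
    also have "\<dots> \<le> gauge_measure d UNIV \<zeta> (A \<union> B)"
      using e by (intro gauge_pre_le_measure)
    finally show ?thesis .
  qed
  then have "(SUP \<delta>'\<in>{0<..}. SUP \<delta>\<in>{0<..}. gauge_pre d UNIV \<zeta> \<delta> A + gauge_pre d UNIV \<zeta> \<delta>' B) \<le>
      gauge_measure d UNIV \<zeta> (A \<union> B)"
    by (auto intro!: SUP_least)
  then show ?thesis
    unfolding gauge_measure_eq_SUP[of d UNIV \<zeta> A] gauge_measure_eq_SUP[of d UNIV \<zeta> B]
    by (simp add: ennreal_SUP_add_left ennreal_SUP_add_right)
qed

section \<open>Caratheodory's criterion for metric outer measures\<close>

lemma ennreal_suminf_tail_small:
  fixes f :: "nat \<Rightarrow> ennreal"
  assumes "suminf f < \<infinity>" and e: "0 < e"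
  obtains N where "(\<Sum>i. f (i + N)) \<le> ennreal e"
proof -
  have fin: "f i \<noteq> Orderings.top" for i
    using assms(1) by (metis ennreal_suminf_lessD infinity_ennreal_def less_irrefl)
  define g where "g i = enn2real (f i)" for i
  have f: "f i = ennreal (g i)" for i using fin[of i] by (simp add: g_def less_top)
  have g0: "0 \<le> g i" for i by (simp add: g_def)
  have sm: "summable g"
    using assms(1) g0 by (intro summable_suminf_not_top) (auto simp: f[abs_def])
  from suminf_exist_split[OF e sm] obtain N where N: "norm (\<Sum>i. g (i + N)) < e" by auto
  have "(\<Sum>i. f (i + N)) = ennreal (\<Sum>i. g (i + N))"
    unfolding f using sm g0 by (intro suminf_ennreal2) (auto simp: summable_iff_shift)
  then show ?thesis using N by (intro that[of N]) (auto intro!: ennreal_leI)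
qed

text \<open>The part \<open>E n\<close> of \<open>T - C\<close> at distance at least
  \<open>1 / Suc n\<close> from \<open>C\<close> is separated from \<open>C\<close>, so additivity
  holds for it. What it misses is a union of shells \<open>R i\<close> with large index, and their
  measures are the tail of a convergent series.\<close>

lemma metric_outer_measure_closed:
  fixes \<mu> :: "'a::metric_space set \<Rightarrow> ennreal"
  assumes empty: "\<mu> {} = 0" and mono: "\<And>A B. A \<subseteq> B \<Longrightarrow> \<mu> A \<le> \<mu> B"
    and subadd: "\<And>A. \<mu> (\<Union>i::nat. A i) \<le> (\<Sum>i. \<mu> (A i))"
    and subadd2: "\<And>A B. \<mu> (A \<union> B) \<le> \<mu> A + \<mu> B"
    and sep: "\<And>A B \<eta>. 0 < \<eta> \<Longrightarrow> (\<And>a b. a \<in> A \<Longrightarrow> b \<in> B \<Longrightarrow> \<eta> \<le> dist a b) \<Longrightarrow> \<mu> A + \<mu> B \<le> \<mu> (A \<union> B)"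
    and C: "closed C"
  shows "\<mu> (T \<inter> C) + \<mu> (T - C) \<le> \<mu> T"
\<comment> \<open>\<open>infdist x {}\<close> is \<open>0\<close> by convention, so for empty
  \<open>C\<close> every layer \<open>E n\<close> would be empty.\<close>
proof (cases "C = {} \<or> \<mu> T = \<infinity>")
  case True
  then show ?thesis by (auto simp: empty)
next
  case False
  then have ne: "C \<noteq> {}" and fin: "\<mu> T < \<infinity>" by (auto simp: less_top)
  define E where "E n = {x \<in> T. 1 / real (Suc n) \<le> infdist x C}" for n
  define R where "R n = E (Suc n) - E n" for n
  have E_mono: "E n \<subseteq> E m" if "n \<le> m" for n m
  proof -
    have "1 / real (Suc m) \<le> 1 / real (Suc n)" using that by (intro frac_le) auto
    then show ?thesis by (auto simp: E_def)
  qed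
  have E_T: "E n \<subseteq> T - C" for n
  proof -
    have "infdist x C = 0" if "x \<in> C" for x using that by simp
    then show ?thesis unfolding E_def by (auto simp: not_le) 
  qed
  have E_cover: "\<exists>n. x \<in> E n" if "x \<in> T - C" for x
  proof -
    have "0 < infdist x C"
      using that C ne in_closed_iff_infdist_zero[of C x] infdist_nonneg[of x C] by auto
    then obtain n where "1 / real (Suc n) < infdist x C" using nat_approx_posE by metis
    then show ?thesis using that by (auto simp: E_def intro!: exI[of _ n])
  qed
  have R_sep: "1 / real (Suc m) - 1 / real (Suc (Suc m)) \<le> dist a b"
    if "a \<in> E m" "b \<in> R (Suc m)" for m a b
  proof -
    have "infdist b C < 1 / real (Suc (Suc m))"
      using that(2) by (auto simp: R_def E_def)
    moreover have "1 / real (Suc m) \<le> infdist a C" using that(1) by (auto simp: E_def)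
    moreover have "infdist a C \<le> infdist b C + dist a b" by (rule infdist_triangle)
    ultimately show ?thesis by linarith
  qed
  \<comment> \<open>Neighbouring shells may touch, but shells whose indices differ by two are
    separated. Summing over one parity at a time, selected by \<open>e\<close>, keeps all partial
    sums below \<open>\<mu> T\<close>.\<close>
  have R_sum: "(\<Sum>i<n. \<mu> (R (2 * i + Suc e))) \<le> \<mu> (E (2 * n + e))" for n e
  proof (induction n)
    case (Suc n)
    have "(\<Sum>i<Suc n. \<mu> (R (2 * i + Suc e))) \<le> \<mu> (E (2 * n + e)) + \<mu> (R (Suc (2 * n + e)))"
      using Suc by (simp add: add_right_mono)
    also have "\<dots> \<le> \<mu> (E (2 * n + e) \<union> R (Suc (2 * n + e)))"
    proof (rule sep)
      show "0 < 1 / real (Suc (2 * n + e)) - 1 / real (Suc (Suc (2 * n + e)))"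
        by (simp add: frac_less2)
    qed (use R_sep in blast)
    also have "\<dots> \<le> \<mu> (E (2 * Suc n + e))"
      using E_mono[of "2 * n + e" "2 * Suc n + e"]
      by (intro mono) (auto simp: R_def)
    finally show ?case .
  qed simp
  have R_suminf: "(\<Sum>i. \<mu> (R (2 * i + Suc e))) \<le> \<mu> T" for e
  proof (rule suminf_le_const)
    show "(\<Sum>i<n. \<mu> (R (2 * i + Suc e))) \<le> \<mu> T" for n
      using E_T by (intro order_trans[OF R_sum mono]) auto
  qed simp
  define f where "f i = \<mu> (R (2 * i + Suc 0)) + \<mu> (R (2 * i + Suc 1))" for i
  have "suminf f = (\<Sum>i. \<mu> (R (2 * i + Suc 0))) + (\<Sum>i. \<mu> (R (2 * i + Suc 1)))"
    unfolding f_def by (rule suminf_add[symmetric]) auto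
  also have "\<dots> \<le> \<mu> T + \<mu> T" by (intro add_mono R_suminf)
  also have "\<dots> < \<infinity>" using fin by simp
  finally have f_fin: "suminf f < \<infinity>" .
  show ?thesis
  proof (rule ennreal_le_epsilon)
    fix e :: real assume "0 < e"
    from ennreal_suminf_tail_small[OF f_fin this] obtain N where N: "(\<Sum>i. f (i + N)) \<le> ennreal e" .
    have "T - C \<subseteq> E (2 * N + 1) \<union> (\<Union>i. R (2 * (i + N) + Suc 0) \<union> R (2 * (i + N) + Suc 1))"
    proof
      fix x assume "x \<in> T - C"
      then have ex: "\<exists>n. x \<in> E n" by (rule E_cover)
      define n where "n = (LEAST n. x \<in> E n)"
      have n: "x \<in> E n" unfolding n_def using ex by (rule LeastI_ex)
      show "x \<in> E (2 * N + 1) \<union> (\<Union>i. R (2 * (i + N) + Suc 0) \<union> R (2 * (i + N) + Suc 1))"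
      proof (cases "n \<le> 2 * N + 1")
        case True
        then show ?thesis using E_mono n by blast
      next
        case False
        then obtain m where m: "n = Suc m" "2 * N + 1 \<le> m" by (cases n) auto
        have "x \<notin> E m" using not_less_Least[of m "\<lambda>n. x \<in> E n"] m by (simp add: n_def)
        then have "x \<in> R m" using n m by (simp add: R_def)
        moreover have "\<exists>i. m = 2 * (i + N) + Suc 0 \<or> m = 2 * (i + N) + Suc 1"
          using m(2) by presburger
        ultimately show ?thesis by blast
      qed
    qed
    then have "\<mu> (T - C) \<le> \<mu> (E (2 * N + 1) \<union> (\<Union>i. R (2 * (i + N) + Suc 0) \<union> R (2 * (i + N) + Suc 1)))"
      by (rule mono)
    also have "\<dots> \<le> \<mu> (E (2 * N + 1)) + (\<Sum>i. \<mu> (R (2 * (i + N) + Suc 0) \<union> R (2 * (i + N) + Suc 1)))"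
      by (intro order_trans[OF subadd2] add_left_mono subadd)
    also have "\<dots> \<le> \<mu> (E (2 * N + 1)) + (\<Sum>i. f (i + N))"
      by (intro add_left_mono suminf_le) (auto simp: f_def subadd2)
    also have "\<dots> \<le> \<mu> (E (2 * N + 1)) + ennreal e"
      using N by (intro add_left_mono)
    finally have 1: "\<mu> (T - C) \<le> \<mu> (E (2 * N + 1)) + ennreal e" .
    have "\<mu> (T \<inter> C) + \<mu> (E (2 * N + 1)) \<le> \<mu> ((T \<inter> C) \<union> E (2 * N + 1))"
    proof (rule sep)
      show "0 < 1 / real (Suc (2 * N + 1))" by simp
      fix a b assume "a \<in> T \<inter> C" "b \<in> E (2 * N + 1)"
      then show "1 / real (Suc (2 * N + 1)) \<le> dist a b"
        using infdist_le[of a C b] by (auto simp: E_def dist_commute)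
    qed
    also have "\<dots> \<le> \<mu> T" using E_T by (intro mono) auto
    finally have 2: "\<mu> (T \<inter> C) + \<mu> (E (2 * N + 1)) \<le> \<mu> T" .
    have "\<mu> (T \<inter> C) + \<mu> (T - C) \<le> \<mu> (T \<inter> C) + (\<mu> (E (2 * N + 1)) + ennreal e)"
      using 1 by (rule add_left_mono)
    also have "\<dots> \<le> \<mu> T + ennreal e"
      using 2 by (simp add: add.assoc[symmetric] add_right_mono)
    finally show "\<mu> (T \<inter> C) + \<mu> (T - C) \<le> \<mu> T + ennreal e" .
  qed
qed

text \<open>The sets that split every test set additively form a sigma-algebra on which
  \<open>\<mu>\<close> is a measure; it contains the closed sets, hence all Borel sets.\<close>

lemma measure_space_metric_outer_measure:
  fixes \<mu> :: "'a::metric_space set \<Rightarrow> ennreal"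
  assumes empty: "\<mu> {} = 0" and mono: "\<And>A B. A \<subseteq> B \<Longrightarrow> \<mu> A \<le> \<mu> B"
    and subadd: "\<And>A. \<mu> (\<Union>i::nat. A i) \<le> (\<Sum>i. \<mu> (A i))"
    and subadd2: "\<And>A B. \<mu> (A \<union> B) \<le> \<mu> A + \<mu> B"
    and sep: "\<And>A B \<eta>. 0 < \<eta> \<Longrightarrow> (\<And>a b. a \<in> A \<Longrightarrow> b \<in> B \<Longrightarrow> \<eta> \<le> dist a b) \<Longrightarrow> \<mu> A + \<mu> B \<le> \<mu> (A \<union> B)"
  shows "measure_space UNIV (sets borel) \<mu>"
proof -
  interpret P: sigma_algebra UNIV "Pow UNIV :: 'a set set" by (rule sigma_algebra_Pow)
  have "outer_measure_space (Pow UNIV) \<mu>"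
    using empty mono subadd
    by (auto simp: outer_measure_space_def positive_def increasing_def countably_subadditive_def)
  then have ms: "measure_space UNIV (lambda_system UNIV (Pow UNIV) \<mu>) \<mu>"
    by (rule P.caratheodory_lemma)
  then have sa: "sigma_algebra UNIV (lambda_system UNIV (Pow UNIV) \<mu>)"
    by (simp add: measure_space_def)
  have "C \<in> lambda_system UNIV (Pow UNIV) \<mu>" if "closed C" for C
  proof -
    have "\<mu> (T \<inter> C) + \<mu> (T - C) = \<mu> T" for T
    proof (rule antisym)
      show "\<mu> (T \<inter> C) + \<mu> (T - C) \<le> \<mu> T"
        by (rule metric_outer_measure_closed[OF empty mono subadd subadd2 sep that])
      show "\<mu> T \<le> \<mu> (T \<inter> C) + \<mu> (T - C)"
        using subadd2[of "T \<inter> C" "T - C"] by (simp add: Int_Diff_Un)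
    qed
    then show ?thesis by (simp only: P.lambda_system_eq) simp
  qed
  then have "sigma_sets UNIV {C :: 'a set. closed C} \<subseteq> lambda_system UNIV (Pow UNIV) \<mu>"
    using sa by (intro sigma_algebra.sigma_sets_subset) auto
  moreover have "sets (borel :: 'a measure) = sigma_sets UNIV {C. closed C}"
    by (simp add: borel_eq_closed)
  ultimately have sub: "sets (borel :: 'a measure) \<subseteq> lambda_system UNIV (Pow UNIV) \<mu>" by simp
  show ?thesis
    by (rule measure_down[OF ms _ sub]) (metis sets.sigma_algebra_axioms space_borel)
qed

section \<open>Hausdorff measure as a Borel measure\<close>

lemma hausdorff_eq_gauge:
  "hausdorff p = gauge_measure dist UNIV (\<lambda>S. ennreal (unit_ball_vol p / 2 ^ p) * ediam dist S ^ p)"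
  by (rule hausdorff_def)

lemma measure_space_hausdorff:
  "measure_space UNIV (sets borel) (hausdorff p :: 'a::euclidean_space set \<Rightarrow> ennreal)"
proof (rule measure_space_metric_outer_measure)
  fix A B :: "'a set" and \<eta> :: real
  assume "0 < \<eta>" and "\<And>a b. a \<in> A \<Longrightarrow> b \<in> B \<Longrightarrow> \<eta> \<le> dist a b"
  then show "hausdorff p A + hausdorff p B \<le> hausdorff p (A \<union> B)"
    unfolding hausdorff_eq_gauge by (intro gauge_measure_separated) auto
qed (auto simp: hausdorff_eq_gauge intro: gauge_measure_mono gauge_measure_subadditive gauge_measure_subadditive2)

text \<open>\<open>measure_of\<close> returns the given set function only if that is a measure on
  the sigma-algebra, so \<open>hausdorff_measure\<close> takes its intended values only by virtue of
  Caratheodory's criterion.\<close>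

lemma sets_hausdorff_measure [simp, measurable_cong]:
    "sets (hausdorff_measure p :: 'a::euclidean_space measure) = sets borel"
  and space_hausdorff_measure [simp]: "space (hausdorff_measure p :: 'a measure) = UNIV"
  and emeasure_hausdorff_measure:
    "A \<in> sets borel \<Longrightarrow> emeasure (hausdorff_measure p) A = hausdorff p (A :: 'a set)"
proof -
  have sb: "sigma_sets UNIV (sets (borel :: 'a measure)) = sets borel"
    using sets.sigma_sets_eq[of "borel :: 'a measure"] by simp
  show "sets (hausdorff_measure p :: 'a measure) = sets borel"
    by (simp add: hausdorff_measure_def sets_measure_of_conv sb)
  show "space (hausdorff_measure p :: 'a measure) = UNIV"
    by (simp add: hausdorff_measure_def space_measure_of_conv)
  show "emeasure (hausdorff_measure p) A = hausdorff p A" if "A \<in> sets borel"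
    using measure_space_hausdorff[of p, where 'a='a] that unfolding hausdorff_measure_def
    by (intro emeasure_measure_of_sigma) (auto simp: measure_space_def)
qed

lemma ediam_isometry:
  assumes "\<And>x y. dist (\<iota> x) (\<iota> y) = dist x y"
  shows "ediam dist (\<iota> ` S) = ediam dist S"
  by (simp add: ediam_def assms image_image)

text \<open>Coverings push forward along \<open>\<iota>\<close> and pull back by preimages, whose
  diameters do not grow. As \<open>\<iota>\<close> may fail to be onto, this carries the measure on
  a subspace back to its coordinates.\<close>

lemma hausdorff_isometry:
  fixes \<iota> :: "'a::euclidean_space \<Rightarrow> 'b::euclidean_space"
  assumes \<iota>: "\<And>x y. dist (\<iota> x) (\<iota> y) = dist x y"
  shows "hausdorff p (\<iota> ` E) = hausdorff p E"
proof -
  let ?\<zeta> = "\<lambda>S :: 'a set. ennreal (unit_ball_vol p / 2 ^ p) * ediam dist S ^ p"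
  let ?\<xi> = "\<lambda>S :: 'b set. ennreal (unit_ball_vol p / 2 ^ p) * ediam dist S ^ p"
  have "gauge_pre dist UNIV ?\<xi> \<delta> (\<iota> ` E) = gauge_pre dist UNIV ?\<zeta> \<delta> E" for \<delta>
  proof (rule antisym)
    show "gauge_pre dist UNIV ?\<xi> \<delta> (\<iota> ` E) \<le> gauge_pre dist UNIV ?\<zeta> \<delta> E"
    proof (rule gauge_pre_ge)
      fix B :: "nat \<Rightarrow> 'a set" assume B: "E \<subseteq> (\<Union>j. B j)" "\<And>j. ediam dist (B j) \<le> ennreal \<delta>"
      have "gauge_pre dist UNIV ?\<xi> \<delta> (\<iota> ` E) \<le> (\<Sum>j. if \<iota> ` B j = {} then 0 else ?\<xi> (\<iota> ` B j))"
        using B by (intro gauge_pre_le) (auto simp: ediam_isometry[OF \<iota>], blast)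
      then show "gauge_pre dist UNIV ?\<xi> \<delta> (\<iota> ` E) \<le> (\<Sum>j. if B j = {} then 0 else ?\<zeta> (B j))"
        by (simp add: ediam_isometry[OF \<iota>] cong: if_cong)
    qed
    show "gauge_pre dist UNIV ?\<zeta> \<delta> E \<le> gauge_pre dist UNIV ?\<xi> \<delta> (\<iota> ` E)"
    proof (rule gauge_pre_ge)
      fix B :: "nat \<Rightarrow> 'b set" assume B: "\<iota> ` E \<subseteq> (\<Union>j. B j)" "\<And>j. ediam dist (B j) \<le> ennreal \<delta>"
      have le: "ediam dist (\<iota> -` B j) \<le> ediam dist (B j)" for j
        unfolding ediam_isometry[OF \<iota>, symmetric] by (rule ediam_mono) auto
      have "gauge_pre dist UNIV ?\<zeta> \<delta> E \<le> (\<Sum>j. if \<iota> -` B j = {} then 0 else ?\<zeta> (\<iota> -` B j))"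
        using B by (intro gauge_pre_le) (auto intro: order_trans[OF le], blast)
      also have "\<dots> \<le> (\<Sum>j. if B j = {} then 0 else ?\<xi> (B j))"
        using le by (intro suminf_le) (auto intro!: mult_left_mono power_mono)
      finally show "gauge_pre dist UNIV ?\<zeta> \<delta> E \<le> (\<Sum>j. if B j = {} then 0 else ?\<xi> (B j))" .
    qed
  qed
  then show ?thesis by (simp add: hausdorff_eq_gauge gauge_measure_eq_SUP)
qed

text \<open>Uniqueness of Haar measure: integrate \<open>1_A(x) 1_Q(y - x)\<close> against both
  measures. Integrating over \<open>y\<close> first gives \<open>M A\<close>. Translating
  \<open>x\<close> by \<open>y\<close> beforehand and then integrating over \<open>y\<close> first
  gives \<open>emeasure lborel A\<close> times the \<open>M\<close>-measure of the reflected
  cube.\<close>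

lemma translation_invariant_eq_lborel:
  fixes M :: "'a::euclidean_space measure"
  assumes M [measurable_cong]: "sets M = sets borel"
    and ti: "\<And>x. distr M borel ((+) x) = M"
    and fin: "emeasure M (cbox 0 One) < \<infinity>"
    and A [measurable]: "A \<in> sets borel"
  shows "emeasure M A = emeasure M (cbox 0 One) * emeasure lborel A"
proof -
  let ?Q = "cbox 0 One :: 'a set"
  have [simp]: "space M = UNIV" using sets_eq_imp_space_eq[OF M] by simp
  have ti_set: "emeasure M ((\<lambda>y. x + y) -` B) = emeasure M B" if [measurable]: "B \<in> sets borel" for x B
    by (subst (2) ti[of x, symmetric]) (simp add: emeasure_distr)
  obtain D :: "'a set" where D: "countable D" "\<And>X. open X \<Longrightarrow> X \<noteq> {} \<Longrightarrow> \<exists>x\<in>D. x \<in> X"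
    using countable_dense_setE by blast
  \<comment> \<open>Fubini needs this. Translates of the cube by the points of a countable dense set
    cover the space and have finite measure.\<close>
  interpret sigma_finite_measure M
  proof
    let ?\<Q> = "(\<lambda>x. (\<lambda>y. - x + y) -` ?Q) ` D"
    have "y \<in> \<Union> ?\<Q>" for y
    proof -
      have "open ((\<lambda>x. - x + y) -` box 0 One)"
        by (intro open_vimage open_box continuous_intros)
      moreover have "y - (1/2) *\<^sub>R One \<in> (\<lambda>x. - x + y) -` box 0 One"
        by (auto simp: mem_box)
      ultimately obtain x where "x \<in> D" "- x + y \<in> box 0 One" using D(2) by blast
      then show ?thesis using box_subset_cbox by blast
    qed
    moreover have "(\<lambda>y. - x + y) -` ?Q \<in> sets M" for x
      using measurable_sets[of "\<lambda>y. - x + y" borel borel ?Q] by (simp add: M)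
    moreover have "emeasure M ((\<lambda>y. - x + y) -` ?Q) \<noteq> \<infinity>" for x
      using ti_set[of ?Q "- x"] fin by simp
    ultimately show "\<exists>A. countable A \<and> A \<subseteq> sets M \<and> \<Union> A = space M \<and> (\<forall>a\<in>A. emeasure M a \<noteq> \<infinity>)"
      using D(1) fin by (intro exI[of _ ?\<Q>]) auto
  qed
  interpret pair_sigma_finite M lborel ..
  \<comment> \<open>The reflected cube is a translate of the cube.\<close>
  have neg: "emeasure M (uminus -` ?Q) = emeasure M ?Q"
  proof -
    have "uminus -` ?Q = (\<lambda>y. One + y) -` ?Q"
      by (force simp: mem_box inner_add_left)
    then show ?thesis by (simp add: ti_set)
  qed
  have "emeasure M A = (\<integral>\<^sup>+x. indicator A x * emeasure lborel ((\<lambda>y. - x + y) -` ?Q) \<partial>M)"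
  proof -
    have "emeasure lborel ((\<lambda>y. - x + y) -` ?Q) = 1" for x :: 'a
    proof -
      have "emeasure lborel ((\<lambda>y. - x + y) -` ?Q) = emeasure lborel ?Q"
        by (subst (2) lborel_distr_plus[of "-x", symmetric]) (simp add: emeasure_distr)
      also have "\<dots> = 1" by simp
      finally show ?thesis .
    qed
    then show ?thesis by simp
  qed
  also have "\<dots> = (\<integral>\<^sup>+x. \<integral>\<^sup>+y. indicator A x * indicator ?Q (- x + y) \<partial>lborel \<partial>M)"
  proof (rule nn_integral_cong)
    fix x :: 'a
    have "(\<lambda>y. - x + y) -` ?Q \<in> sets borel"
      using measurable_sets[of "\<lambda>y. - x + y" borel borel ?Q] by simp
    then have "emeasure lborel ((\<lambda>y. - x + y) -` ?Q) = (\<integral>\<^sup>+y. indicator ((\<lambda>y. - x + y) -` ?Q) y \<partial>lborel)"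
      by simp
    also have "\<dots> = (\<integral>\<^sup>+y. indicator ?Q (- x + y) \<partial>lborel)"
      by (intro nn_integral_cong) (auto split: split_indicator)
    finally show "indicator A x * emeasure lborel ((\<lambda>y. - x + y) -` ?Q) =
        (\<integral>\<^sup>+y. indicator A x * indicator ?Q (- x + y) \<partial>lborel)"
      by (simp only: nn_integral_cmult borel_measurable_indicator) (subst nn_integral_cmult, measurable)
  qed
  also have "\<dots> = (\<integral>\<^sup>+y. \<integral>\<^sup>+x. indicator A x * indicator ?Q (- x + y) \<partial>M \<partial>lborel)"
    by (rule Fubini'[symmetric]) measurable
  also have "\<dots> = (\<integral>\<^sup>+y. \<integral>\<^sup>+x. indicator A (y + x) * indicator ?Q (- x) \<partial>M \<partial>lborel)"
  proof (rule nn_integral_cong)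
    fix y :: 'a
    have "(\<integral>\<^sup>+x. indicator A x * indicator ?Q (- x + y) \<partial>M) =
        (\<integral>\<^sup>+x. indicator A x * indicator ?Q (- x + y) \<partial>distr M borel ((+) y))"
      by (simp add: ti)
    also have "\<dots> = (\<integral>\<^sup>+x. indicator A (y + x) * indicator ?Q (- (y + x) + y) \<partial>M)"
      by (rule nn_integral_distr) measurable
    finally show "(\<integral>\<^sup>+x. indicator A x * indicator ?Q (- x + y) \<partial>M) =
        (\<integral>\<^sup>+x. indicator A (y + x) * indicator ?Q (- x) \<partial>M)" by simp
  qed
  also have "\<dots> = (\<integral>\<^sup>+x. \<integral>\<^sup>+y. indicator A (y + x) * indicator ?Q (- x) \<partial>lborel \<partial>M)"
    by (rule Fubini'[where f="\<lambda>x y. indicator A (y + x) * indicator ?Q (- x)"]) measurable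
  also have "\<dots> = (\<integral>\<^sup>+x. emeasure lborel A * indicator (uminus -` ?Q) x \<partial>M)"
  proof (rule nn_integral_cong)
    fix x :: 'a
    have "(\<integral>\<^sup>+y. indicator A (y + x) * indicator ?Q (- x) \<partial>lborel) =
        (\<integral>\<^sup>+y. indicator A (x + y) \<partial>lborel) * indicator ?Q (- x)"
      by (simp add: nn_integral_multc add.commute)
    also have "(\<integral>\<^sup>+y. indicator A (x + y) \<partial>lborel) = (\<integral>\<^sup>+y. indicator A y \<partial>distr lborel borel ((+) x))"
      by (rule nn_integral_distr[symmetric]) measurable
    also have "\<dots> = emeasure lborel A" by (simp add: lborel_distr_plus)
    finally show "(\<integral>\<^sup>+y. indicator A (y + x) * indicator ?Q (- x) \<partial>lborel) =
        emeasure lborel A * indicator (uminus -` ?Q) x" by (simp add: indicator_def)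
  qed
  also have "\<dots> = emeasure lborel A * emeasure M (uminus -` ?Q)"
    using measurable_sets[of uminus borel borel ?Q] by (intro nn_integral_cmult_indicator) (simp add: M)
  finally show ?thesis by (simp add: neg mult.commute)
qed

definition hausdorff_const :: "'a::euclidean_space itself \<Rightarrow> ennreal" where
  "hausdorff_const _ = hausdorff DIM('a) (cbox 0 One :: 'a set)"

text \<open>Cut the cube into cells of side \<open>1 / N\<close>. Each has diameter at most
  \<open>D / N\<close> by the l1 bound on the norm, so in the sum over all \<open>N ^ D\<close>
  cells \<open>N\<close> cancels and \<open>K\<close> bounds it for every
  \<open>\<delta>\<close>.\<close>

lemma hausdorff_const_finite: "hausdorff_const TYPE('a::euclidean_space) < \<infinity>"
proof -
  let ?D = "DIM('a)"
  define K where "K = unit_ball_vol ?D / 2 ^ ?D * real ?D ^ ?D"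
  have K: "0 \<le> K" by (simp add: K_def)
  let ?\<zeta> = "\<lambda>S :: 'a set. ennreal (unit_ball_vol ?D / 2 ^ ?D) * ediam dist S ^ ?D"
  have "gauge_pre dist UNIV ?\<zeta> \<delta> (cbox 0 One :: 'a set) \<le> ennreal K" if "\<delta> > 0" for \<delta>
  proof -
    obtain N :: nat where N: "real ?D / \<delta> < real N" using reals_Archimedean2 by blast
    have N0: "0 < N" using N that by (cases N) (auto simp: zero_less_divide_iff divide_less_0_iff not_less[symmetric])
    have ND: "real ?D / real N \<le> \<delta>" using N N0 that by (simp add: field_simps)
    define I where "I = (Basis :: 'a set) \<rightarrow>\<^sub>E {..<N}"
    define C where "C k = {x :: 'a. \<forall>b\<in>Basis. real (k b) / N \<le> x \<bullet> b \<and> x \<bullet> b \<le> (real (k b) + 1) / N}" for k :: "'a \<Rightarrow> nat"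
    have finI: "finite I" unfolding I_def by (intro finite_PiE) auto
    have cardI: "card I = N ^ ?D" by (simp add: I_def card_PiE)
    have diam: "ediam dist (C k) \<le> ennreal (real ?D / real N)" for k
    proof (rule ediam_le)
      fix x y assume xy: "x \<in> C k" "y \<in> C k"
      have "\<bar>(x - y) \<bullet> b\<bar> \<le> 1 / N" if "b \<in> Basis" for b
        using xy that N0 by (fastforce simp: C_def inner_diff_left abs_le_iff add_divide_distrib)
      then have "(\<Sum>b\<in>Basis. \<bar>(x - y) \<bullet> b\<bar>) \<le> (\<Sum>b\<in>(Basis::'a set). 1 / N)" by (intro sum_mono)
      then show "dist x y \<le> real ?D / real N"
        using norm_le_l1[of "x - y"] by (simp add: dist_norm)
    qed
    have cov: "(cbox 0 One :: 'a set) \<subseteq> (\<Union>k\<in>I. C k)"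
    proof
      fix x :: 'a assume x: "x \<in> cbox 0 One"
      \<comment> \<open>A coordinate equal to \<open>1\<close> would receive the cell number
        \<open>N\<close>, one beyond the last. It goes into the last cell, whose upper face is
        closed.\<close>
      define k where "k = restrict (\<lambda>b. if x \<bullet> b = 1 then N - 1 else nat \<lfloor>N * (x \<bullet> b)\<rfloor>) Basis"
      have "k b < N \<and> real (k b) / N \<le> x \<bullet> b \<and> x \<bullet> b \<le> (real (k b) + 1) / N" if "b \<in> Basis" for b
      proof -
        have b: "0 \<le> x \<bullet> b" "x \<bullet> b \<le> 1" using x that by (auto simp: mem_box)
        show ?thesis
        proof (cases "x \<bullet> b = 1")
          case True
          then show ?thesis using N0 that by (simp add: k_def of_nat_diff)
        next
          case False
          then have "N * (x \<bullet> b) < N" using b N0 by simp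
          then have "nat \<lfloor>N * (x \<bullet> b)\<rfloor> < N" using b by (simp add: nat_less_iff floor_less_iff)
          moreover have "real (nat \<lfloor>N * (x \<bullet> b)\<rfloor>) \<le> N * (x \<bullet> b)" using b by simp
          moreover have "N * (x \<bullet> b) \<le> real (nat \<lfloor>N * (x \<bullet> b)\<rfloor>) + 1" using b by linarith
          ultimately show ?thesis using N0 that False by (simp add: k_def field_simps)
        qed
      qed
      then have "x \<in> C k" "k \<in> I" by (auto simp: C_def I_def k_def)
      then show "x \<in> (\<Union>k\<in>I. C k)" by blast
    qed
    have "gauge_pre dist UNIV ?\<zeta> \<delta> (cbox 0 One :: 'a set) \<le> (\<integral>\<^sup>+ k. ?\<zeta> (C k) \<partial>count_space I)"
      using finI cov by (intro gauge_pre_le_countable)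
        (auto intro: order_trans[OF diam] ennreal_leI ND countable_finite)
    also have "\<dots> \<le> (\<integral>\<^sup>+ k. ennreal (unit_ball_vol ?D / 2 ^ ?D * (real ?D / real N) ^ ?D) \<partial>count_space I)"
    proof (intro nn_integral_mono)
      fix k
      have "?\<zeta> (C k) \<le> ennreal (unit_ball_vol ?D / 2 ^ ?D) * ennreal (real ?D / real N) ^ ?D"
        using diam by (intro mult_left_mono power_mono) auto
      then show "?\<zeta> (C k) \<le> ennreal (unit_ball_vol ?D / 2 ^ ?D * (real ?D / real N) ^ ?D)"
        by (simp add: ennreal_power ennreal_mult[symmetric])
    qed
    also have "\<dots> = ennreal (unit_ball_vol ?D / 2 ^ ?D * (real ?D / real N) ^ ?D) * of_nat (N ^ ?D)"
      using finI by (simp add: emeasure_count_space_finite cardI)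
    also have "\<dots> = ennreal K"
      using N0 by (simp add: ennreal_of_nat_eq_real_of_nat ennreal_mult[symmetric] K_def power_divide del: of_nat_power) simp
    finally show ?thesis .
  qed
  then have "hausdorff_const TYPE('a) \<le> ennreal K"
    by (auto simp: hausdorff_const_def hausdorff_eq_gauge gauge_measure_eq_SUP intro!: SUP_least)
  then show ?thesis by (simp add: le_less_trans)
qed

lemma hausdorff_eq_lborel:
  assumes A: "A \<in> sets borel"
  shows "hausdorff DIM('a) A = hausdorff_const TYPE('a) * emeasure lborel (A :: 'a::euclidean_space set)"
proof -
  let ?H = "hausdorff_measure DIM('a) :: 'a measure"
  have "emeasure ?H A = emeasure ?H (cbox 0 One) * emeasure lborel A"
  proof (rule translation_invariant_eq_lborel[OF _ _ _ A])
    show "distr ?H borel ((+) x) = ?H" for x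
    proof (rule measure_eqI)
      fix B :: "'a set" assume "B \<in> sets (distr ?H borel ((+) x))"
      then have B: "B \<in> sets borel" by simp
      have "(+) x -` B \<in> sets borel" using measurable_sets[of "(+) x" borel borel B] B by simp
      moreover have "hausdorff DIM('a) ((+) x -` B) = hausdorff DIM('a) B"
        using hausdorff_isometry[of "(+) x" "DIM('a)" "(+) x -` B"]
        by (simp add: image_vimage_eq surj_plus)
      ultimately show "emeasure (distr ?H borel ((+) x)) B = emeasure ?H B"
        using B by (simp add: emeasure_distr emeasure_hausdorff_measure)
    qed simp
    show "emeasure ?H (cbox 0 One) < \<infinity>"
      using hausdorff_const_finite[where 'a='a] by (simp add: emeasure_hausdorff_measure hausdorff_const_def)
  qed simp
  then show ?thesis using A by (simp add: emeasure_hausdorff_measure hausdorff_const_def)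
qed

lemma hausdorff_const_pos: "0 < hausdorff_const TYPE('a::euclidean_space)"
proof -
  let ?D = "DIM('a)"
  let ?\<zeta> = "\<lambda>S :: 'a set. ennreal (unit_ball_vol ?D / 2 ^ ?D) * ediam dist S ^ ?D"
  \<comment> \<open>A ball of radius \<open>r\<close> about a point of \<open>S\<close>, and not of
    radius \<open>r / 2\<close>, costs a factor \<open>2 ^ D\<close> that is harmless for
    positivity. Closures make the covering sets measurable.\<close>
  have ball: "emeasure lborel (closure S) \<le> 2 ^ ?D * ?\<zeta> S" if S: "S \<noteq> {}" "ediam dist S \<le> 1" for S :: "'a set"
  proof -
    obtain x where x: "x \<in> S" using S(1) by blast
    obtain r where r: "0 \<le> r" "ediam dist S = ennreal r"
      using S(2) by (cases "ediam dist S") (auto simp: top_unique)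
    have "S \<subseteq> cball x r"
      using dist_le_ediam[OF x, of _ dist] r by (auto simp: ennreal_le_iff)
    then have "closure S \<subseteq> cball x r" by (rule closure_minimal) simp
    then have "emeasure lborel (closure S) \<le> emeasure lborel (cball x r)"
      by (intro emeasure_mono) auto
    also have "\<dots> = ennreal (unit_ball_vol ?D * r ^ ?D)" using r(1) by (rule emeasure_cball)
    also have "\<dots> = 2 ^ ?D * ?\<zeta> S"
      using r by (simp add: ennreal_power ennreal_mult[symmetric] flip: ennreal_numeral mult.assoc)
    finally show ?thesis .
  qed
  have "ennreal (1 / 2 ^ ?D) \<le> gauge_pre dist UNIV ?\<zeta> 1 (cbox 0 One :: 'a set)"
  proof (rule gauge_pre_ge)
    fix B :: "nat \<Rightarrow> 'a set"
    assume B: "cbox 0 One \<subseteq> (\<Union>j. B j)" "\<And>j. ediam dist (B j) \<le> ennreal 1"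
    let ?s = "\<Sum>j. if B j = {} then 0 else ?\<zeta> (B j)"
    have "1 = emeasure lborel (cbox 0 One :: 'a set)" by simp
    also have "\<dots> \<le> emeasure lborel (\<Union>j. closure (B j))"
      using B(1) closure_subset by (intro emeasure_mono) (blast, auto)
    also have "\<dots> \<le> (\<Sum>j. emeasure lborel (closure (B j)))"
      by (rule emeasure_subadditive_countably) auto
    also have "\<dots> \<le> (\<Sum>j. 2 ^ ?D * (if B j = {} then 0 else ?\<zeta> (B j)))"
      using ball B(2) by (intro suminf_le) auto
    also have "\<dots> = 2 ^ ?D * ?s"
      by (rule ennreal_suminf_cmult)
    finally have "ennreal (1 / 2 ^ ?D) * 1 \<le> ennreal (1 / 2 ^ ?D) * (2 ^ ?D * ?s)"
      by (rule mult_left_mono) simp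
    also have "\<dots> = ennreal (1 / 2 ^ ?D * 2 ^ ?D) * ?s"
      by (subst ennreal_mult) (auto simp: mult.assoc simp flip: ennreal_power)
    finally show "ennreal (1 / 2 ^ ?D) \<le> ?s" by simp
  qed
  also have "\<dots> \<le> hausdorff_const TYPE('a)"
    unfolding hausdorff_const_def hausdorff_eq_gauge by (intro gauge_pre_le_measure) auto
  finally show ?thesis by (rule less_le_trans[rotated]) simp
qed

section \<open>Determinants and linear changes of variables\<close>

text \<open>In the Leibniz expansion a permutation contributes only if it maps
  \<open>range g\<close> into itself; it then permutes both blocks, and such permutations correspond
  to pairs. The blocks are given by injections so that sum and option types can serve as index
  sets.\<close>

lemma det_block_triangular:
  fixes M :: "'a::comm_ring_1^'c^'c" and f :: "'i::finite \<Rightarrow> 'c::finite" and g :: "'j::finite \<Rightarrow> 'c"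
  assumes f: "inj f" and g: "inj g" and disj: "range f \<inter> range g = {}" and un: "range f \<union> range g = UNIV"
    and zero: "\<And>i j. M $ g j $ f i = 0"
  shows "det M = det (\<chi> i j. M $ f i $ f j) * det (\<chi> i j. M $ g i $ g j)"
proof -
  define \<Psi> where "\<Psi> = (\<lambda>(p, q). map_permutation UNIV f p \<circ> map_permutation UNIV g q)"
  define S where "S = {p. p permutes (UNIV :: 'c set) \<and> (\<forall>j. p (g j) \<in> range g)}"
  let ?P = "{p. p permutes (UNIV :: 'i set)} \<times> {q. q permutes (UNIV :: 'j set)}"
  have nfg: "f i \<noteq> g j" for i j using disj by blast
  have ap_f: "\<Psi> (p, q) (f i) = f (p i)" for p q i
  proof -
    have "f i \<notin> range g" using disj by blast
    then have "map_permutation UNIV g q (f i) = f i"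
      by (simp add: map_permutation_def restrict_id_def)
    then show ?thesis by (simp add: \<Psi>_def map_permutation_apply[OF f])
  qed
  have ap_g: "\<Psi> (p, q) (g j) = g (q j)" for p q j
  proof -
    have "g (q j) \<notin> range f" using disj by blast
    then have "map_permutation UNIV f p (g (q j)) = g (q j)"
      by (simp add: map_permutation_def restrict_id_def)
    then show ?thesis by (simp add: \<Psi>_def map_permutation_apply[OF g])
  qed
  have perm_f: "map_permutation UNIV f p permutes UNIV" if "p permutes UNIV" for p
    using map_permutation_permutes[of f UNIV "range f" p] f that
    by (auto simp: bij_betw_def intro: permutes_subset)
  have perm_g: "map_permutation UNIV g p permutes UNIV" if "p permutes UNIV" for p
    using map_permutation_permutes[of g UNIV "range g" p] g that
    by (auto simp: bij_betw_def intro: permutes_subset)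
  have perm_\<Psi>: "\<Psi> pq permutes UNIV" if "pq \<in> ?P" for pq
    using that perm_f perm_g by (auto simp: \<Psi>_def intro!: permutes_compose)
  have sign_\<Psi>: "sign (\<Psi> (p, q)) = sign p * sign q" if "p permutes UNIV" "q permutes UNIV" for p q
    using that perm_f[of p] perm_g[of q] f g
    by (simp add: \<Psi>_def sign_compose permutation_permutes[THEN iffD2] sign_map_permutation exI[of _ UNIV])
  have inj_\<Psi>: "inj_on \<Psi> ?P"
  proof (rule inj_onI, clarify)
    fix p q p' q' assume eq: "\<Psi> (p, q) = \<Psi> (p', q')"
    have "p i = p' i" for i using ap_f[of p q i] ap_f[of p' q' i] eq f by (simp add: inj_eq)
    moreover have "q j = q' j" for j using ap_g[of p q j] ap_g[of p' q' j] eq g by (simp add: inj_eq)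
    ultimately show "p = p' \<and> q = q'" by (simp add: fun_eq_iff)
  qed
  have img_\<Psi>: "\<Psi> ` ?P = S"
  proof (intro equalityI subsetI)
    fix r assume "r \<in> \<Psi> ` ?P"
    then obtain p q where "p permutes UNIV" "q permutes UNIV" "r = \<Psi> (p, q)" by auto
    then show "r \<in> S" using perm_\<Psi>[of "(p, q)"] by (auto simp: S_def ap_g)
  next
    fix r assume r: "r \<in> S"
    have rinj: "inj r" using r by (auto simp: S_def permutes_inj)
    define q where "q j = inv_into UNIV g (r (g j))" for j
    have q: "r (g j) = g (q j)" for j using r by (auto simp: S_def q_def f_inv_into_f)
    have "inj q" by (rule injI) (metis rinj g q injD)
    then have bq: "bij q" by (simp add: bij_def finite_UNIV_inj_surj)
    \<comment> \<open>By finiteness \<open>r\<close> maps \<open>range g\<close> onto itself, so by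
      injectivity nothing from outside can land there.\<close>
    have "r (f i) \<in> range f" for i
    proof (rule ccontr)
      assume "r (f i) \<notin> range f"
      then obtain j where "r (f i) = g j" using un by blast
      moreover obtain j' where "q j' = j" using bq by (metis bij_pointE)
      ultimately have "r (f i) = r (g j')" by (simp add: q)
      then show False using rinj nfg by (metis injD)
    qed
    then have p: "\<exists>i'. r (f i) = f i'" for i by blast
    define p where "p i = inv_into UNIV f (r (f i))" for i
    have p: "r (f i) = f (p i)" for i using p[of i] f by (auto simp: p_def)
    have "inj p" by (rule injI) (metis rinj f p injD)
    then have bp: "bij p" by (simp add: bij_def finite_UNIV_inj_surj)
    have "r = \<Psi> (p, q)"
    proof
      fix x
      consider i where "x = f i" | j where "x = g j" using un by blast
      then show "r x = \<Psi> (p, q) x" by cases (auto simp: ap_f ap_g p q)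
    qed
    moreover have "p permutes UNIV" "q permutes UNIV" using bp bq by (auto intro: bij_imp_permutes)
    ultimately show "r \<in> \<Psi> ` ?P" by (auto intro!: image_eqI[of _ _ "(p, q)"])
  qed
  have prod_\<Psi>: "(\<Prod>i\<in>UNIV. M $ i $ \<Psi> (p, q) i) = (\<Prod>i\<in>UNIV. M $ f i $ f (p i)) * (\<Prod>j\<in>UNIV. M $ g j $ g (q j))" for p q
  proof -
    have "(\<Prod>i\<in>UNIV. M $ i $ \<Psi> (p, q) i) = (\<Prod>i\<in>range f. M $ i $ \<Psi> (p, q) i) * (\<Prod>i\<in>range g. M $ i $ \<Psi> (p, q) i)"
      unfolding un[symmetric] using disj by (intro prod.union_disjoint) auto
    then show ?thesis by (simp add: prod.reindex[OF f] prod.reindex[OF g] ap_f ap_g)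
  qed
  have "det M = (\<Sum>r\<in>{r. r permutes UNIV}. of_int (sign r) * (\<Prod>i\<in>UNIV. M $ i $ r i))"
    by (simp add: det_def)
  also have "\<dots> = (\<Sum>r\<in>S. of_int (sign r) * (\<Prod>i\<in>UNIV. M $ i $ r i))"
  proof (rule sum.mono_neutral_right)
    show "\<forall>r\<in>{r. r permutes UNIV} - S. of_int (sign r) * (\<Prod>i\<in>UNIV. M $ i $ r i) = 0"
    proof
      fix r :: "'c \<Rightarrow> 'c" assume "r \<in> {r. r permutes UNIV} - S"
      then obtain j where "r (g j) \<notin> range g" by (auto simp: S_def)
      then obtain i where "r (g j) = f i" using un by blast
      then have "M $ g j $ r (g j) = 0" using zero by simp
      then have "(\<Prod>i\<in>UNIV. M $ i $ r i) = 0" by (intro prod_zero) auto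
      then show "of_int (sign r) * (\<Prod>i\<in>UNIV. M $ i $ r i) = 0" by simp
    qed
  qed (auto simp: S_def finite_permutations)
  also have "\<dots> = (\<Sum>pq\<in>?P. of_int (sign (\<Psi> pq)) * (\<Prod>i\<in>UNIV. M $ i $ \<Psi> pq i))"
    unfolding img_\<Psi>[symmetric] using inj_\<Psi> by (simp add: sum.reindex)
  also have "\<dots> = (\<Sum>(p, q)\<in>?P. (of_int (sign p) * (\<Prod>i\<in>UNIV. M $ f i $ f (p i))) *
       (of_int (sign q) * (\<Prod>j\<in>UNIV. M $ g j $ g (q j))))"
    by (rule sum.cong) (auto simp: prod_\<Psi> sign_\<Psi> algebra_simps)
  also have "\<dots> = det (\<chi> i j. M $ f i $ f j) * det (\<chi> i j. M $ g i $ g j)"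
    by (simp add: det_def sum_product sum.cartesian_product)
  finally show ?thesis .
qed

text \<open>\<open>m\<close> sends a family to its matrix of coordinates in an orthonormal basis
  indexed by \<open>'i\<close>. The existential hides the choice of that indexing.\<close>

lemma pairing_eq_matrix_mult:
  assumes "CARD('i::finite) = DIM('a::euclidean_space)"
  shows "\<exists>m :: ('i \<Rightarrow> 'a) \<Rightarrow> real^'i^'i. \<forall>X Y. (\<chi> i j. X i \<bullet> Y j) = m X ** transpose (m Y)"
proof -
  obtain b :: "'i \<Rightarrow> 'a" where b: "bij_betw b UNIV Basis"
    using finite_same_card_bij[of "UNIV :: 'i set" "Basis :: 'a set"] assms by auto
  have inner: "x \<bullet> y = (\<Sum>l\<in>UNIV. (x \<bullet> b l) * (y \<bullet> b l))" for x y :: 'a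
    by (subst euclidean_inner) (rule sum.reindex_bij_betw[OF b, symmetric])
  show ?thesis
    by (rule exI[of _ "\<lambda>X. \<chi> i l. X i \<bullet> b l"])
      (simp add: vec_eq_iff matrix_matrix_mult_def transpose_def inner[symmetric])
qed

lemma wedge_norm_nonneg:
  assumes "CARD('i::finite) = DIM('a::euclidean_space)"
  shows "0 \<le> wedge_norm (X :: 'i \<Rightarrow> 'a)"
proof -
  obtain m :: "('i \<Rightarrow> 'a) \<Rightarrow> real^'i^'i" where "\<forall>X Y. (\<chi> i j. X i \<bullet> Y j) = m X ** transpose (m Y)"
    using pairing_eq_matrix_mult[OF assms] by blast
  then show ?thesis by (simp add: wedge_norm_def wedge_inner_def det_mul)
qed

text \<open>Multivectors of top degree form a line, on which the Cauchy-Schwarz inequality is an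
  equality.\<close>

lemma det_pairing:
  fixes X Y :: "'i::finite \<Rightarrow> 'a::euclidean_space"
  assumes "CARD('i) = DIM('a)"
  shows "\<bar>det (\<chi> i j. X i \<bullet> Y j)\<bar> = wedge_norm X * wedge_norm Y"
proof -
  obtain m :: "('i \<Rightarrow> 'a) \<Rightarrow> real^'i^'i" where "\<forall>X Y. (\<chi> i j. X i \<bullet> Y j) = m X ** transpose (m Y)"
    using pairing_eq_matrix_mult[OF assms] by blast
  then show ?thesis by (simp add: wedge_norm_def wedge_inner_def det_mul abs_mult)
qed

text \<open>To be read with \<open>g\<close> the gradients, \<open>q\<close> an orthonormal basis of
  the horizontal part of their common kernel, and \<open>u\<close> the vectors \<open>w\<close>
  moved along \<open>v\<close> into that kernel. Adding multiples of \<open>v\<close> leaves the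
  multivector of \<open>(v, e, w)\<close> unchanged, and the pairing of \<open>(v, e, u)\<close>
  with \<open>(g, e, q)\<close> is block triangular. Since \<open>e\<close> and \<open>q\<close> are
  orthonormal and orthogonal to \<open>g\<close>, the second family has the norm of
  \<open>g\<close>.\<close>

lemma wedge_norm_unipotent_graph:
  fixes v g :: "'k::finite \<Rightarrow> 'a::euclidean_space" and w q u :: "'m::finite \<Rightarrow> 'a"
  assumes card: "CARD('k) + CARD('m) + 1 = DIM('a)"
    and e: "e \<bullet> e = 1" "\<And>i. e \<bullet> g i = 0" "\<And>i. e \<bullet> v i = 0" "\<And>j. e \<bullet> u j = 0" "\<And>j. e \<bullet> q j = 0"
    and q: "\<And>i j. q i \<bullet> q j = (if i = j then 1 else 0)" "\<And>i j. q j \<bullet> g i = 0"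
    and u: "\<And>j. u j = w j + (\<Sum>i\<in>UNIV. r j i *\<^sub>R v i)" "\<And>i j. u j \<bullet> g i = 0"
  shows "\<bar>det (\<chi> i j. v i \<bullet> g j)\<bar> * \<bar>det (\<chi> i j. u i \<bullet> q j)\<bar> =
     wedge_norm (case_sum v (case_option e w)) * wedge_norm g"
proof -
  define X where "X = case_sum v (case_option e w)"
  define X' where "X' = case_sum v (case_option e u)"
  define Y where "Y = case_sum g (case_option e q)"
  \<comment> \<open>The change of basis from \<open>X\<close> to \<open>X'\<close>: the identity
    plus the entries \<open>r j l\<close> in one off-diagonal block, hence of determinant
    \<open>1\<close>.\<close>
  define R where "R i i' = (if i = i' then 1 else
     case (i, i') of (Inr (Some j), Inl l) \<Rightarrow> r j l | _ \<Rightarrow> 0)" for i i' :: "'k + 'm option"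
  have cardI: "CARD('k + 'm option) = DIM('a)" using card by simp
  have sum_I: "(\<Sum>i\<in>UNIV. h i) = (\<Sum>i\<in>UNIV. h (Inl i)) + h (Inr None) + (\<Sum>j\<in>UNIV. h (Inr (Some j)))"
    for h :: "'k + 'm option \<Rightarrow> 'a"
  proof -
    have "(\<Sum>i\<in>UNIV. h i) = (\<Sum>i\<in>UNIV <+> UNIV. h i)" by (simp only: UNIV_Plus_UNIV)
    also have "\<dots> = (\<Sum>i\<in>UNIV. h (Inl i)) + (\<Sum>j\<in>UNIV. h (Inr j))" by (subst sum.Plus) (auto simp: o_def)
    also have "(\<Sum>j\<in>UNIV. h (Inr j)) = (\<Sum>j\<in>insert None (range Some). h (Inr j))"
      by (simp only: UNIV_option_conv)
    also have "\<dots> = h (Inr None) + (\<Sum>j\<in>UNIV. h (Inr (Some j)))"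
      by (simp add: sum.reindex)
    finally show ?thesis by (simp add: add.assoc)
  qed
  have X': "X' i = (\<Sum>i'\<in>UNIV. R i i' *\<^sub>R X i')" for i
  proof (cases i)
    case (Inl l)
    have "R i (Inl l') *\<^sub>R X (Inl l') = (if l' = l then v l' else 0)" for l'
      by (auto simp: R_def X_def Inl)
    then show ?thesis by (simp add: sum_I) (simp add: R_def X'_def Inl)
  next
    case (Inr o')
    then show ?thesis
    proof (cases o')
      case None
      then show ?thesis using Inr by (simp add: sum_I X_def R_def X'_def)
    next
      case (Some j)
      have "R i (Inr (Some j')) *\<^sub>R X (Inr (Some j')) = (if j' = j then w j' else 0)" for j'
        by (auto simp: R_def X_def Inr Some)
      then show ?thesis by (simp add: sum_I) (simp add: R_def X_def X'_def u(1) Inr Some)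
    qed
  qed
  have Inr_Inl: "x \<in> range (Inr :: 'm option \<Rightarrow> _)" if "x \<notin> range Inl" for x :: "'k + 'm option"
    using that by (cases x) auto
  \<comment> \<open>The block of \<open>None\<close> has a single index, supplied by the type
    \<open>1\<close>.\<close>
  have opt: "det (\<chi> i j. N i j) = N None None * det (\<chi> i j. N (Some i) (Some j))"
    if "\<And>j. N (Some j) None = 0" for N :: "'m option \<Rightarrow> 'm option \<Rightarrow> real"
  proof -
    have "det (\<chi> i j. N i j) = det (\<chi> (i::1) (j::1). N None None) * det (\<chi> i j. N (Some i) (Some j))"
      by (subst det_block_triangular[of "\<lambda>_::1. None" Some])
        (auto simp: that inj_def UNIV_option_conv[symmetric] num1_eq_iff)
    then show ?thesis by (simp add: det_def)
  qed
  have det_R: "det (\<chi> i j. R i j) = 1"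
  proof -
    have "det (\<chi> i j. R i j) = det (\<chi> i j. R (Inr i) (Inr j)) * det (\<chi> i j. R (Inl i) (Inl j))"
      by (subst det_block_triangular[of Inr Inl]) (auto simp: R_def dest: Inr_Inl)
    also have "(\<chi> i j. R (Inr i) (Inr j)) = mat 1"
      by (auto simp: R_def mat_def vec_eq_iff split: option.splits)
    also have "(\<chi> i j. R (Inl i) (Inl j)) = mat 1"
      by (auto simp: R_def mat_def vec_eq_iff)
    finally show ?thesis by simp
  qed
  have "(\<chi> i j. X' i \<bullet> Y j) = (\<chi> i j. R i j) ** (\<chi> i j. X i \<bullet> Y j)"
    by (simp add: vec_eq_iff matrix_matrix_mult_def X' inner_sum_left)
  then have XX': "det (\<chi> i j. X' i \<bullet> Y j) = det (\<chi> i j. X i \<bullet> Y j)"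
    by (simp add: det_mul det_R)
  have "det (\<chi> i j. X' i \<bullet> Y j) = det (\<chi> i j. X' (Inl i) \<bullet> Y (Inl j)) * det (\<chi> i j. X' (Inr i) \<bullet> Y (Inr j))"
    by (subst det_block_triangular[of Inl Inr])
      (auto simp: X'_def Y_def e u(2) split: option.splits dest: Inr_Inl)
  also have "det (\<chi> i j. X' (Inr i) \<bullet> Y (Inr j)) = det (\<chi> i j. u i \<bullet> q j)"
    by (subst opt) (auto simp: X'_def Y_def e inner_commute)
  finally have 1: "det (\<chi> i j. X i \<bullet> Y j) = det (\<chi> i j. v i \<bullet> g j) * det (\<chi> i j. u i \<bullet> q j)"
    unfolding XX' by (simp add: X'_def Y_def)
  have "wedge_inner Y Y = det (\<chi> i j. Y (Inl i) \<bullet> Y (Inl j)) * det (\<chi> i j. Y (Inr i) \<bullet> Y (Inr j))"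
    unfolding wedge_inner_def
    by (subst det_block_triangular[of Inl Inr])
      (auto simp: Y_def e q split: option.splits dest: Inr_Inl)
  also have "det (\<chi> i j. Y (Inr i) \<bullet> Y (Inr j)) = det (\<chi> i j. q i \<bullet> q j)"
    by (subst opt) (auto simp: Y_def e inner_commute)
  also have "(\<chi> i j. q i \<bullet> q j) = mat 1"
    by (simp add: q mat_def)
  finally have "wedge_norm Y = wedge_norm g"
    by (simp add: wedge_norm_def wedge_inner_def Y_def)
  then show ?thesis
    using det_pairing[OF cardI, of X Y] unfolding 1 abs_mult by (simp add: X_def)
qed

section \<open>Lebesgue measure under linear maps and fibrewise shears\<close>

definition unit_cube_scale :: "real^'m::finite^'m \<Rightarrow> ennreal" where
  "unit_cube_scale A = emeasure lborel ((*v) A -` cbox 0 One)"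

lemma measurable_matrix_vector_mult [measurable]:
  "(*v) A \<in> borel_measurable (borel :: (real^'m::finite) measure)"
  by (intro borel_measurable_continuous_onI linear_continuous_on)
    (simp add: linear_linear[symmetric] matrix_vector_mul_linear)

text \<open>The push-forward of Lebesgue measure is translation invariant because
  \<open>x + A y = A (A' x + y)\<close> for the inverse \<open>A'\<close>, and it is finite on the
  cube because the preimage of the cube is compact.\<close>

lemma emeasure_lborel_matrix_vimage:
  fixes A :: "real^'m::finite^'m"
  assumes A: "det A \<noteq> 0" and E [measurable]: "E \<in> sets borel"
  shows "emeasure lborel ((*v) A -` E) = unit_cube_scale A * emeasure lborel E"
proof -
  let ?M = "distr lborel borel ((*v) A) :: (real^'m) measure"
  obtain A' where inv: "A ** A' = mat 1" "A' ** A = mat 1"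
    using A by (auto simp: invertible_det_nz[symmetric] invertible_def)
  have [simp]: "A *v (A' *v x) = x" "A' *v (A *v x) = x" for x
    by (auto simp: matrix_vector_mul_assoc inv)
  have vim: "(*v) A -` B = (*v) A' ` B" for B
  proof (intro equalityI subsetI)
    fix x assume "x \<in> (*v) A -` B"
    then show "x \<in> (*v) A' ` B" by (intro image_eqI[of _ _ "A *v x"]) auto
  qed auto
  have "compact ((*v) A' ` cbox 0 One)"
    by (intro compact_continuous_image linear_continuous_on)
      (auto simp: linear_linear[symmetric] matrix_vector_mul_linear)
  then have "emeasure lborel ((*v) A' ` cbox 0 One) < \<infinity>"
    by (intro emeasure_bounded_finite compact_imp_bounded)
  then have cube: "emeasure ?M (cbox 0 One) = unit_cube_scale A" "unit_cube_scale A < \<infinity>"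
    by (simp_all add: emeasure_distr unit_cube_scale_def vim)
  have "emeasure ?M E = emeasure ?M (cbox 0 One) * emeasure lborel E"
  proof (rule translation_invariant_eq_lborel)
    show "distr ?M borel ((+) x) = ?M" for x
    proof -
      have "distr ?M borel ((+) x) = distr lborel borel (\<lambda>y. x + A *v y)"
        by (simp add: distr_distr o_def)
      also have "\<dots> = distr lborel borel (\<lambda>y. A *v (A' *v x + y))"
        by (simp add: matrix_vector_right_distrib)
      also have "\<dots> = distr (distr lborel borel ((+) (A' *v x))) borel ((*v) A)"
        by (simp add: distr_distr o_def)
      finally show ?thesis by (simp add: lborel_distr_plus)
    qed
    show "emeasure ?M (cbox 0 One) < \<infinity>" using cube by simp
  qed simp_all
  then show ?thesis by (simp only: cube) (simp add: emeasure_distr)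
qed

lemma unit_cube_scale_mult:
  assumes "det A \<noteq> 0" "det B \<noteq> 0"
  shows "unit_cube_scale (A ** B) = unit_cube_scale A * unit_cube_scale (B :: real^'m::finite^'m)"
proof -
  have "(*v) (A ** B) -` cbox 0 One = (*v) B -` ((*v) A -` cbox 0 One)"
    by (auto simp: matrix_vector_mul_assoc)
  moreover have "(*v) A -` cbox 0 One \<in> sets borel"
    using measurable_sets[OF measurable_matrix_vector_mult, of "cbox 0 One" A] by simp
  ultimately show ?thesis
    using assms by (simp add: unit_cube_scale_def[of "A ** B"] emeasure_lborel_matrix_vimage)
      (simp add: unit_cube_scale_def mult.commute)
qed

lemma unit_cube_scale_one: "unit_cube_scale (mat 1 :: real^'m::finite^'m) = 1"
  by (simp add: unit_cube_scale_def vimage_def)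

lemma unit_cube_scale_nonzero_finite:
  assumes "det (A :: real^'m::finite^'m) \<noteq> 0"
  shows "unit_cube_scale A \<noteq> 0" "unit_cube_scale A \<noteq> \<infinity>"
proof -
  obtain A' where inv: "A ** A' = mat 1" "A' ** A = mat 1"
    using assms by (auto simp: invertible_det_nz[symmetric] invertible_def)
  then have "det A' \<noteq> 0" by (metis det_I det_mul mult_zero_right zero_neq_one)
  then have "unit_cube_scale A * unit_cube_scale A' = 1"
    using unit_cube_scale_mult[of A A'] assms by (simp add: inv unit_cube_scale_one)
  then show "unit_cube_scale A \<noteq> 0" "unit_cube_scale A \<noteq> \<infinity>"
    by (auto simp: ennreal_top_mult split: if_splits)
qed

text \<open>A diagonal matrix conjugates an elementary shear to its square, so a shear scales by the
  idempotent factor 1.\<close>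
lemma unit_cube_scale_shear:
  fixes m n :: "'m::finite"
  assumes "m \<noteq> n"
  defines "S \<equiv> \<chi> i j. if i = m \<and> j = n \<or> i = j then 1 else (0::real)"
  shows "unit_cube_scale S = 1" "det S = 1"
proof -
  define D where "D = (\<chi> i j. if i = j then (if i = m then 2 else 1) else (0::real))"
  have S_apply: "S *v x = x + (x $ n) *\<^sub>R axis m 1" for x
  proof -
    have "(\<Sum>j\<in>UNIV. (if i = m \<and> j = n \<or> i = j then 1 else 0) * x $ j) =
      (\<Sum>j\<in>UNIV. (if j = i then x $ j else 0) + (if j = n then (if i = m then x $ j else 0) else 0))" for i
      using assms(1) by (intro sum.cong) auto
    then show ?thesis
      by (simp add: S_def matrix_vector_mult_def vec_eq_iff axis_def sum.distrib)
  qed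
  have D_apply: "D *v x = x + (x $ m) *\<^sub>R axis m 1" for x
  proof -
    have "(\<Sum>j\<in>UNIV. (if i = j then (if i = m then 2 else 1) else 0) * x $ j) =
      (\<Sum>j\<in>UNIV. if j = i then (if i = m then 2 else 1) * x $ j else 0)" for i
      by (intro sum.cong) auto
    then show ?thesis
      by (simp add: D_def matrix_vector_mult_def vec_eq_iff axis_def)
  qed
  have "det D = (\<Prod>i\<in>UNIV. D $ i $ i)" by (rule det_diagonal) (simp add: D_def)
  then have D: "det D \<noteq> 0" by (simp add: D_def)
  show S: "det S = 1"
  proof -
    have "S = (\<chi> k. if k = m then row m (mat 1) + 1 *s row n (mat 1) else row k (mat 1))"
      using assms(1) by (auto simp: S_def vec_eq_iff row_def mat_def)
    then show ?thesis using det_row_operation[OF assms(1), of "mat 1" "1::real"] by simp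
  qed
  have "D ** S = (S ** S) ** D"
  proof -
    have "(D ** S) *v x = ((S ** S) ** D) *v x" for x
      using assms(1) by (simp add: matrix_vector_mul_assoc[symmetric] S_apply D_apply vec_eq_iff axis_def)
    then show ?thesis by (simp add: matrix_eq)
  qed
  then have "unit_cube_scale D * unit_cube_scale S = unit_cube_scale S * unit_cube_scale S * unit_cube_scale D"
    using unit_cube_scale_mult[of D S] unit_cube_scale_mult[of "S ** S" D] unit_cube_scale_mult[of S S] D S
    by (simp add: det_mul)
  then have "unit_cube_scale D * unit_cube_scale S * 1 = unit_cube_scale S * unit_cube_scale S * unit_cube_scale D"
    by simp
  also have "\<dots> = unit_cube_scale D * unit_cube_scale S * unit_cube_scale S"
    by (simp add: ac_simps)
  finally have "unit_cube_scale D * unit_cube_scale S * 1 = unit_cube_scale D * unit_cube_scale S * unit_cube_scale S" .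
  then show "unit_cube_scale S = 1"
    using unit_cube_scale_nonzero_finite[of D] unit_cube_scale_nonzero_finite[of S] D S
    by (subst (asm) ennreal_mult_cancel_left) (auto simp: ennreal_mult_eq_top_iff)
qed

lemma mem_unit_cube_cart: "x \<in> cbox 0 (One :: real^'m::finite) \<longleftrightarrow> (\<forall>i. 0 \<le> x $ i \<and> x $ i \<le> 1)"
proof -
  have "(One :: real^'m) $ i = 1" for i
    using inner_sum_Basis[of "axis i (1::real)"] by (simp add: inner_axis axis_in_Basis_iff)
  then show ?thesis by (simp only: mem_box_cart zero_index)
qed

text \<open>Both sides are multiplicative, so generators suffice: the preimage of the cube under a
  diagonal matrix is a box, transpositions preserve the cube, and elementary shears have factor
  \<open>1\<close>. A zero row contradicts the nonzero determinant.\<close>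

lemma unit_cube_scale_eq:
  "det A \<noteq> 0 \<Longrightarrow> unit_cube_scale A = ennreal (1 / \<bar>det (A :: real^'m::finite^'m)\<bar>)"
proof (induction A rule: induct_matrix_elementary_alt)
  case (1 A B)
  then show ?case by (simp add: unit_cube_scale_mult det_mul abs_mult ennreal_mult[symmetric])
next
  case (2 A i)
  then show ?case by (simp add: det_zero_row)
next
  case (3 A)
  have det: "det A = (\<Prod>i\<in>UNIV. A $ i $ i)" using "3"(1) by (rule det_diagonal)
  then have nz: "A $ i $ i \<noteq> 0" for i using "3"(2) by auto
  have app: "(A *v x) $ i = A $ i $ i * x $ i" for x i
  proof -
    have "(\<Sum>j\<in>UNIV. A $ i $ j * x $ j) = (\<Sum>j\<in>UNIV. if j = i then A $ i $ i * x $ i else 0)"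
      using "3"(1) by (intro sum.cong) auto
    then show ?thesis by (simp add: matrix_vector_mult_def)
  qed
  \<comment> \<open>A negative diagonal entry reverses the interval; \<open>min\<close> and
    \<open>max\<close> with \<open>0\<close> treat both signs at once.\<close>
  let ?a = "\<chi> i. min 0 (1 / A $ i $ i)" and ?b = "\<chi> i. max 0 (1 / A $ i $ i)"
  have "(*v) A -` cbox 0 One = cbox ?a ?b"
  proof -
    have "(0 \<le> A $ i $ i * x \<and> A $ i $ i * x \<le> 1) \<longleftrightarrow> (min 0 (1 / A $ i $ i) \<le> x \<and> x \<le> max 0 (1 / A $ i $ i))" for i x
      using nz[of i] by (cases "0 < A $ i $ i") (auto simp: field_simps min_def max_def zero_le_mult_iff)
    then show ?thesis by (simp only: set_eq_iff vimage_eq mem_unit_cube_cart app mem_box_cart(2)[of _ ?a ?b] vec_lambda_beta simp_thms)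
  qed
  moreover have "emeasure lborel (cbox ?a ?b) = ennreal (\<Prod>i\<in>UNIV. 1 / \<bar>A $ i $ i\<bar>)"
  proof -
    have "measure lborel (cbox ?a ?b) = (\<Prod>i\<in>UNIV. ?b $ i - ?a $ i)"
      by (rule content_cbox_cart) (auto simp: interval_ne_empty_cart)
    also have "\<dots> = (\<Prod>i\<in>UNIV. 1 / \<bar>A $ i $ i\<bar>)"
      using nz by (intro prod.cong) (auto simp: min_def max_def abs_if)
    finally show ?thesis
      using emeasure_eq_ennreal_measure[of lborel "cbox ?a ?b"] emeasure_lborel_cbox_finite[of ?a ?b] by simp
  qed
  ultimately show ?case by (simp add: unit_cube_scale_def det abs_prod prod_dividef)
next
  case (4 m n)
  let ?P = "(\<chi> i j. mat 1 $ i $ Transposition.transpose m n j) :: real^'m^'m"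
  have app: "(?P *v x) $ i = x $ Transposition.transpose m n i" for x :: "real^'m" and i
  proof -
    have "(\<Sum>j\<in>UNIV. mat 1 $ i $ Transposition.transpose m n j * x $ j) =
        (\<Sum>j\<in>UNIV. if j = Transposition.transpose m n i then x $ j else 0)"
      by (intro sum.cong) (auto simp: mat_def)
    then show ?thesis by (simp add: matrix_vector_mult_def)
  qed
  have "(*v) ?P -` cbox 0 One = cbox 0 One"
    by (simp only: set_eq_iff vimage_eq mem_unit_cube_cart app) (metis transpose_involutory)
  then have "unit_cube_scale ?P = 1" by (simp add: unit_cube_scale_def)
  moreover have "\<bar>det ?P\<bar> = 1"
    using det_permute_columns[of "Transposition.transpose m n" "mat 1 :: real^'m^'m"]
    by (simp add: permutes_swap_id abs_mult sign_swap_id)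
  ultimately show ?case by simp
next
  case (5 m n)
  then show ?case using unit_cube_scale_shear[OF "5"(1)] by (simp add: of_bool_def)
qed

lemma emeasure_lborel_linear_vimage:
  fixes A :: "real^'m::finite^'m" and E :: "(real^'m) set"
  assumes "det A \<noteq> 0" "E \<in> sets borel"
  shows "emeasure lborel ((*v) A -` E) = ennreal (1 / \<bar>det A\<bar>) * emeasure lborel E"
  using assms by (simp add: emeasure_lborel_matrix_vimage unit_cube_scale_eq)

text \<open>Fubini over the vertical lines: on each of them the map is affine and \<open>g a\<close>
  is a mere translation, so measurability of \<open>g\<close> suffices.\<close>

lemma emeasure_lborel_graph_vimage:
  fixes A :: "real^'m::finite^'m" and E :: "((real^'m) \<times> real) set"
  assumes A: "det A \<noteq> 0" and r: "r \<noteq> 0" and g [measurable]: "g \<in> borel_measurable borel"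
    and E [measurable]: "E \<in> sets borel"
  shows "emeasure lborel {(a, s). (A *v a, r * s + g a) \<in> E} =
     ennreal (1 / (\<bar>det A\<bar> * \<bar>r\<bar>)) * emeasure lborel E"
proof -
  have E' [measurable]: "E \<in> sets (borel \<Otimes>\<^sub>M borel)" using E borel_prod by metis
  have lp: "(lborel :: ((real^'m) \<times> real) measure) = lborel \<Otimes>\<^sub>M lborel" by (simp add: lborel_prod)
  define F where "F = {(a, s). (A *v a, r * s + g a) \<in> E}"
  have F: "F \<in> sets (borel \<Otimes>\<^sub>M borel)"
  proof -
    have "(\<lambda>(a, s). (A *v a, r * s + g a)) \<in> borel \<Otimes>\<^sub>M borel \<rightarrow>\<^sub>M borel \<Otimes>\<^sub>M borel"
      by measurable
    from measurable_sets[OF this E'] show ?thesis by (simp add: F_def vimage_def split_def space_pair_measure)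
  qed
  define h where "h a = emeasure lborel (Pair a -` E)" for a
  have h [measurable]: "h \<in> borel_measurable borel"
    unfolding h_def using lborel.measurable_emeasure_Pair[of E borel] by simp
  have slice: "emeasure lborel (Pair a -` F) = ennreal (1 / \<bar>r\<bar>) * h (A *v a)" for a
  proof -
    have m: "Pair (A *v a) -` E \<in> sets borel"
      using sets_Pair1[OF E'] by simp
    have "emeasure lborel (Pair (A *v a) -` E) =
       emeasure (density (distr lborel borel (\<lambda>s. g a + r * s)) (\<lambda>_. ennreal \<bar>r\<bar>)) (Pair (A *v a) -` E)"
      by (subst lborel_real_affine[OF r, of "g a"]) simp
    also have "\<dots> = ennreal \<bar>r\<bar> * emeasure lborel ((\<lambda>s. g a + r * s) -` (Pair (A *v a) -` E))"
      using m by (simp add: emeasure_density nn_integral_cmult emeasure_distr)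
    also have "(\<lambda>s. g a + r * s) -` (Pair (A *v a) -` E) = Pair a -` F"
      by (auto simp: F_def add.commute)
    finally have "ennreal (1 / \<bar>r\<bar>) * h (A *v a) = ennreal (1 / \<bar>r\<bar>) * (ennreal \<bar>r\<bar> * emeasure lborel (Pair a -` F))"
      by (simp add: h_def)
    also have "\<dots> = ennreal (1 / \<bar>r\<bar> * \<bar>r\<bar>) * emeasure lborel (Pair a -` F)"
      by (simp add: ennreal_mult mult.assoc del: times_divide_eq_left)
    finally show ?thesis using r by simp
  qed
  have lin: "(\<integral>\<^sup>+a. h (A *v a) \<partial>lborel) = ennreal (1 / \<bar>det A\<bar>) * (\<integral>\<^sup>+a. h a \<partial>lborel)"
  proof -
    have eq: "distr lborel borel ((*v) A) = scale_measure (ennreal (1 / \<bar>det A\<bar>)) lborel"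
      by (rule measure_eqI) (simp_all add: emeasure_distr emeasure_lborel_linear_vimage[OF A])
    have "(\<integral>\<^sup>+a. h (A *v a) \<partial>lborel) = (\<integral>\<^sup>+a. h a \<partial>distr lborel borel ((*v) A))"
      by (rule nn_integral_distr[symmetric]) measurable
    also have "\<dots> = ennreal (1 / \<bar>det A\<bar>) * (\<integral>\<^sup>+a. h a \<partial>lborel)"
      unfolding eq by (rule nn_integral_scale_measure) simp
    finally show ?thesis .
  qed
  have "emeasure lborel F = (\<integral>\<^sup>+a. emeasure lborel (Pair a -` F) \<partial>lborel)"
    unfolding lp using F by (intro lborel.emeasure_pair_measure_alt) simp
  also have "\<dots> = ennreal (1 / \<bar>r\<bar>) * (\<integral>\<^sup>+a. h (A *v a) \<partial>lborel)"
    unfolding slice by (rule nn_integral_cmult) measurable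
  also have "\<dots> = ennreal (1 / \<bar>r\<bar>) * (ennreal (1 / \<bar>det A\<bar>) * (\<integral>\<^sup>+a. h a \<partial>lborel))"
    by (simp add: lin)
  also have "(\<integral>\<^sup>+a. h a \<partial>lborel) = emeasure lborel E"
    unfolding lp h_def by (intro lborel.emeasure_pair_measure_alt[symmetric]) simp
  finally have "emeasure lborel F = ennreal (1 / \<bar>r\<bar> * (1 / \<bar>det A\<bar>)) * emeasure lborel E"
    by (subst ennreal_mult) (simp_all add: mult.assoc)
  then show ?thesis by (simp add: F_def mult.commute)
qed

section \<open>Homogeneous distances in coordinates\<close>

declare split_paired_All [simp del] split_paired_Ex [simp del]

lemma heis_mult_eq: "p \<cdot> q = (fst p + fst q, snd p + snd q + symp (fst p) (fst q) / 2)"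
  by (simp add: heis_mult_def bracket_def evert_def prod_eq_iff)

lemma fst_heis_mult [simp]: "fst (p \<cdot> q) = fst p + fst q"
  and snd_heis_mult [simp]: "snd (p \<cdot> q) = snd p + snd q + symp (fst p) (fst q) / 2"
  by (simp_all add: heis_mult_eq)

lemma symp_add_left [simp]: "symp (p + p') q = symp p q + symp p' q"
  and symp_add_right [simp]: "symp p (q + q') = symp p q + symp p q'"
  and symp_minus_left [simp]: "symp (- p) q = - symp p q"
  and symp_minus_right [simp]: "symp p (- q) = - symp p q"
  and symp_scale_left [simp]: "symp (t *\<^sub>R p) q = t * symp p q"
  and symp_scale_right [simp]: "symp p (t *\<^sub>R q) = t * symp p q"
  and symp_diff_left [simp]: "symp (p - p') q = symp p q - symp p' q"
  and symp_diff_right [simp]: "symp p (q - q') = symp p q - symp p q'"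
  and symp_self [simp]: "symp p p = 0"
  and symp_zero_left [simp]: "symp 0 q = 0"
  and symp_zero_right [simp]: "symp p 0 = 0"
  by (simp_all add: symp_def inner_add_left inner_add_right inner_diff_left inner_diff_right algebra_simps inner_commute)

lemma symp_swap: "symp q p = - symp p q"
  by (simp add: symp_def inner_commute)

lemma continuous_on_symp [continuous_intros]:
  "continuous_on S f \<Longrightarrow> continuous_on S g \<Longrightarrow> continuous_on S (\<lambda>x. symp (f x) (g x))"
  unfolding symp_def by (intro continuous_intros)

lemma tendsto_symp [tendsto_intros]:
  "(f \<longlongrightarrow> a) F \<Longrightarrow> (g \<longlongrightarrow> b) F \<Longrightarrow> ((\<lambda>x. symp (f x) (g x)) \<longlongrightarrow> symp a b) F"
  unfolding symp_def by (intro tendsto_intros)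

lemma continuous_on_heis_mult [continuous_intros]:
  "continuous_on S f \<Longrightarrow> continuous_on S g \<Longrightarrow> continuous_on S (\<lambda>x. f x \<cdot> g x)"
  unfolding heis_mult_eq by (intro continuous_intros) auto

lemma norm_le_fst_snd: "norm x \<le> norm (fst x) + norm (snd x)"
  using norm_Pair_le[of "fst x" "snd x"] by simp

lemma heis_mult_assoc: "(p \<cdot> q) \<cdot> r = p \<cdot> (q \<cdot> r)"
  by (simp add: prod_eq_iff add_divide_distrib)

lemma heis_mult_zero [simp]: "0 \<cdot> p = p" "p \<cdot> 0 = p"
  by (simp_all add: prod_eq_iff)

lemma heis_mult_minus [simp]: "(- p) \<cdot> p = 0" "p \<cdot> (- p) = 0"
    "(- p) \<cdot> (p \<cdot> q) = q" "p \<cdot> ((- p) \<cdot> q) = q"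
  by (simp_all add: prod_eq_iff)

lemma minus_heis_mult: "- (p \<cdot> q) = (- q) \<cdot> (- p)"
  using symp_swap[of "fst p" "fst q"] by (simp add: prod_eq_iff)

lemma fst_dil [simp]: "fst (dil t p) = t *\<^sub>R fst p"
  and snd_dil [simp]: "snd (dil t p) = t\<^sup>2 * snd p"
  by (simp_all add: dil_def)

lemma dil_mult: "dil t (p \<cdot> q) = dil t p \<cdot> dil t q"
  by (simp add: prod_eq_iff algebra_simps power2_eq_square)

lemma dil_dil: "dil s (dil t p) = dil (s * t) p"
  by (simp add: prod_eq_iff power_mult_distrib)

lemma dil_one [simp]: "dil 1 p = p"
  and dil_zero [simp]: "dil t 0 = 0"
  and dil_minus: "dil t (- p) = - dil t p"
  by (simp_all add: prod_eq_iff)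

lemma dil_inverse [simp]: "t \<noteq> 0 \<Longrightarrow> dil (1 / t) (dil t p) = p" "t \<noteq> 0 \<Longrightarrow> dil t (dil (1 / t) p) = p"
  by (simp_all add: dil_dil)

lemma continuous_on_dil [continuous_intros]:
  "continuous_on S f \<Longrightarrow> continuous_on S (\<lambda>x. dil t (f x))"
  unfolding dil_def by (intro continuous_intros)

section \<open>Topology and balls of a homogeneous distance\<close>

locale homogeneous_dist =
  fixes d :: "'n::finite heis \<Rightarrow> 'n heis \<Rightarrow> real"
  assumes homogeneous: "homogeneous_distance d"
begin

lemma d_nonneg [simp]: "0 \<le> d x y"
  and d_commute: "d x y = d y x"
  and d_eq_0 [simp]: "d x y = 0 \<longleftrightarrow> x = y"
  and d_triangle: "d x z \<le> d x y + d y z"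
proof -
  interpret Metric_space UNIV d using homogeneous by (simp add: homogeneous_distance_def)
  show "0 \<le> d x y" "d x y = d y x" "d x y = 0 \<longleftrightarrow> x = y" "d x z \<le> d x y + d y z"
    using nonneg commute zero triangle by auto
qed

lemma d_self [simp]: "d x x = 0"
  by simp

lemma d_translate [simp]: "d (z \<cdot> x) (z \<cdot> y) = d x y"
  using homogeneous unfolding homogeneous_distance_def by blast

lemma d_dil: "0 < t \<Longrightarrow> d (dil t x) (dil t y) = t * d x y"
  using homogeneous unfolding homogeneous_distance_def by blast

lemma d_eq_norm: "d x y = d ((- y) \<cdot> x) 0"
  using d_translate[of "- y" x y] by simp

lemma d_norm_dil: "0 < t \<Longrightarrow> d (dil t x) 0 = t * d x 0"
  using d_dil[of t x 0] by simp

lemma d_norm_minus [simp]: "d (- x) 0 = d x 0"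
  using d_translate[of x "- x" 0] by (simp add: d_commute)

lemma d_norm_mult: "d (x \<cdot> y) 0 \<le> d x 0 + d y 0"
  using d_triangle[of "x \<cdot> y" 0 x] d_translate[of x y 0] by simp

lemma d_norm_vertical: "d (0, s) 0 = sqrt \<bar>s\<bar> * d (0, 1) 0"
proof -
  have pos: "d (0, s) 0 = sqrt s * d (0, 1) 0" if "0 < s" for s
    using d_norm_dil[of "sqrt s" "(0, 1)"] that by (simp add: dil_def)
  consider "s = 0" | "0 < s" | "0 < - s" by linarith
  then show ?thesis
  proof cases
    case 3
    have "d (0, s) 0 = d (0, - s) 0" using d_norm_minus[of "(0, s)"] by simp
    then show ?thesis using pos[OF 3] 3 by simp
  next
    case 2
    then show ?thesis using pos[OF 2] by simp
  qed (simp flip: zero_prod_def)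
qed

lemma d_norm_horizontal_scale: "d (c *\<^sub>R h, 0) 0 = \<bar>c\<bar> * d (h, 0) 0"
proof -
  have pos: "d (c *\<^sub>R h, 0) 0 = c * d (h, 0) 0" if "0 < c" for c
    using d_norm_dil[of c "(h, 0)"] that by (simp add: dil_def)
  consider "c = 0" | "0 < c" | "0 < - c" by linarith
  then show ?thesis
  proof cases
    case 3
    have "d (c *\<^sub>R h, 0) 0 = d ((- c) *\<^sub>R h, 0) 0" using d_norm_minus[of "(c *\<^sub>R h, 0)"] by simp
    then show ?thesis using pos[OF 3] 3 by simp
  next
    case 2
    then show ?thesis using pos[OF 2] by simp
  qed (simp flip: zero_prod_def)
qed

lemma d_norm_add_horizontal:
  "d (a + b, 0) 0 \<le> d (a, 0) 0 + d (b, 0) 0 + sqrt (\<bar>symp a b\<bar> / 2) * d (0, 1) 0"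
proof -
  have "(a + b, 0) = ((a, 0) \<cdot> (b, 0)) \<cdot> (0, - symp a b / 2)"
    by (simp add: prod_eq_iff)
  then have "d (a + b, 0) 0 \<le> d (a, 0) 0 + d (b, 0) 0 + d (0, - symp a b / 2) 0"
    using d_norm_mult[of "(a, 0) \<cdot> (b, 0)" "(0, - symp a b / 2)"] d_norm_mult[of "(a, 0)" "(b, 0)"]
    by simp
  then show ?thesis unfolding d_norm_vertical[of "- symp a b / 2"] by simp
qed

text \<open>The definition of a homogeneous distance does not mention the Euclidean topology.
  Homogeneity determines \<open>d\<close> along each horizontal axis, where it is linear, and along
  the vertical one, where it is a square root. The triangle inequality assembles the coordinates,
  one basis vector at a time, each product costing a vertical correction of order
  \<open>sqrt \<bar>symp a b\<bar>\<close>.\<close>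

lemma d_norm_tendsto_0: "((\<lambda>x. d x 0) \<longlongrightarrow> 0) (nhds 0)"
proof -
  have hor: "((\<lambda>x :: 'n heis. d (\<Sum>b\<in>B. (fst x \<bullet> b) *\<^sub>R b, 0) 0) \<longlongrightarrow> 0) (nhds 0)"
    if "finite B" for B :: "'n hvec set"
    using that
  proof (induction B rule: finite_induct)
    case empty
    then show ?case by (simp flip: zero_prod_def)
  next
    case (insert c B)
    let ?S = "\<lambda>x :: 'n heis. \<Sum>b\<in>B. (fst x \<bullet> b) *\<^sub>R b"
    let ?T = "\<lambda>x :: 'n heis. (fst x \<bullet> c) *\<^sub>R c"
    have "((\<lambda>x. d (?S x, 0) 0 + \<bar>fst x \<bullet> c\<bar> * d (c, 0) 0 + sqrt (\<bar>symp (?S x) (?T x)\<bar> / 2) * d (0, 1) 0)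
        \<longlongrightarrow> 0 + \<bar>fst (0 :: 'n heis) \<bullet> c\<bar> * d (c, 0) 0 + sqrt (\<bar>symp (?S 0) (?T 0)\<bar> / 2) * d (0, 1) 0) (nhds 0)"
      by (intro tendsto_intros insert.IH filterlim_ident) auto
    then have lim: "((\<lambda>x. d (?S x, 0) 0 + \<bar>fst x \<bullet> c\<bar> * d (c, 0) 0 + sqrt (\<bar>symp (?S x) (?T x)\<bar> / 2) * d (0, 1) 0)
        \<longlongrightarrow> 0) (nhds 0)"
      by simp
    have le: "d (?S x + ?T x, 0) 0 \<le> d (?S x, 0) 0 + \<bar>fst x \<bullet> c\<bar> * d (c, 0) 0 + sqrt (\<bar>symp (?S x) (?T x)\<bar> / 2) * d (0, 1) 0" for x
      using d_norm_add_horizontal[of "?S x" "?T x"] unfolding d_norm_horizontal_scale .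
    have "((\<lambda>x. d (?S x + ?T x, 0) 0) \<longlongrightarrow> 0) (nhds 0)"
      by (rule tendsto_sandwich[OF always_eventually[OF allI[OF d_nonneg]] always_eventually[OF allI[OF le]] tendsto_const lim])
    then show ?case using insert.hyps by (simp add: add.commute)
  qed
  have "((\<lambda>x. d (\<Sum>b\<in>Basis. (fst x \<bullet> b) *\<^sub>R b, 0) 0 + sqrt \<bar>snd x\<bar> * d (0, 1) 0) \<longlongrightarrow>
      0 + sqrt \<bar>snd (0 :: 'n heis)\<bar> * d (0, 1) 0) (nhds 0)"
    by (intro tendsto_intros hor filterlim_ident) auto
  then have lim: "((\<lambda>x. d (fst x, 0) 0 + sqrt \<bar>snd x\<bar> * d (0, 1) 0) \<longlongrightarrow> 0) (nhds 0)"
    by (simp add: euclidean_representation)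
  have le: "d x 0 \<le> d (fst x, 0) 0 + sqrt \<bar>snd x\<bar> * d (0, 1) 0" for x
  proof -
    have "x = (fst x, 0) \<cdot> (0, snd x)" by (simp add: prod_eq_iff)
    then have "d x 0 \<le> d (fst x, 0) 0 + d (0, snd x) 0" using d_norm_mult by metis
    then show ?thesis by (simp only: d_norm_vertical[of "snd x"])
  qed
  show ?thesis
    by (rule tendsto_sandwich[OF always_eventually[OF allI[OF d_nonneg]] always_eventually[OF allI[OF le]] tendsto_const lim])
qed

lemma continuous_d_norm: "continuous_on UNIV (\<lambda>x. d x 0)"
  unfolding continuous_on_def
proof (intro ballI)
  fix x :: "'n heis"
  have "isCont (\<lambda>y. (- x) \<cdot> y) x"
    using continuous_on_heis_mult[OF continuous_on_const[of UNIV "- x"] continuous_on_id]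
    by (simp add: continuous_on_eq_continuous_at)
  then have "((\<lambda>y. (- x) \<cdot> y) \<longlongrightarrow> (- x) \<cdot> x) (at x)"
    by (simp only: isCont_def)
  then have "((\<lambda>y. d ((- x) \<cdot> y) 0) \<longlongrightarrow> 0) (at x)"
    by (intro filterlim_compose[OF d_norm_tendsto_0]) simp
  then have lim: "((\<lambda>y. d y x) \<longlongrightarrow> 0) (at x)" by (subst d_eq_norm)
  have "((\<lambda>y. d y 0 - d x 0) \<longlongrightarrow> 0) (at x)"
  proof (rule Lim_null_comparison[OF always_eventually lim], intro allI)
    fix y show "norm (d y 0 - d x 0) \<le> d y x"
      using d_triangle[of y 0 x] d_triangle[of x 0 y] by (simp add: d_commute abs_le_iff)
  qed
  then show "((\<lambda>y. d y 0) \<longlongrightarrow> d x 0) (at x)" by (rule LIM_zero_cancel)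
qed

lemma continuous_on_d [continuous_intros]:
  assumes "continuous_on S f" "continuous_on S g"
  shows "continuous_on S (\<lambda>x. d (f x) (g x))"
proof -
  have "continuous_on S (\<lambda>x. d ((- g x) \<cdot> f x) 0)"
    by (intro continuous_on_compose2[OF continuous_d_norm] continuous_intros assms) auto
  then show ?thesis by (simp add: d_eq_norm[symmetric])
qed

text \<open>The set \<open>?K\<close> is the compact unit sphere of a gauge that scales by
  \<open>t ^ 4\<close> under \<open>dil t\<close>. By continuity \<open>d\<close> has a positive
  minimum on it, and homogeneity spreads the bound to all points.\<close>

lemma d_norm_lower_bound:
  "\<exists>c>0. \<forall>x. norm (fst x) \<le> c * d x 0 \<and> \<bar>snd x\<bar> \<le> (c * d x 0)\<^sup>2"
proof -
  let ?K = "{x :: 'n heis. norm (fst x) ^ 4 + (snd x)\<^sup>2 = 1}"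
  have "closed ?K" by (intro closed_Collect_eq continuous_intros)
  moreover have "bounded ?K"
    unfolding bounded_iff
  proof (intro exI[of _ 2] ballI)
    fix x :: "'n heis" assume x: "x \<in> ?K"
    then have "norm (fst x) ^ 4 + (snd x)\<^sup>2 = 1" by simp
    moreover note zero_le_power2[of "snd x"] zero_le_power[OF norm_ge_zero, of "fst x" 4]
    ultimately have "norm (fst x) ^ 4 \<le> 1" "(snd x)\<^sup>2 \<le> 1" by linarith+
    then have "norm (fst x) ^ 4 \<le> 1 ^ 4" "(snd x)\<^sup>2 \<le> 1\<^sup>2" by simp_all
    then have "norm (fst x) \<le> 1" "\<bar>snd x\<bar> \<le> 1"
      using power_mono_iff[of "norm (fst x)" 1 4] by (auto simp: abs_square_le_1)
    moreover have "norm x \<le> norm (fst x) + norm (snd x)"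
      by (rule norm_le_fst_snd)
    ultimately show "norm x \<le> 2" by simp
  qed
  ultimately have K: "compact ?K" by (simp add: compact_eq_bounded_closed)
  have K0: "(0, 1) \<in> ?K" by simp
  have "\<exists>k\<in>?K. \<forall>x\<in>?K. d k 0 \<le> d x 0"
  proof (rule continuous_attains_inf[OF K])
    show "?K \<noteq> {}" using K0 by blast
    show "continuous_on ?K (\<lambda>x. d x 0)" by (rule continuous_on_subset[OF continuous_d_norm]) simp
  qed
  then obtain k where k: "k \<in> ?K" "\<And>x. x \<in> ?K \<Longrightarrow> d k 0 \<le> d x 0"
    by blast
  have k0: "0 < d k 0"
  proof -
    have "k \<noteq> 0" using k(1) by (auto simp: zero_prod_def)
    then show ?thesis using d_nonneg[of k 0] d_eq_0[of k 0] by linarith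
  qed
  have *: "norm (fst x) \<le> (1 / d k 0) * d x 0 \<and> \<bar>snd x\<bar> \<le> ((1 / d k 0) * d x 0)\<^sup>2" for x
  proof (cases "x = 0")
    case False
    define q where "q = norm (fst x) ^ 4 + (snd x)\<^sup>2"
    \<comment> \<open>The gauge norm of \<open>x\<close>: the dilation by \<open>1 / \<rho>\<close>
      moves \<open>x\<close> to the sphere.\<close>
    define \<rho> where "\<rho> = sqrt (sqrt q)"
    have q0: "0 < q" using False by (auto simp: q_def prod_eq_iff add_pos_nonneg add_nonneg_pos)
    then have \<rho>0: "0 < \<rho>" by (simp add: \<rho>_def)
    have \<rho>4: "\<rho> ^ 4 = q"
    proof -
      have "\<rho> ^ 4 = (\<rho>\<^sup>2)\<^sup>2" by (simp flip: power_mult)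
      also have "\<rho>\<^sup>2 = sqrt q" using q0 by (simp add: \<rho>_def)
      finally show ?thesis using q0 by simp
    qed
    have "dil (1 / \<rho>) x \<in> ?K"
    proof -
      have "norm (fst (dil (1 / \<rho>) x)) ^ 4 + (snd (dil (1 / \<rho>) x))\<^sup>2 = q / \<rho> ^ 4"
        using \<rho>0 by (simp add: q_def power_divide power_mult_distrib add_divide_distrib)
      then show ?thesis using \<rho>4 q0 by simp
    qed
    from k(2)[OF this] have "d k 0 \<le> d x 0 / \<rho>"
      using d_norm_dil[of "1 / \<rho>" x] \<rho>0 by simp
    then have \<rho>_le: "\<rho> \<le> (1 / d k 0) * d x 0" using \<rho>0 k0 by (simp add: field_simps)
    have "norm (fst x) ^ 4 \<le> \<rho> ^ 4" by (simp add: \<rho>4 q_def)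
    then have 1: "norm (fst x) \<le> \<rho>" using \<rho>0 power_mono_iff[of "norm (fst x)" \<rho> 4] by simp
    have "(snd x)\<^sup>2 \<le> (\<rho>\<^sup>2)\<^sup>2" using \<rho>4 by (simp add: q_def)
    then have "\<bar>snd x\<bar> \<le> \<bar>\<rho>\<^sup>2\<bar>" by (simp only: abs_le_square_iff)
    then have "\<bar>snd x\<bar> \<le> \<rho>\<^sup>2" by simp
    also have "\<dots> \<le> ((1 / d k 0) * d x 0)\<^sup>2" using \<rho>_le \<rho>0 by (intro power_mono) auto
    finally show ?thesis using 1 \<rho>_le by linarith
  qed simp
  show ?thesis using k0 * by (intro exI[of _ "1 / d k 0"]) simp
qed

lemma bounded_norm_ball: "bounded {x. d x 0 \<le> r}"
proof -
  obtain c where c0: "0 < c" and c12: "\<forall>x. norm (fst x) \<le> c * d x 0 \<and> \<bar>snd x\<bar> \<le> (c * d x 0)\<^sup>2"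
    using d_norm_lower_bound by blast
  note c = c0 c12[THEN spec, THEN conjunct1] c12[THEN spec, THEN conjunct2]
  show ?thesis
    unfolding bounded_iff
  proof (intro exI ballI)
    fix x assume "x \<in> {x. d x 0 \<le> r}"
    then have r: "d x 0 \<le> r" by simp
    have "norm x \<le> norm (fst x) + norm (snd x)"
      by (rule norm_le_fst_snd)
    also have "\<dots> \<le> c * d x 0 + (c * d x 0)\<^sup>2" using c(2)[of x] c(3)[of x] by simp
    also have "\<dots> \<le> c * r + (c * r)\<^sup>2" using r c(1) by (intro add_mono mult_left_mono power_mono) auto
    finally show "norm x \<le> c * r + (c * r)\<^sup>2" .
  qed
qed

lemma closed_dball [simp]: "closed (dball d x r)"
  unfolding dball_def by (intro closed_Collect_le continuous_intros)

lemma borel_dball [measurable]: "dball d x r \<in> sets borel"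
  by (rule borel_closed) simp

lemma open_d_ball: "open {y. d x y < r}"
  by (intro open_Collect_less continuous_intros)

text \<open>Together with the continuity of \<open>d\<close> this says that \<open>d\<close> induces
  the Euclidean topology.\<close>

lemma d_ball_subset_open:
  assumes "open S" "x \<in> S"
  obtains r where "0 < r" "{y. d x y < r} \<subseteq> S"
proof -
  obtain c where c0: "0 < c" and c12: "\<forall>x. norm (fst x) \<le> c * d x 0 \<and> \<bar>snd x\<bar> \<le> (c * d x 0)\<^sup>2"
    using d_norm_lower_bound by blast
  note c = c0 c12[THEN spec, THEN conjunct1] c12[THEN spec, THEN conjunct2]
  have "continuous_on UNIV (\<lambda>w. x \<cdot> w)" by (intro continuous_intros)
  then have "open ((\<lambda>w. x \<cdot> w) -` S)" using assms(1) by (rule open_vimage[rotated])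
  moreover have "0 \<in> (\<lambda>w. x \<cdot> w) -` S" using assms(2) by simp
  ultimately obtain e where e: "0 < e" "ball 0 e \<subseteq> (\<lambda>w. x \<cdot> w) -` S" by (rule openE)
  have "((\<lambda>r. c * r + (c * r)\<^sup>2) \<longlongrightarrow> c * 0 + (c * 0)\<^sup>2) (at_right 0)"
    by (intro tendsto_intros)
  then have "\<forall>\<^sub>F r in at_right 0. c * r + (c * r)\<^sup>2 < e"
    using e(1) by (intro order_tendstoD(2)) auto
  then obtain b where b: "0 < b" "\<And>r. 0 < r \<Longrightarrow> r < b \<Longrightarrow> c * r + (c * r)\<^sup>2 < e"
    by (auto simp: eventually_at_right_field)
  define r where "r = b / 2"
  have r: "0 < r" "c * r + (c * r)\<^sup>2 < e" using b(1) b(2)[of r] by (auto simp: r_def)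
  show ?thesis
  proof (rule that[OF r(1)], rule subsetI)
    fix y assume "y \<in> {y. d x y < r}"
    then have y: "d ((- x) \<cdot> y) 0 \<le> r" using d_eq_norm[of y x] d_commute[of x y] by (simp only: mem_Collect_eq)
    let ?w = "(- x) \<cdot> y"
    have "norm ?w \<le> norm (fst ?w) + norm (snd ?w)"
      by (rule norm_le_fst_snd)
    also have "\<dots> \<le> c * d ?w 0 + (c * d ?w 0)\<^sup>2" using c(2)[of ?w] c(3)[of ?w] by simp
    also have "\<dots> \<le> c * r + (c * r)\<^sup>2" using y c(1) by (intro add_mono mult_left_mono power_mono) auto
    also have "\<dots> < e" by (rule r(2))
    finally have "?w \<in> ball 0 e" by simp
    then show "y \<in> S" using e(2) by auto
  qed
qed

text \<open>In a general metric space a ball can have diameter less than \<open>2 * r\<close>. Here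
  a horizontal \<open>k\<close> of norm \<open>r\<close> satisfies
  \<open>k \<cdot> k = dil 2 k\<close>, which puts \<open>x \<cdot> k\<close> and
  \<open>x \<cdot> (- k)\<close> at distance \<open>2 * r\<close>. The spherical gauge of a ball is
  therefore exactly a power of its radius.\<close>

lemma ediam_dball:
  assumes "0 < r"
  shows "ediam d (dball d x r) = ennreal (2 * r)"
proof (rule antisym)
  show "ediam d (dball d x r) \<le> ennreal (2 * r)"
  proof (rule ediam_le)
    fix y z assume "y \<in> dball d x r" "z \<in> dball d x r"
    then show "d y z \<le> 2 * r"
      using d_triangle[of y z x] d_commute[of x y] unfolding dball_def mem_Collect_eq by linarith
  qed
  obtain h :: "'n hvec" where h: "h \<noteq> 0"
    using SOME_Basis nonzero_Basis by blast
  define N where "N = d (h, 0) 0"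
  have N: "0 < N" using h d_nonneg[of "(h, 0)" 0] d_eq_0[of "(h, 0)" 0] unfolding N_def
    by (simp add: less_le zero_prod_def)
  define k where "k = ((r / N) *\<^sub>R h, 0 :: real)"
  have k: "d k 0 = r" using N assms by (simp add: k_def d_norm_horizontal_scale N_def[symmetric])
  have "d (x \<cdot> k) (x \<cdot> (- k)) = d (k \<cdot> k) 0"
    by (simp add: d_eq_norm[of k "- k"])
  also have "k \<cdot> k = dil 2 k" by (simp only: heis_mult_eq dil_def scaleR_2 symp_self) (simp add: k_def)
  finally have "d (x \<cdot> k) (x \<cdot> (- k)) = 2 * r" by (simp add: d_norm_dil k)
  moreover have "x \<cdot> k \<in> dball d x r" "x \<cdot> (- k) \<in> dball d x r"
    using d_translate[of x 0 k] d_translate[of x 0 "- k"] d_norm_minus[of k] k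
    by (simp_all add: dball_def d_commute[of 0])
  ultimately show "ennreal (2 * r) \<le> ediam d (dball d x r)"
    using dist_le_ediam[of "x \<cdot> k" "dball d x r" "x \<cdot> (- k)" d] by simp
qed

end

section \<open>Differentiation with respect to the spherical measure\<close>

lemma nn_integral_count_space_tail:
  assumes H: "countable H" and fin: "(\<integral>\<^sup>+p. g p \<partial>count_space H) < \<infinity>" and e: "(0::ennreal) < e"
  obtains F where "finite F" "F \<subseteq> H" "(\<integral>\<^sup>+p. g p * indicator (H - F) p \<partial>count_space H) < e"
proof -
  let ?M = "density (count_space H) g"
  define F where "F n = {p \<in> H. to_nat_on H p < n}" for n
  have em: "emeasure ?M (H - F n) = (\<integral>\<^sup>+p. g p * indicator (H - F n) p \<partial>count_space H)" for n
    by (rule emeasure_density) auto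
  have dec: "decseq (\<lambda>n. H - F n)"
    by (auto simp: decseq_def F_def)
  have ne: "emeasure ?M (H - F n) \<noteq> \<infinity>" for n
  proof -
    have "emeasure ?M (H - F n) \<le> (\<integral>\<^sup>+p. g p \<partial>count_space H)"
      unfolding em by (intro nn_integral_mono) (auto split: split_indicator)
    then show ?thesis using fin by auto
  qed
  have "(\<lambda>n. emeasure ?M (H - F n)) \<longlonglongrightarrow> emeasure ?M (\<Inter>n. H - F n)"
    by (rule Lim_emeasure_decseq[OF _ dec ne]) auto
  also have "(\<Inter>n. H - F n) = {}"
  proof -
    have "p \<in> F (Suc (to_nat_on H p))" if "p \<in> H" for p using that by (simp add: F_def)
    then show ?thesis by blast
  qed
  finally have "\<forall>\<^sub>F n in sequentially. emeasure ?M (H - F n) < e"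
    using e by (intro order_tendstoD(2)) auto
  then obtain n where "emeasure ?M (H - F n) < e" by (auto simp: eventually_sequentially)
  moreover have "finite (F n)"
  proof (rule inj_on_finite[of "to_nat_on H" _ "{..<n}"])
    show "inj_on (to_nat_on H) (F n)"
      using inj_on_to_nat_on[OF H] by (rule inj_on_subset) (auto simp: F_def)
  qed (auto simp: F_def)
  moreover have "F n \<subseteq> H" by (auto simp: F_def)
  ultimately show ?thesis unfolding em by (intro that[of "F n"])
qed

context homogeneous_dist
begin

text \<open>Zorn's lemma, applied to disjoint subfamilies with the following property: a ball that
  meets the subfamily meets a member of at least half its radius. This clause makes a maximal
  subfamily meet every ball, since otherwise a ball with radius above half the supremum among the
  missed ones could be added. Balls are kept as pairs of centre and radius.\<close>

lemma vitali_5r: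
  assumes pos: "\<And>p. p \<in> G \<Longrightarrow> 0 < snd p \<and> snd p \<le> (R::real)"
  shows "\<exists>H\<subseteq>G.
    (\<forall>p\<in>H. \<forall>q\<in>H. p \<noteq> q \<longrightarrow> dball d (fst p) (snd p) \<inter> dball d (fst q) (snd q) = {}) \<and>
    (\<forall>p\<in>G. \<exists>q\<in>H. dball d (fst p) (snd p) \<inter> dball d (fst q) (snd q) \<noteq> {} \<and> snd p \<le> 2 * snd q)"
proof -
  define b where "b p = dball d (fst p) (snd p)" for p
  define \<A> where "\<A> = {H. H \<subseteq> G \<and> (\<forall>p\<in>H. \<forall>q\<in>H. p \<noteq> q \<longrightarrow> b p \<inter> b q = {}) \<and>
     (\<forall>p\<in>G. (\<exists>q\<in>H. b p \<inter> b q \<noteq> {}) \<longrightarrow> (\<exists>q\<in>H. b p \<inter> b q \<noteq> {} \<and> snd p \<le> 2 * snd q))}"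
  have "\<exists>H\<in>\<A>. \<forall>X\<in>\<A>. H \<subseteq> X \<longrightarrow> X = H"
  proof (rule subset_Zorn')
    fix \<C> assume C: "subset.chain \<A> \<C>"
    then have sub: "\<C> \<subseteq> \<A>" and ch: "\<And>X Y. X \<in> \<C> \<Longrightarrow> Y \<in> \<C> \<Longrightarrow> X \<subseteq> Y \<or> Y \<subseteq> X"
      by (auto simp: subset_chain_def)
    have "b p \<inter> b q = {}" if pq: "p \<in> \<Union>\<C>" "q \<in> \<Union>\<C>" "p \<noteq> q" for p q
    proof -
      obtain X Y where "X \<in> \<C>" "p \<in> X" "Y \<in> \<C>" "q \<in> Y" using pq by blast
      then obtain Z where "Z \<in> \<C>" "p \<in> Z" "q \<in> Z" using ch[of X Y] by blast
      then show ?thesis using sub pq(3) unfolding \<A>_def by blast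
    qed
    moreover have "\<exists>q\<in>\<Union>\<C>. b p \<inter> b q \<noteq> {} \<and> snd p \<le> 2 * snd q"
      if pq: "p \<in> G" "q \<in> \<Union>\<C>" "b p \<inter> b q \<noteq> {}" for p q
    proof -
      obtain X where X: "X \<in> \<C>" "q \<in> X" using pq(2) by blast
      then have "X \<in> \<A>" using sub by blast
      then have "\<exists>q\<in>X. b p \<inter> b q \<noteq> {} \<and> snd p \<le> 2 * snd q"
        using pq(1,3) X(2) unfolding \<A>_def by blast
      then show ?thesis using X(1) by blast
    qed
    moreover have "\<Union>\<C> \<subseteq> G" using sub by (auto simp: \<A>_def)
    ultimately show "\<Union>\<C> \<in> \<A>" unfolding \<A>_def by blast
  qed
  then obtain H where H: "H \<in> \<A>" and max: "\<And>X. X \<in> \<A> \<Longrightarrow> H \<subseteq> X \<Longrightarrow> X = H" by blast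
  have HG: "H \<subseteq> G" and disj: "\<And>p q. p \<in> H \<Longrightarrow> q \<in> H \<Longrightarrow> p \<noteq> q \<Longrightarrow> b p \<inter> b q = {}"
    and big: "\<And>p q. p \<in> G \<Longrightarrow> q \<in> H \<Longrightarrow> b p \<inter> b q \<noteq> {} \<Longrightarrow> \<exists>q\<in>H. b p \<inter> b q \<noteq> {} \<and> snd p \<le> 2 * snd q"
    using H unfolding \<A>_def by blast+
  have meet: "\<exists>q\<in>H. b p \<inter> b q \<noteq> {}" if p: "p \<in> G" for p
  proof (rule ccontr)
    assume no: "\<not> ?thesis"
    define G' where "G' = {p \<in> G. \<forall>q\<in>H. b p \<inter> b q = {}}"
    have G': "G' \<noteq> {}" using p no by (auto simp: G'_def)
    define s where "s = Sup (snd ` G')"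
    have bdd: "bdd_above (snd ` G')" using pos by (auto simp: G'_def intro!: bdd_aboveI[of _ R])
    have le_s: "snd q \<le> s" if "q \<in> G'" for q
      unfolding s_def using that bdd by (intro cSup_upper) auto
    have "0 < s" using le_s[of p] pos[OF p] p no by (auto simp: G'_def)
    then have "s / 2 < s" by simp
    then have "s / 2 < Sup (snd ` G')" by (simp add: s_def)
    then obtain z where "z \<in> snd ` G'" "s / 2 < z" by (rule less_cSupE) (use G' in blast)
    then obtain q where q: "q \<in> G'" "s / 2 < snd q" by blast
    have qG: "q \<in> G" using q(1) by (simp add: G'_def)
    have qb: "fst q \<in> b q" using pos[OF qG] by (simp add: b_def dball_def)
    have "insert q H \<in> \<A>"
      unfolding \<A>_def
    proof (intro CollectI conjI ballI impI)
      show "insert q H \<subseteq> G" using qG HG by blast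
      show "b p \<inter> b p' = {}" if "p \<in> insert q H" "p' \<in> insert q H" "p \<noteq> p'" for p p'
        using that q(1) disj unfolding G'_def by blast
      fix p assume p: "p \<in> G" and ex: "\<exists>q'\<in>insert q H. b p \<inter> b q' \<noteq> {}"
      show "\<exists>q'\<in>insert q H. b p \<inter> b q' \<noteq> {} \<and> snd p \<le> 2 * snd q'"
      proof (cases "\<exists>q'\<in>H. b p \<inter> b q' \<noteq> {}")
        case True
        then show ?thesis using big[OF p] by blast
      next
        case False
        then have "p \<in> G'" using p by (auto simp: G'_def)
        then have "snd p \<le> 2 * snd q" using le_s[of p] q(2) by simp
        moreover have "b p \<inter> b q \<noteq> {}" using ex False by blast
        ultimately show ?thesis by blast
      qed
    qed
    then have "insert q H = H" by (rule max) blast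
    then have "q \<in> H" by blast
    then show False using q(1) qb by (auto simp: G'_def)
  qed
  have "\<exists>q\<in>H. b p \<inter> b q \<noteq> {} \<and> snd p \<le> 2 * snd q" if p: "p \<in> G" for p
  proof -
    obtain q where q: "q \<in> H" "b p \<inter> b q \<noteq> {}" using meet[OF p] by blast
    show ?thesis by (rule big[OF p q])
  qed
  then show ?thesis
    using HG disj unfolding b_def by (intro exI[of _ H] conjI ballI impI)
qed

section \<open>Density bounds and the spherical measure\<close>

lemma gauge_dball: "0 < t \<Longrightarrow> ediam d (dball d y t) ^ \<alpha> / 2 ^ \<alpha> = ennreal (t ^ \<alpha>)"
  by (simp add: ediam_dball ennreal_power power_mult_distrib ennreal_mult ennreal_mult_divide_eq mult.commute[of 2]
      flip: ennreal_numeral)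

abbreviation "spherical_pre \<alpha> \<equiv> gauge_pre d {dball d x r |x r. 0 < r} (\<lambda>S. ediam d S ^ \<alpha> / 2 ^ \<alpha>)"

text \<open>The radius below which the density bound holds depends on the point. \<open>C j\<close>
  collects the points for which \<open>1 / Suc j\<close> will do, and in a fine covering every ball
  that meets \<open>C j\<close> obeys the bound. Concentration on \<open>\<Sigma>\<close> is
  expressed through Borel sets that avoid it, as \<open>\<Sigma>\<close> is not known to be Borel
  here.\<close>

lemma spherical_upper:
  fixes M :: "'n heis measure"
  assumes M [measurable_cong]: "sets M = sets borel" and \<theta>: "0 < \<theta>"
    and conc: "\<And>N. N \<in> sets borel \<Longrightarrow> N \<inter> \<Sigma> = {} \<Longrightarrow> emeasure M N = 0"
    and up: "\<And>x. x \<in> \<Sigma> \<Longrightarrow> \<exists>r>0. \<forall>y t. 0 < t \<and> t < r \<and> d y x \<le> t \<longrightarrow> emeasure M (dball d y t) \<le> ennreal (\<theta> * t ^ \<alpha>)"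
    and A [measurable]: "A \<in> sets borel"
  shows "emeasure M A \<le> ennreal \<theta> * spherical d \<alpha> (\<Sigma> \<inter> A)"
proof -
  define bad where "bad j x \<longleftrightarrow> (\<exists>y t. 0 < t \<and> t < 1 / real (Suc j) \<and> d y x \<le> t \<and> ennreal (\<theta> * t ^ \<alpha>) < emeasure M (dball d y t))"
    for j x
  \<comment> \<open>A slightly larger concentric ball still violates the strict bound, and its open
    interior part contains only bad points. So \<open>C j\<close> is closed and hence
    measurable.\<close>
  have op: "open {x. bad j x}" for j
  proof (subst open_subopen, intro ballI)
    fix x assume "x \<in> {x. bad j x}"
    then obtain y t where t: "0 < t" "t < 1 / real (Suc j)" "d y x \<le> t" "ennreal (\<theta> * t ^ \<alpha>) < emeasure M (dball d y t)"
      unfolding bad_def by blast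
    have "((\<lambda>s. ennreal (\<theta> * s ^ \<alpha>)) \<longlongrightarrow> ennreal (\<theta> * t ^ \<alpha>)) (at_right t)"
      by (intro tendsto_ennrealI tendsto_intros)
    then have "\<forall>\<^sub>F s in at_right t. ennreal (\<theta> * s ^ \<alpha>) < emeasure M (dball d y t)"
      using t(4) by (rule order_tendstoD(2))
    moreover have "\<forall>\<^sub>F s in at_right t. t < s \<and> s < 1 / real (Suc j)"
      using t(2) by (auto simp: eventually_at_right_field)
    ultimately have "\<forall>\<^sub>F s in at_right t. ennreal (\<theta> * s ^ \<alpha>) < emeasure M (dball d y t) \<and> t < s \<and> s < 1 / real (Suc j)"
      by (rule eventually_conj)
    then obtain s where s: "ennreal (\<theta> * s ^ \<alpha>) < emeasure M (dball d y t)" "t < s" "s < 1 / real (Suc j)"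
      using eventually_happens[of _ "at_right t"] trivial_limit_at_right_real by blast
    have "emeasure M (dball d y t) \<le> emeasure M (dball d y s)"
    proof (rule emeasure_mono)
      show "dball d y t \<subseteq> dball d y s" using s(2) by (auto simp: dball_def)
    qed (simp add: M borel_dball)
    then have "ennreal (\<theta> * s ^ \<alpha>) < emeasure M (dball d y s)" using s(1) by (rule less_le_trans[rotated])
    then have "{z. d y z < s} \<subseteq> {x. bad j x}"
      using s(2,3) t(1) unfolding bad_def by (auto intro!: exI[of _ y] exI[of _ s])
    moreover have "x \<in> {z. d y z < s}" using t(3) s(2) by simp
    ultimately show "\<exists>T. open T \<and> x \<in> T \<and> T \<subseteq> {x. bad j x}"
      using open_d_ball by blast
  qed
  define C where "C j = {x. \<not> bad j x}" for j
  have C [measurable]: "C j \<in> sets borel" for j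
  proof -
    have "closed (C j)" using op[of j] by (simp add: C_def closed_def Collect_neg_eq[symmetric])
    then show ?thesis by (rule borel_closed)
  qed
  have C_mono: "C i \<subseteq> C j" if "i \<le> j" for i j
  proof -
    have "1 / real (Suc j) \<le> 1 / real (Suc i)" using that by (intro frac_le) auto
    then show ?thesis unfolding C_def bad_def by (auto dest: less_le_trans)
  qed
  have C_cover: "\<exists>j. x \<in> C j" if x: "x \<in> \<Sigma>" for x
  proof -
    obtain r where r: "0 < r" "\<And>y t. 0 < t \<Longrightarrow> t < r \<Longrightarrow> d y x \<le> t \<Longrightarrow> emeasure M (dball d y t) \<le> ennreal (\<theta> * t ^ \<alpha>)"
      using up[OF x] by blast
    obtain j where j: "1 / real (Suc j) < r" using nat_approx_posE[OF r(1)] by metis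
    have "\<not> bad j x" unfolding bad_def using r(2) j by (meson less_trans not_le)
    then show ?thesis by (auto simp: C_def)
  qed
  have piece: "emeasure M (A \<inter> C j) \<le> ennreal \<theta> * spherical d \<alpha> (\<Sigma> \<inter> A)" for j
  proof -
    define \<delta> where "\<delta> = 1 / real (Suc j)"
    have \<delta>: "0 < \<delta>" by (simp add: \<delta>_def)
    have "ennreal (1 / \<theta>) * emeasure M (A \<inter> C j) \<le> spherical_pre \<alpha> \<delta> (\<Sigma> \<inter> A)"
    proof (rule gauge_pre_ge)
      fix B :: "nat \<Rightarrow> 'n heis set"
      assume B: "range B \<subseteq> insert {} {dball d x r |x r. 0 < r}" "\<Sigma> \<inter> A \<subseteq> (\<Union>i. B i)" "\<And>i. ediam d (B i) \<le> ennreal \<delta>"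
      \<comment> \<open>The discarded balls contain no point of \<open>C j\<close>, so the uncovered
        rest of \<open>A \<inter> C j\<close> avoids \<open>\<Sigma>\<close> and is null.\<close>
      define D where "D i = (if B i \<inter> C j = {} then {} else B i)" for i
      have Bi: "B i = {} \<or> (\<exists>x r. 0 < r \<and> B i = dball d x r)" for i using B(1) by blast
      have D [measurable]: "D i \<in> sets borel" for i using Bi[of i] by (auto simp: D_def)
      have "emeasure M (A \<inter> C j) \<le> emeasure M (\<Union>i. D i) + emeasure M (A \<inter> C j - (\<Union>i. D i))"
      proof -
        have "emeasure M (A \<inter> C j) \<le> emeasure M ((\<Union>i. D i) \<union> (A \<inter> C j - (\<Union>i. D i)))"
          by (intro emeasure_mono) auto
        also have "\<dots> \<le> emeasure M (\<Union>i. D i) + emeasure M (A \<inter> C j - (\<Union>i. D i))"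
          by (intro emeasure_subadditive) auto
        finally show ?thesis .
      qed
      also have "emeasure M (A \<inter> C j - (\<Union>i. D i)) = 0"
      proof (rule conc)
        show "(A \<inter> C j - (\<Union>i. D i)) \<inter> \<Sigma> = {}" using B(2) by (fastforce simp: D_def)
      qed measurable
      also have "emeasure M (\<Union>i. D i) \<le> (\<Sum>i. emeasure M (D i))"
        by (rule emeasure_subadditive_countably) (auto simp: M)
      finally have "emeasure M (A \<inter> C j) \<le> (\<Sum>i. emeasure M (D i))" by simp
      also have "\<dots> \<le> (\<Sum>i. ennreal \<theta> * (if B i = {} then 0 else ediam d (B i) ^ \<alpha> / 2 ^ \<alpha>))"
      proof (rule suminf_le)
        fix i
        show "emeasure M (D i) \<le> ennreal \<theta> * (if B i = {} then 0 else ediam d (B i) ^ \<alpha> / 2 ^ \<alpha>)"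
        proof (cases "D i = {}")
          case False
          then have Di: "D i = B i" "B i \<inter> C j \<noteq> {}" by (auto simp: D_def split: if_splits)
          then obtain y t where rescaled: "0 < t" "B i = dball d y t" using Bi[of i] by blast
          obtain x where x: "x \<in> C j" "d y x \<le> t" using Di(2) rescaled(2) by (auto simp: dball_def)
          have "ennreal (2 * t) \<le> ennreal \<delta>" using B(3)[of i] rescaled by (simp add: ediam_dball)
          then have "t < \<delta>" using rescaled(1) \<delta> by (simp add: ennreal_le_iff)
          then have "\<not> ennreal (\<theta> * t ^ \<alpha>) < emeasure M (dball d y t)"
            using x rescaled(1) unfolding C_def bad_def \<delta>_def by blast
          then have "emeasure M (dball d y t) \<le> ennreal (\<theta> * t ^ \<alpha>)" by (simp add: not_less)
          also have "\<dots> = ennreal \<theta> * (ediam d (B i) ^ \<alpha> / 2 ^ \<alpha>)"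
            using \<theta> rescaled by (simp add: gauge_dball ennreal_mult)
          finally show ?thesis using Di rescaled False by simp
        qed simp
      qed simp_all
      also have "\<dots> = ennreal \<theta> * (\<Sum>i. if B i = {} then 0 else ediam d (B i) ^ \<alpha> / 2 ^ \<alpha>)"
        by (rule ennreal_suminf_cmult)
      finally have "ennreal (1 / \<theta>) * emeasure M (A \<inter> C j) \<le>
          ennreal (1 / \<theta>) * (ennreal \<theta> * (\<Sum>i. if B i = {} then 0 else ediam d (B i) ^ \<alpha> / 2 ^ \<alpha>))"
        by (rule mult_left_mono) simp
      also have "\<dots> = (\<Sum>i. if B i = {} then 0 else ediam d (B i) ^ \<alpha> / 2 ^ \<alpha>)"
        using \<theta> by (simp add: mult.assoc[symmetric] ennreal_mult[symmetric])
      finally show "ennreal (1 / \<theta>) * emeasure M (A \<inter> C j) \<le> (\<Sum>i. if B i = {} then 0 else ediam d (B i) ^ \<alpha> / 2 ^ \<alpha>)" .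
    qed
    also have "\<dots> \<le> spherical d \<alpha> (\<Sigma> \<inter> A)"
      unfolding spherical_def using \<delta> by (rule gauge_pre_le_measure)
    finally have "ennreal \<theta> * (ennreal (1 / \<theta>) * emeasure M (A \<inter> C j)) \<le> ennreal \<theta> * spherical d \<alpha> (\<Sigma> \<inter> A)"
      by (rule mult_left_mono) simp
    then show ?thesis using \<theta> by (simp add: mult.assoc[symmetric] ennreal_mult[symmetric])
  qed
  have "emeasure M A \<le> emeasure M ((\<Union>j. A \<inter> C j) \<union> (A - (\<Union>j. C j)))"
    by (intro emeasure_mono) auto
  also have "\<dots> \<le> emeasure M (\<Union>j. A \<inter> C j) + emeasure M (A - (\<Union>j. C j))"
    by (intro emeasure_subadditive) auto
  also have "emeasure M (A - (\<Union>j. C j)) = 0"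
    by (rule conc) (measurable, use C_cover in auto)
  also have "emeasure M (\<Union>j. A \<inter> C j) = (SUP j. emeasure M (A \<inter> C j))"
    using C_mono by (intro SUP_emeasure_incseq[symmetric]) (auto simp: incseq_def M)
  finally have "emeasure M A \<le> (SUP j. emeasure M (A \<inter> C j))" by simp
  also have "\<dots> \<le> ennreal \<theta> * spherical d \<alpha> (\<Sigma> \<inter> A)"
    using piece by (rule SUP_least)
  finally show ?thesis .
qed

text \<open>Balls of large measure inside a tight open neighbourhood of \<open>A\<close> form a fine
  cover, and a disjoint subfamily has a total gauge controlled by \<open>M\<close>. Enlarging all of
  its balls would cost a factor \<open>5 ^ \<alpha>\<close>; so a finite part that carries almost
  the whole sum keeps its size and only the small tail is enlarged.\<close>

lemma spherical_lower_open:
  fixes M :: "'n heis measure"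
  assumes M [measurable_cong]: "sets M = sets borel" and \<theta>: "0 < \<theta>"
    and lo: "\<And>x r. x \<in> \<Sigma> \<Longrightarrow> 0 < r \<Longrightarrow> \<exists>y t. 0 < t \<and> t < r \<and> d y x \<le> t \<and> ennreal (\<theta> * t ^ \<alpha>) \<le> emeasure M (dball d y t)"
    and W: "open W" "emeasure M W < \<infinity>"
    and A [measurable]: "A \<in> sets borel" and AW: "A \<subseteq> W"
  shows "ennreal \<theta> * spherical d \<alpha> (\<Sigma> \<inter> A) \<le> emeasure M A"
proof -
  have pre: "ennreal \<theta> * spherical_pre \<alpha> \<delta> (\<Sigma> \<inter> A) \<le> emeasure M A" if \<delta>: "0 < \<delta>" for \<delta>
  proof (rule ennreal_le_epsilon)
    fix e :: real assume e: "0 < e"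
    have W' [measurable]: "W \<in> sets borel" using W(1) by simp
    \<comment> \<open>Outer regularity is applied to a finite measure, the restriction of
      \<open>M\<close> to \<open>W\<close>.\<close>
    define N where "N = density M (indicator W)"
    have N: "sets N = sets borel" by (simp add: N_def M)
    have N_eq: "emeasure N X = emeasure M (W \<inter> X)" if "X \<in> sets borel" for X
    proof -
      have "emeasure N X = (\<integral>\<^sup>+x. indicator W x * indicator X x \<partial>M)"
        unfolding N_def using that by (intro emeasure_density) (auto simp: M)
      also have "\<dots> = (\<integral>\<^sup>+x. indicator (W \<inter> X) x \<partial>M)"
        by (simp add: indicator_inter_arith)
      also have "\<dots> = emeasure M (W \<inter> X)"
        using that by (intro nn_integral_indicator) (auto simp: M)
      finally show ?thesis .
    qed
    have "emeasure N A = (INF U\<in>{U. A \<subseteq> U \<and> open U}. emeasure N U)"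
    proof (rule outer_regular[OF N _ A])
      have "space N = UNIV" using sets_eq_imp_space_eq[OF N] by simp
      then show "emeasure N (space N) \<noteq> \<infinity>" using W(2) by (simp add: N_eq)
    qed
    moreover have NA: "emeasure N A = emeasure M A" using AW by (simp add: N_eq Int_absorb1)
    moreover have "emeasure M A < emeasure M A + ennreal (e / 2)"
    proof -
      have "emeasure M A \<le> emeasure M W" using AW by (intro emeasure_mono) (auto simp: M)
      then have "emeasure M A < \<infinity>" using W(2) by (rule le_less_trans)
      then show ?thesis using e by (simp add: ennreal_add_left_cancel_less)
    qed
    ultimately have "(INF U\<in>{U. A \<subseteq> U \<and> open U}. emeasure N U) < emeasure M A + ennreal (e / 2)" by simp
    then obtain U where U: "A \<subseteq> U" "open U" "emeasure N U < emeasure M A + ennreal (e / 2)"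
      unfolding INF_less_iff by blast
    define Q where "Q = W \<inter> U"
    have Q: "open Q" "A \<subseteq> Q" "emeasure M Q \<le> emeasure M A + ennreal (e / 2)"
      using U W(1) AW N_eq[of U] by (auto simp: Q_def)
    have QW: "emeasure M Q < \<infinity>"
      using W(2) emeasure_mono[of Q W M] by (auto simp: Q_def M intro: le_less_trans)
    define b where "b p = dball d (fst p) (snd p)" for p :: "'n heis \<times> real"
    have b_borel [measurable]: "b p \<in> sets borel" for p by (simp add: b_def borel_dball)
    \<comment> \<open>\<open>10\<close> is twice the enlargement factor \<open>5\<close>, so that
      even enlarged balls have diameter at most \<open>\<delta>\<close>.\<close>
    define G where "G = {p. 0 < snd p \<and> 10 * snd p \<le> \<delta> \<and> b p \<subseteq> Q \<and> ennreal (\<theta> * snd p ^ \<alpha>) \<le> emeasure M (b p)}"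
    have "0 < snd p \<and> snd p \<le> \<delta>" if "p \<in> G" for p using that by (auto simp: G_def)
    then have "\<exists>H\<subseteq>G. (\<forall>p\<in>H. \<forall>q\<in>H. p \<noteq> q \<longrightarrow> b p \<inter> b q = {}) \<and>
        (\<forall>p\<in>G. \<exists>q\<in>H. b p \<inter> b q \<noteq> {} \<and> snd p \<le> 2 * snd q)"
      unfolding b_def by (rule vitali_5r)
    then obtain H where HG0: "H \<subseteq> G" and H0: "\<forall>p\<in>H. \<forall>q\<in>H. p \<noteq> q \<longrightarrow> b p \<inter> b q = {}"
        "\<forall>p\<in>G. \<exists>q\<in>H. b p \<inter> b q \<noteq> {} \<and> snd p \<le> 2 * snd q"
      by blast
    note H = HG0 H0(1)[rule_format] H0(2)[rule_format]
    have HG: "0 < snd p" "10 * snd p \<le> \<delta>" "b p \<subseteq> Q" "ennreal (\<theta> * snd p ^ \<alpha>) \<le> emeasure M (b p)" if "p \<in> H" for p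
      using that H(1) by (auto simp: G_def)
    have ctr: "fst p \<in> {z. d (fst p) z < snd p}" if "p \<in> H" for p using HG[OF that] by simp
    have sub_b: "{z. d (fst p) z < snd p} \<subseteq> b p" for p by (auto simp: b_def dball_def)
    \<comment> \<open>Disjoint open sets in a separable space are countably many, and the nonempty
      open balls inside the members of \<open>H\<close> tell these members apart.\<close>
    have H_inj: "inj_on (\<lambda>p. {z. d (fst p) z < snd p}) H"
    proof (rule inj_onI, rule ccontr)
      fix p q assume "p \<in> H" "q \<in> H" "{z. d (fst p) z < snd p} = {z. d (fst q) z < snd q}" "p \<noteq> q"
      then show False using H(2)[of p q] ctr[of p] sub_b[of p] sub_b[of q] by blast
    qed
    have "countable ((\<lambda>p. {z. d (fst p) z < snd p}) ` H)"
    proof (rule countable_disjoint_open_subsets)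
      show "pairwise disjnt ((\<lambda>p. {z. d (fst p) z < snd p}) ` H)"
      proof (clarsimp simp: pairwise_def)
        fix y t y' t' assume pq: "(y, t) \<in> H" "(y', t') \<in> H" "{z. d y z < t} \<noteq> {z. d y' z < t'}"
        then have "(y, t) \<noteq> (y', t')" by auto
        from H(2)[OF pq(1,2) this] show "disjnt {z. d y z < t} {z. d y' z < t'}"
          using sub_b[of "(y, t)"] sub_b[of "(y', t')"] by (auto simp: disjnt_def)
      qed
      fix S assume "S \<in> (\<lambda>p. {z. d (fst p) z < snd p}) ` H"
      then obtain p where "S = {z. d (fst p) z < snd p}" by blast
      then show "open S" by (simp only: open_d_ball)
    qed
    then have cH: "countable H" using H_inj by (rule countable_image_inj_on)
    have sum_le: "ennreal \<theta> * (\<integral>\<^sup>+p. ennreal (snd p ^ \<alpha>) \<partial>count_space H) \<le> emeasure M Q"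
    proof -
      have "ennreal \<theta> * (\<integral>\<^sup>+p. ennreal (snd p ^ \<alpha>) \<partial>count_space H) = (\<integral>\<^sup>+p. ennreal \<theta> * ennreal (snd p ^ \<alpha>) \<partial>count_space H)"
        by (rule nn_integral_cmult[symmetric]) simp
      also have "\<dots> \<le> (\<integral>\<^sup>+p. emeasure M (b p) \<partial>count_space H)"
      proof (rule nn_integral_mono)
        fix p assume "p \<in> space (count_space H)"
        then have p: "p \<in> H" by simp
        have "ennreal \<theta> * ennreal (snd p ^ \<alpha>) = ennreal (\<theta> * snd p ^ \<alpha>)"
          using HG(1)[OF p] \<theta> by (simp add: ennreal_mult)
        then show "ennreal \<theta> * ennreal (snd p ^ \<alpha>) \<le> emeasure M (b p)"
          using HG(4)[OF p] by simp
      qed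
      also have "\<dots> = emeasure M (\<Union>p\<in>H. b p)"
        using cH H(2) by (intro emeasure_UN_countable[symmetric]) (auto simp: M disjoint_family_on_def)
      also have "\<dots> \<le> emeasure M Q"
      proof (rule emeasure_mono)
        show "(\<Union>p\<in>H. b p) \<subseteq> Q" using HG(3) by (rule UN_least)
      qed (use Q(1) in \<open>simp add: M\<close>)
      finally show ?thesis .
    qed
    have fin: "(\<integral>\<^sup>+p. ennreal (snd p ^ \<alpha>) \<partial>count_space H) < \<infinity>"
      using le_less_trans[OF sum_le QW] \<theta> by (auto simp: ennreal_mult_less_top less_top[symmetric])
    \<comment> \<open>Chosen so that the enlarged tail contributes at most \<open>e / 2\<close>; the
      other half was spent on outer regularity.\<close>
    define c where "c = e / 2 / (\<theta> * 5 ^ \<alpha>)"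
    have c: "0 < c" "\<theta> * 5 ^ \<alpha> * c = e / 2" using e \<theta> by (auto simp: c_def)
    have "(0::ennreal) < ennreal c" using c by simp
    from nn_integral_count_space_tail[OF cH fin this]
    obtain F where F: "finite F" "F \<subseteq> H" "(\<integral>\<^sup>+p. ennreal (snd p ^ \<alpha>) * indicator (H - F) p \<partial>count_space H) < ennreal c" .
    define C where "C p = dball d (fst p) (if p \<in> F then snd p else 5 * snd p)" for p :: "'n heis \<times> real"
    have cover: "\<Sigma> \<inter> A \<subseteq> (\<Union>p\<in>H. C p)"
    proof
      fix x assume x: "x \<in> \<Sigma> \<inter> A"
      show "x \<in> (\<Union>p\<in>H. C p)"
      proof (cases "x \<in> (\<Union>p\<in>F. b p)")
        case True
        then obtain p where "p \<in> F" "x \<in> b p" by blast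
        then show ?thesis using F(2) by (intro UN_I[of p]) (auto simp: C_def b_def)
      next
        case False
        \<comment> \<open>Outside the finitely many closed balls of \<open>F\<close> there is room
          for a ball of \<open>G\<close> that contains \<open>x\<close>, as a ball of radius
          \<open>t\<close> through \<open>x\<close> stays within \<open>2 * t\<close> of it. The
          member of \<open>H\<close> that it meets then belongs to the tail.\<close>
        have "open (Q - (\<Union>p\<in>F. b p))"
          using Q(1) F(1) by (intro open_Diff closed_UN) (auto simp: b_def)
        moreover have "x \<in> Q - (\<Union>p\<in>F. b p)" using False x Q(2) by blast
        ultimately obtain r where r: "0 < r" "{y. d x y < r} \<subseteq> Q - (\<Union>p\<in>F. b p)"
          by (rule d_ball_subset_open)
        have "0 < min (r / 2) (\<delta> / 10)" using r(1) \<delta> by simp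
        with lo[of x] x obtain y t where rescaled: "0 < t" "t < min (r / 2) (\<delta> / 10)" "d y x \<le> t"
            "ennreal (\<theta> * t ^ \<alpha>) \<le> emeasure M (dball d y t)" by blast
        have sub: "b (y, t) \<subseteq> Q - (\<Union>p\<in>F. b p)"
        proof (rule subset_trans[OF _ r(2)], rule subsetI)
          fix z assume "z \<in> b (y, t)"
          then have "d y z \<le> t" by (simp add: b_def dball_def)
          then show "z \<in> {y. d x y < r}" using d_triangle[of x z y] d_commute[of x y] rescaled(2,3) by (simp only: mem_Collect_eq)
        qed
        have "(y, t) \<in> G" using sub rescaled by (auto simp: G_def b_def)
        from H(3)[OF this, unfolded snd_conv]
        obtain q where q: "q \<in> H" "b (y, t) \<inter> b q \<noteq> {}" "t \<le> 2 * snd q" by blast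
        have "q \<notin> F" using q(2) sub by blast
        obtain z where "z \<in> b (y, t)" "z \<in> b q" using q(2) by blast
        then have z: "d y z \<le> t" "d (fst q) z \<le> snd q" by (simp_all add: b_def dball_def)
        \<comment> \<open>\<open>5 = 1 + 2 + 2\<close>: from the centre of \<open>q\<close> to the
          common point, then to \<open>y\<close> and to \<open>x\<close>, the last two distances
          being at most \<open>t \<le> 2 * snd q\<close>.\<close>
        have "d (fst q) x \<le> 5 * snd q"
          using d_triangle[of "fst q" x z] d_triangle[of z x y] d_commute[of z y] z rescaled(3) q(3) by linarith
        then have "x \<in> C q" using \<open>q \<notin> F\<close> by (simp add: C_def dball_def)
        then show ?thesis using q(1) by blast
      qed
    qed
    have "spherical_pre \<alpha> \<delta> (\<Sigma> \<inter> A) \<le> (\<integral>\<^sup>+p. ediam d (C p) ^ \<alpha> / 2 ^ \<alpha> \<partial>count_space H)"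
    proof (rule gauge_pre_le_countable[OF cH _ cover])
      fix p assume p: "p \<in> H"
      show "C p \<in> {dball d x r |x r. 0 < r}" 
        using HG(1)[OF p]
        by (intro CollectI exI[of _ "fst p"] exI[of _ "if p \<in> F then snd p else 5 * snd p"]) (simp add: C_def)
      have "ediam d (C p) = ennreal (2 * (if p \<in> F then snd p else 5 * snd p))"
        unfolding C_def using HG(1)[OF p] by (intro ediam_dball) auto
      also have "\<dots> \<le> ennreal \<delta>" using HG(1,2)[OF p] by (intro ennreal_leI) auto
      finally show "ediam d (C p) \<le> ennreal \<delta>" .
    qed
    also have "\<dots> \<le> (\<integral>\<^sup>+p. ennreal (snd p ^ \<alpha>) + ennreal (5 ^ \<alpha>) * (ennreal (snd p ^ \<alpha>) * indicator (H - F) p) \<partial>count_space H)"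
    proof (rule nn_integral_mono)
      fix p assume "p \<in> space (count_space H)"
      then have p: "p \<in> H" by simp
      show "ediam d (C p) ^ \<alpha> / 2 ^ \<alpha> \<le> ennreal (snd p ^ \<alpha>) + ennreal (5 ^ \<alpha>) * (ennreal (snd p ^ \<alpha>) * indicator (H - F) p)"
      proof (cases "p \<in> F")
        case True
        then show ?thesis using HG(1)[OF p] by (simp add: C_def gauge_dball)
      next
        case False
        then have "ediam d (C p) ^ \<alpha> / 2 ^ \<alpha> = ennreal (5 ^ \<alpha>) * ennreal (snd p ^ \<alpha>)"
          using HG(1)[OF p] by (simp add: C_def gauge_dball power_mult_distrib ennreal_mult)
        then show ?thesis using False p by simp
      qed
    qed
    also have "\<dots> = (\<integral>\<^sup>+p. ennreal (snd p ^ \<alpha>) \<partial>count_space H) +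
        ennreal (5 ^ \<alpha>) * (\<integral>\<^sup>+p. ennreal (snd p ^ \<alpha>) * indicator (H - F) p \<partial>count_space H)"
      by (simp add: nn_integral_add nn_integral_cmult)
    also have "\<dots> \<le> (\<integral>\<^sup>+p. ennreal (snd p ^ \<alpha>) \<partial>count_space H) + ennreal (5 ^ \<alpha>) * ennreal c"
      using F(3) by (intro add_left_mono mult_left_mono) auto
    finally have "ennreal \<theta> * spherical_pre \<alpha> \<delta> (\<Sigma> \<inter> A) \<le>
        ennreal \<theta> * ((\<integral>\<^sup>+p. ennreal (snd p ^ \<alpha>) \<partial>count_space H) + ennreal (5 ^ \<alpha>) * ennreal c)"
      by (rule mult_left_mono) simp
    also have "\<dots> = ennreal \<theta> * (\<integral>\<^sup>+p. ennreal (snd p ^ \<alpha>) \<partial>count_space H) + ennreal (\<theta> * 5 ^ \<alpha> * c)"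
      using \<theta> c by (simp add: distrib_left ennreal_mult mult.assoc)
    also have "\<dots> \<le> (emeasure M A + ennreal (e / 2)) + ennreal (e / 2)"
      using sum_le Q(3) c(2) by (intro add_mono) auto
    also have "\<dots> = emeasure M A + ennreal e"
      using e by (simp add: add.assoc flip: ennreal_plus)
    finally show "ennreal \<theta> * spherical_pre \<alpha> \<delta> (\<Sigma> \<inter> A) \<le> emeasure M A + ennreal e" .
  qed
  have "ennreal \<theta> * spherical d \<alpha> (\<Sigma> \<inter> A) = (SUP \<delta>\<in>{0<..}. ennreal \<theta> * spherical_pre \<alpha> \<delta> (\<Sigma> \<inter> A))"
    unfolding spherical_def gauge_measure_eq_SUP by (rule SUP_mult_left_ennreal)
  also have "\<dots> \<le> emeasure M A" using pre by (intro SUP_least) auto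
  finally show ?thesis .
qed

text \<open>By Lindelof's theorem countably many open sets of finite measure cover
  \<open>\<Sigma>\<close>; the bound is summed over the disjoint Borel pieces cut out by
  them.\<close>

lemma spherical_lower:
  fixes M :: "'n heis measure"
  assumes M [measurable_cong]: "sets M = sets borel" and \<theta>: "0 < \<theta>"
    and fin: "\<And>x. x \<in> \<Sigma> \<Longrightarrow> \<exists>W. open W \<and> x \<in> W \<and> emeasure M W < \<infinity>"
    and lo: "\<And>x r. x \<in> \<Sigma> \<Longrightarrow> 0 < r \<Longrightarrow> \<exists>y t. 0 < t \<and> t < r \<and> d y x \<le> t \<and> ennreal (\<theta> * t ^ \<alpha>) \<le> emeasure M (dball d y t)"
    and A [measurable]: "A \<in> sets borel"
  shows "ennreal \<theta> * spherical d \<alpha> (\<Sigma> \<inter> A) \<le> emeasure M A"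
proof -
  let ?F = "{W. open W \<and> emeasure M W < \<infinity>}"
  obtain \<F> where \<F>: "\<F> \<subseteq> ?F" "countable \<F>" "\<Union>\<F> = \<Union>?F"
    using Lindelof[of ?F] by blast
  \<comment> \<open>The empty set is added so that an enumeration exists even if \<open>\<F>\<close>
    is empty.\<close>
  define E where "E = from_nat_into (insert {} \<F>)"
  have rE: "range E = insert {} \<F>" unfolding E_def using \<F>(2) by (intro range_from_nat_into) auto
  have E: "open (E i)" "emeasure M (E i) < \<infinity>" for i
  proof -
    have "E i \<in> insert {} \<F>" using rE by blast
    then show "open (E i)" "emeasure M (E i) < \<infinity>" using \<F>(1) by auto
  qed
  have E_cover: "\<Sigma> \<subseteq> (\<Union>i. E i)"
    using fin \<F>(3) rE by blast
  have E' [measurable]: "disjointed E i \<in> sets borel" for i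
  proof -
    have "range E \<subseteq> sets borel" using E(1) by (auto intro: borel_open)
    from sets.range_disjointed_sets[OF this] show ?thesis by blast
  qed
  have "\<Sigma> \<inter> A \<subseteq> (\<Union>i. \<Sigma> \<inter> (A \<inter> disjointed E i))"
    using E_cover UN_disjointed_eq[of E] by blast
  then have "spherical d \<alpha> (\<Sigma> \<inter> A) \<le> spherical d \<alpha> (\<Union>i. \<Sigma> \<inter> (A \<inter> disjointed E i))"
    unfolding spherical_def by (rule gauge_measure_mono)
  also have "\<dots> \<le> (\<Sum>i. spherical d \<alpha> (\<Sigma> \<inter> (A \<inter> disjointed E i)))"
    unfolding spherical_def by (rule gauge_measure_subadditive)
  finally have "ennreal \<theta> * spherical d \<alpha> (\<Sigma> \<inter> A) \<le> ennreal \<theta> * (\<Sum>i. spherical d \<alpha> (\<Sigma> \<inter> (A \<inter> disjointed E i)))"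
    by (rule mult_left_mono) simp
  also have "\<dots> = (\<Sum>i. ennreal \<theta> * spherical d \<alpha> (\<Sigma> \<inter> (A \<inter> disjointed E i)))"
    by (rule ennreal_suminf_cmult[symmetric])
  also have "\<dots> \<le> (\<Sum>i. emeasure M (A \<inter> disjointed E i))"
  proof (rule suminf_le)
    show "ennreal \<theta> * spherical d \<alpha> (\<Sigma> \<inter> (A \<inter> disjointed E i)) \<le> emeasure M (A \<inter> disjointed E i)" for i
      using disjointed_subset[of E i] by (intro spherical_lower_open[OF M \<theta> lo E(1,2)[of i]]) auto
  qed simp_all
  also have "\<dots> = emeasure M (\<Union>i. A \<inter> disjointed E i)"
    using disjoint_family_disjointed[of E]
    by (intro suminf_emeasure) (auto simp: M disjoint_family_on_def)
  also have "\<dots> \<le> emeasure M A" by (intro emeasure_mono) (auto simp: M)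
  finally show ?thesis .
qed

text \<open>The density bounds are available only for \<open>\<theta>'\<close> strictly above or
  below \<open>\<theta>\<close>, and the equality is their limit. In the lower bound an infinite
  spherical measure is treated apart, because the error is proportional to it.\<close>

theorem spherical_density:
  fixes M :: "'n heis measure"
  assumes M: "sets M = sets borel" and \<theta>: "0 < \<theta>"
    and fin: "\<And>x. x \<in> \<Sigma> \<Longrightarrow> \<exists>W. open W \<and> x \<in> W \<and> emeasure M W < \<infinity>"
    and conc: "\<And>N. N \<in> sets borel \<Longrightarrow> N \<inter> \<Sigma> = {} \<Longrightarrow> emeasure M N = 0"
    and up: "\<And>x \<theta>'. x \<in> \<Sigma> \<Longrightarrow> \<theta> < \<theta>' \<Longrightarrow>
      \<exists>r>0. \<forall>y t. 0 < t \<and> t < r \<and> d y x \<le> t \<longrightarrow> emeasure M (dball d y t) \<le> ennreal (\<theta>' * t ^ \<alpha>)"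
    and lo: "\<And>x \<theta>' r. x \<in> \<Sigma> \<Longrightarrow> 0 < \<theta>' \<Longrightarrow> \<theta>' < \<theta> \<Longrightarrow> 0 < r \<Longrightarrow>
      \<exists>y t. 0 < t \<and> t < r \<and> d y x \<le> t \<and> ennreal (\<theta>' * t ^ \<alpha>) \<le> emeasure M (dball d y t)"
    and A: "A \<in> sets borel"
  shows "emeasure M A = ennreal \<theta> * spherical d \<alpha> (\<Sigma> \<inter> A)"
proof (rule antisym)
  let ?s = "spherical d \<alpha> (\<Sigma> \<inter> A)"
  have upper: "emeasure M A \<le> ennreal \<theta>' * ?s" if "\<theta> < \<theta>'" for \<theta>'
    using \<theta> that by (intro spherical_upper[OF M _ conc up A]) auto
  have lower: "ennreal \<theta>' * ?s \<le> emeasure M A" if "0 < \<theta>'" "\<theta>' < \<theta>" for \<theta>'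
    using that by (intro spherical_lower[OF M _ fin lo A]) auto
  show "emeasure M A \<le> ennreal \<theta> * ?s"
  proof (rule ennreal_le_epsilon)
    fix e :: real assume e: "0 < e" and lt: "ennreal \<theta> * ?s < Orderings.top"
    then have "?s \<noteq> Orderings.top" using \<theta> by (auto simp: ennreal_mult_top)
    then obtain s where s: "0 \<le> s" "?s = ennreal s" by (cases ?s) auto
    have "emeasure M A \<le> ennreal (\<theta> + e / (s + 1)) * ?s" using s e by (intro upper) simp
    also have "\<dots> = ennreal (\<theta> * s + e * (s / (s + 1)))"
      using s e \<theta> by (simp add: ennreal_mult[symmetric] distrib_right)
    also have "\<dots> \<le> ennreal (\<theta> * s + e)"
      using s e by (intro ennreal_leI add_left_mono) (simp add: field_simps)
    finally show "emeasure M A \<le> ennreal \<theta> * ?s + ennreal e"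
      using s e \<theta> by (simp add: ennreal_mult)
  qed
  show "ennreal \<theta> * ?s \<le> emeasure M A"
  proof (cases "?s = Orderings.top")
    case True
    then show ?thesis using lower[of "\<theta> / 2"] \<theta> by (simp add: ennreal_mult_top)
  next
    case False
    then obtain s where s: "0 \<le> s" "?s = ennreal s" by (cases ?s) auto
    show ?thesis
    proof (rule ennreal_le_epsilon)
      fix e :: real assume e: "0 < e"
      define \<epsilon> where "\<epsilon> = min (\<theta> / 2) (e / (s + 1))"
      have \<epsilon>: "0 < \<epsilon>" "\<epsilon> < \<theta>" "\<epsilon> * s \<le> e"
      proof -
        have "\<epsilon> * s \<le> e / (s + 1) * s" using s by (intro mult_right_mono) (auto simp: \<epsilon>_def)
        also have "\<dots> \<le> e" using s e by (simp add: field_simps)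
        finally show "\<epsilon> * s \<le> e" .
      qed (use \<theta> e s in \<open>auto simp: \<epsilon>_def\<close>)
      have "ennreal \<theta> * ?s = ennreal ((\<theta> - \<epsilon>) * s + \<epsilon> * s)"
        using s \<theta> by (simp add: ennreal_mult[symmetric] algebra_simps)
      also have "\<dots> = ennreal (\<theta> - \<epsilon>) * ?s + ennreal (\<epsilon> * s)"
        using s \<epsilon> by (simp add: ennreal_mult)
      also have "\<dots> \<le> emeasure M A + ennreal e"
        using \<epsilon> by (intro add_mono lower ennreal_leI) auto
      finally show "ennreal \<theta> * ?s \<le> emeasure M A + ennreal e" .
    qed
  qed
qed

end

section \<open>Vertical subgroups and the spherical factor\<close>

definition orthonormal :: "('m::finite \<Rightarrow> 'a::real_inner) \<Rightarrow> bool" where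
  "orthonormal p \<longleftrightarrow> (\<forall>i j. p i \<bullet> p j = (if i = j then 1 else 0))"

definition hcomb :: "('m::finite \<Rightarrow> 'n::finite hvec) \<Rightarrow> real^'m \<Rightarrow> 'n hvec" where
  "hcomb p a = (\<Sum>j\<in>UNIV. a $ j *\<^sub>R p j)"

text \<open>For orthonormal \<open>p\<close>, an isometric chart of the vertical subgroup whose
  horizontal part is spanned by \<open>p\<close>.\<close>

definition frame :: "('m::finite \<Rightarrow> 'n::finite hvec) \<Rightarrow> (real^'m) \<times> real \<Rightarrow> 'n heis" where
  "frame p x = (hcomb p (fst x), snd x)"

lemma hcomb_zero [simp]: "hcomb p 0 = 0"
  by (simp add: hcomb_def)

lemma hcomb_diff: "hcomb p (a - b) = hcomb p a - hcomb p b"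
  by (simp add: hcomb_def scaleR_diff_left sum_subtractf)

lemma hcomb_add: "hcomb p (a + b) = hcomb p a + hcomb p b"
  by (simp add: hcomb_def scaleR_add_left sum.distrib)

lemma hcomb_scale: "hcomb p (t *\<^sub>R a) = t *\<^sub>R hcomb p a"
  by (simp add: hcomb_def scaleR_sum_right)

lemma continuous_on_hcomb [continuous_intros]:
  "continuous_on S f \<Longrightarrow> continuous_on S (\<lambda>x. hcomb p (f x))"
  unfolding hcomb_def by (intro continuous_intros)

lemma continuous_on_frame [continuous_intros]:
  "continuous_on S f \<Longrightarrow> continuous_on S (\<lambda>x. frame p (f x))"
  unfolding frame_def by (intro continuous_intros)

lemma norm_hcomb:
  assumes "orthonormal p"
  shows "norm (hcomb p a) = norm a"
proof -
  have "hcomb p a \<bullet> hcomb p a = (\<Sum>i\<in>UNIV. \<Sum>j\<in>UNIV. a $ i * a $ j * (p j \<bullet> p i))"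
    by (simp add: hcomb_def inner_sum_left inner_sum_right sum_distrib_left mult.assoc)
  also have "\<dots> = (\<Sum>i\<in>UNIV. \<Sum>j\<in>UNIV. if j = i then a $ i * a $ i else 0)"
    using assms by (intro sum.cong) (auto simp: orthonormal_def)
  also have "\<dots> = a \<bullet> a" by (simp add: inner_vec_def)
  finally show ?thesis by (simp add: norm_eq_sqrt_inner)
qed

lemma dist_frame:
  assumes "orthonormal p"
  shows "dist (frame p x) (frame p y) = dist x y"
proof -
  have "frame p x - frame p y = (hcomb p (fst (x - y)), snd (x - y))"
    by (simp add: frame_def hcomb_diff)
  moreover have "norm (hcomb p (fst (x - y)), snd (x - y)) = norm (fst (x - y), snd (x - y))"
    using norm_hcomb[OF assms] by (simp only: norm_prod_def fst_conv snd_conv)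
  moreover have "norm (fst (x - y), snd (x - y)) = norm (x - y)"
    by (simp only: prod.collapse)
  ultimately show ?thesis by (simp only: dist_norm)
qed

lemma range_hcomb: "range (hcomb p) = span (range p)"
proof
  show "range (hcomb p) \<subseteq> span (range p)"
  proof
    fix x assume "x \<in> range (hcomb p)"
    then obtain a where "x = hcomb p a" by blast
    then show "x \<in> span (range p)"
      by (simp only: hcomb_def) (intro span_sum span_scale span_base rangeI)
  qed
  have "subspace (range (hcomb p))"
    unfolding subspace_def
  proof (intro conjI ballI allI)
    show "0 \<in> range (hcomb p)" by (rule range_eqI[of _ _ 0]) (simp add: hcomb_def)
    show "x + y \<in> range (hcomb p)" if "x \<in> range (hcomb p)" "y \<in> range (hcomb p)" for x y
      using that by (auto simp: hcomb_add[symmetric])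
    show "c *\<^sub>R x \<in> range (hcomb p)" if "x \<in> range (hcomb p)" for c x
      using that by (auto simp: hcomb_scale[symmetric])
  qed
  moreover have "p j \<in> range (hcomb p)" for j
  proof (rule range_eqI[of _ _ "axis j 1"])
    have "(\<Sum>i\<in>UNIV. axis j 1 $ i *\<^sub>R p i) = (\<Sum>i\<in>UNIV. if i = j then p i else 0)"
      by (intro sum.cong) (auto simp: axis_def)
    then show "p j = hcomb p (axis j 1)" by (simp add: hcomb_def)
  qed
  ultimately show "span (range p) \<subseteq> range (hcomb p)" by (intro span_minimal) auto
qed

lemma range_frame: "range (frame p) = span (range p) \<times> UNIV"
  unfolding range_hcomb[symmetric]
proof (intro equalityI subsetI)
  fix x assume "x \<in> range (hcomb p) \<times> (UNIV :: real set)"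
  then obtain a where "fst x = hcomb p a" by (metis imageE mem_Times_iff)
  then have "x = frame p (a, snd x)" by (simp add: frame_def prod_eq_iff)
  then show "x \<in> range (frame p)" by blast
qed (auto simp: frame_def)

lemma dim_span_orthonormal:
  assumes "orthonormal (p :: 'm::finite \<Rightarrow> 'a::euclidean_space)"
  shows "dim (span (range p)) = CARD('m)"
proof -
  have inj: "inj p"
  proof (rule injI)
    fix i j assume "p i = p j"
    then show "i = j" using assms unfolding orthonormal_def by (metis zero_neq_one)
  qed
  have "independent (range p)"
  proof (rule pairwise_orthogonal_independent)
    show "pairwise orthogonal (range p)"
      using assms by (auto simp: pairwise_def orthogonal_def orthonormal_def)
    show "0 \<notin> range p"
      using assms unfolding orthonormal_def by (metis (mono_tags) imageE inner_zero_left zero_neq_one)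
  qed
  then show ?thesis using inj by (simp add: dim_eq_card_independent card_image)
qed

lemma hausdorff_frame:
  fixes p :: "'m::finite \<Rightarrow> 'n::finite hvec"
  assumes "orthonormal p" "E \<in> sets borel"
  shows "hausdorff (CARD('m) + 1) (frame p ` E) = hausdorff_const TYPE((real^'m) \<times> real) * emeasure lborel E"
  using hausdorff_isometry[OF dist_frame[OF assms(1)], of "CARD('m) + 1" E] hausdorff_eq_lborel[OF assms(2)]
  by simp

text \<open>Multiplication by vertical elements moves freely along the second factor, which absorbs
  the commutators and turns products into sums on the horizontal projection. Dilations and inverses
  supply all scalars.\<close>

lemma vertical_subgroup_eq:
  fixes S :: "'n::finite heis set"
  assumes S: "vertical_subgroup S"
  shows "subspace (fst ` S)" "S = fst ` S \<times> UNIV" "dim S = dim (fst ` S) + 1"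
proof -
  have sub: "subgroup S heis_group" and H2: "\<And>s. (0, s) \<in> S" and dil: "\<And>t x. 0 < t \<Longrightarrow> x \<in> S \<Longrightarrow> dil t x \<in> S"
    using S by (auto simp: vertical_subgroup_def homogeneous_subgroup_def H2_def)
  have mult: "x \<cdot> y \<in> S" if "x \<in> S" "y \<in> S" for x y
    using subgroup.m_closed[OF sub that] by (simp add: heis_group_def)
  have minus: "- x \<in> S" if "x \<in> S" for x
    using subgroup.m_inv_closed[OF sub that] by (simp add: hinv_eq)
  have vert: "(h, s') \<in> S" if "(h, s) \<in> S" for h s s'
    using mult[OF that H2[of "s' - s"]] by (simp add: heis_mult_eq)
  show eq: "S = fst ` S \<times> UNIV"
  proof (intro equalityI subsetI)
    fix x :: "'n heis" assume "x \<in> fst ` S \<times> UNIV"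
    then obtain s where "(fst x, s) \<in> S" by force
    then show "x \<in> S" using vert[of "fst x" s "snd x"] by simp
  qed force
  show subsp: "subspace (fst ` S)"
    unfolding subspace_def
  proof (intro conjI ballI allI)
    show "0 \<in> fst ` S" using H2[of 0] by force
    show "x + y \<in> fst ` S" if xy: "x \<in> fst ` S" "y \<in> fst ` S" for x y
    proof -
      have "(x, 0) \<in> S" "(y, 0) \<in> S" using xy eq by auto
      from mult[OF this] show ?thesis by (force simp: heis_mult_eq)
    qed
    show "c *\<^sub>R x \<in> fst ` S" if x: "x \<in> fst ` S" for c x
    proof -
      have xS: "(x, 0) \<in> S" using x eq by auto
      consider "c = 0" | "0 < c" | "0 < - c" by linarith
      then show ?thesis
      proof cases
        case 1
        then show ?thesis using H2[of 0] by force
      next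
        case 2
        from dil[OF 2 xS] show ?thesis by (force simp: dil_def)
      next
        case 3
        from minus[OF dil[OF 3 xS]] show ?thesis by (force simp: dil_def)
      qed
    qed
  qed
  have "dim S = dim (fst ` S \<times> (UNIV :: real set))" using eq by metis
  also have "\<dots> = dim (fst ` S) + 1"
    using subsp by (simp add: dim_Times)
  finally show "dim S = dim (fst ` S) + 1" .
qed

lemma vertical_subgroup_frame:
  fixes S :: "'n::finite heis set"
  assumes S: "vertical_subgroup S" and dim: "dim S = CARD('m::finite) + 1"
  obtains p :: "'m::finite \<Rightarrow> 'n hvec" where "orthonormal p" "span (range p) = fst ` S" "range (frame p) = S"
proof -
  note * = vertical_subgroup_eq[OF S]
  obtain B where B: "B \<subseteq> fst ` S" "pairwise orthogonal B" "\<And>x. x \<in> B \<Longrightarrow> norm x = 1"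
      "independent B" "card B = dim (fst ` S)" "span B = fst ` S"
    using orthonormal_basis_subspace[OF *(1)] by blast
  have "card B = CARD('m)" using B(5) dim *(3) by simp
  moreover have "finite B" using B(4) by (rule independent_imp_finite)
  ultimately obtain p :: "'m \<Rightarrow> 'n hvec" where p: "bij_betw p UNIV B"
    using finite_same_card_bij[of "UNIV :: 'm set" B] by auto
  have rp: "range p = B" using p by (simp add: bij_betw_def)
  have "orthonormal p"
    unfolding orthonormal_def
  proof (intro allI)
    fix i j
    show "p i \<bullet> p j = (if i = j then 1 else 0)"
    proof (cases "i = j")
      case True
      have "norm (p i) = 1" using B(3) rp by blast
      then show ?thesis using True by (simp add: dot_square_norm)
    next
      case False
      then have "p i \<noteq> p j" using p by (auto simp: bij_betw_def inj_on_def)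
      then show ?thesis using False B(2) rp by (auto simp: pairwise_def orthogonal_def)
    qed
  qed
  moreover have "range (frame p) = S"
    using *(2) by (simp add: range_frame rp B(6))
  ultimately show ?thesis using that B(6) rp by blast
qed

section \<open>Independence of the spherical factor from the subgroup\<close>

context homogeneous_dist
begin

text \<open>Translating the ball to the origin is a shear in the coordinates of the subgroup, so the
  measure of the slice depends only on the horizontal part of the centre, and the symplectic form
  drops out. This is what lets isometries that do not respect the group law compare two
  subgroups.\<close>

lemma hausdorff_frame_dball:
  fixes p :: "'m::finite \<Rightarrow> 'n hvec"
  assumes p: "orthonormal p"
  shows "hausdorff (CARD('m) + 1) (range (frame p) \<inter> dball d z 1) =
    hausdorff_const TYPE((real^'m) \<times> real) * emeasure lborel {x :: (real^'m) \<times> real. d (hcomb p (fst x) - fst z, snd x) 0 \<le> 1}"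
proof -
  let ?E = "{x :: (real^'m) \<times> real. d (hcomb p (fst x) - fst z, snd x) 0 \<le> 1}"
  let ?g = "\<lambda>a. - snd z - symp (fst z) (hcomb p a) / 2"
  have "closed ?E" by (intro closed_Collect_le continuous_intros)
  then have E: "?E \<in> sets borel" by (rule borel_closed)
  have "continuous_on UNIV ?g" by (intro continuous_intros) auto
  then have g: "?g \<in> borel_measurable borel" by (rule borel_measurable_continuous_onI)
  have "closed (frame p -` dball d z 1)"
    unfolding dball_def vimage_def mem_Collect_eq by (intro closed_Collect_le continuous_intros)
  then have F: "frame p -` dball d z 1 \<in> sets borel" by (rule borel_closed)
  have "range (frame p) \<inter> dball d z 1 = frame p ` (frame p -` dball d z 1)" by auto
  then have "hausdorff (CARD('m) + 1) (range (frame p) \<inter> dball d z 1) =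
      hausdorff_const TYPE((real^'m) \<times> real) * emeasure lborel (frame p -` dball d z 1)"
    using hausdorff_frame[OF p F] by simp
  also have "frame p -` dball d z 1 = {(a, s). (mat 1 *v a, 1 * s + ?g a) \<in> ?E}"
  proof -
    have "d z (frame p (a, s)) = d (hcomb p a - fst z, 1 * s + ?g a) 0" for a s
      using d_eq_norm[of "frame p (a, s)" z] d_commute[of z "frame p (a, s)"]
      by (simp add: heis_mult_eq frame_def algebra_simps)
    then show ?thesis by (auto simp: dball_def)
  qed
  also have "emeasure lborel {(a, s). (mat 1 *v a, 1 * s + ?g a) \<in> ?E} = emeasure lborel ?E"
    using emeasure_lborel_graph_vimage[OF _ _ g E, of "mat 1" 1] by simp
  finally show ?thesis .
qed

text \<open>For each horizontal centre \<open>h\<close> there has to be an \<open>h'\<close> that is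
  admissible at the same heights and sees the points of the second subgroup as \<open>h\<close> sees
  those of the first.\<close>

lemma spherical_factor_frame_le:
  fixes p p' :: "'m::finite \<Rightarrow> 'n hvec"
  assumes p: "orthonormal p" "orthonormal p'"
    and tr: "\<And>h. \<exists>h'. (\<forall>s. d (h, s) 0 \<le> 1 \<longrightarrow> d (h', s) 0 \<le> 1) \<and>
      (\<forall>a s. d (hcomb p a - h, s) 0 \<le> 1 \<longleftrightarrow> d (hcomb p' a - h', s) 0 \<le> 1)"
  shows "spherical_factor d (CARD('m) + 1) (range (frame p)) \<le> spherical_factor d (CARD('m) + 1) (range (frame p'))"
  unfolding spherical_factor_def
proof (rule SUP_least)
  fix z assume "z \<in> dball d 0 1"
  then have z: "d (fst z, snd z) 0 \<le> 1" by (simp add: dball_def d_commute)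
  from tr[of "fst z"] obtain h' where h': "\<And>s. d (fst z, s) 0 \<le> 1 \<Longrightarrow> d (h', s) 0 \<le> 1"
      "\<And>a s. d (hcomb p a - fst z, s) 0 \<le> 1 \<longleftrightarrow> d (hcomb p' a - h', s) 0 \<le> 1" by blast
  have "hausdorff (CARD('m) + 1) (range (frame p) \<inter> dball d z 1) =
      hausdorff (CARD('m) + 1) (range (frame p') \<inter> dball d (h', snd z) 1)"
    unfolding hausdorff_frame_dball[OF p(1)] hausdorff_frame_dball[OF p(2)] h'(2) by simp
  moreover have "(h', snd z) \<in> dball d 0 1"
    using h'(1)[OF z] by (simp add: dball_def d_commute)
  ultimately show "hausdorff (CARD('m) + 1) (range (frame p) \<inter> dball d z 1) \<le>
      (SUP z\<in>dball d 0 1. hausdorff (CARD('m) + 1) (range (frame p') \<inter> dball d z 1))"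
    by (intro SUP_upper2[of "(h', snd z)"]) auto
qed

text \<open>Split the centre into a part in the span of \<open>p\<close> and a normal part
  \<open>\<nu>\<close>. The same coordinates along \<open>p'\<close> and a vector of the same length
  normal to \<open>p'\<close> reproduce all norms by Pythagoras. A normal direction exists because
  \<open>CARD('m) < 2 * CARD('n)\<close>.\<close>

lemma spherical_factor_le_multiradial:
  fixes p p' :: "'m::finite \<Rightarrow> 'n hvec"
  assumes mr: "multiradial d" and p: "orthonormal p" "orthonormal p'" and m: "CARD('m) < 2 * CARD('n)"
  shows "spherical_factor d (CARD('m) + 1) (range (frame p)) \<le> spherical_factor d (CARD('m) + 1) (range (frame p'))"
proof (rule spherical_factor_frame_le[OF p])
  fix h
  obtain \<theta> :: "real \<times> real \<Rightarrow> real" where \<theta>: "\<And>x. d x 0 = \<theta> (norm (fst x), \<bar>snd x\<bar>)"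
    using mr unfolding multiradial_def by blast
  define u where "u = (\<chi> j. h \<bullet> p j)"
  define \<nu> where "\<nu> = h - hcomb p u"
  have hcomb_inner: "hcomb q a \<bullet> q j = a $ j" if "orthonormal q" for q :: "'m \<Rightarrow> 'n hvec" and a j
  proof -
    have "hcomb q a \<bullet> q j = (\<Sum>i\<in>UNIV. if i = j then a $ i else 0)"
      using that unfolding hcomb_def inner_sum_left by (intro sum.cong) (auto simp: orthonormal_def)
    then show ?thesis by simp
  qed
  have orth: "orthogonal \<nu> (hcomb p a)" for a
  proof -
    have "\<nu> \<bullet> p j = 0" for j using hcomb_inner[OF p(1), of u j] by (simp add: \<nu>_def inner_diff_left u_def)
    then show ?thesis by (simp add: orthogonal_def hcomb_def inner_sum_right)
  qed
  have "dim (span (range p')) < DIM('n hvec)" using dim_span_orthonormal[OF p(2)] m by simp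
  then obtain x where x: "x \<noteq> 0" "\<And>y. y \<in> span (range p') \<Longrightarrow> orthogonal x y"
    using orthogonal_to_subspace_exists[of "span (range p')"] by (auto simp: span_span)
  define \<nu>' where "\<nu>' = (norm \<nu> / norm x) *\<^sub>R x"
  have n\<nu>: "norm \<nu>' = norm \<nu>" using x(1) by (simp add: \<nu>'_def)
  have orth': "orthogonal \<nu>' (hcomb p' a)" for a
    using x(2)[of "hcomb p' a"] range_hcomb[of p'] by (auto simp: \<nu>'_def orthogonal_def)
  have key: "norm (hcomb p a - h) = norm (hcomb p' a - (hcomb p' u + \<nu>'))" for a
  proof -
    have "(norm (hcomb p a - h))\<^sup>2 = (norm (- \<nu> + hcomb p (a - u)))\<^sup>2"
      by (simp add: \<nu>_def hcomb_diff)
    also have "\<dots> = (norm \<nu>)\<^sup>2 + (norm (a - u))\<^sup>2"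
      using norm_add_Pythagorean[of "- \<nu>" "hcomb p (a - u)"] orth norm_hcomb[OF p(1)] by (simp add: orthogonal_clauses)
    also have "\<dots> = (norm (- \<nu>' + hcomb p' (a - u)))\<^sup>2"
      using norm_add_Pythagorean[of "- \<nu>'" "hcomb p' (a - u)"] orth' norm_hcomb[OF p(2)] n\<nu> by (simp add: orthogonal_clauses)
    also have "- \<nu>' + hcomb p' (a - u) = hcomb p' a - (hcomb p' u + \<nu>')"
      by (simp add: hcomb_diff)
    finally show ?thesis by simp
  qed
  have key0: "norm (hcomb p' u + \<nu>') = norm h"
    using key[of 0] by (simp only: hcomb_zero diff_0 norm_minus_cancel)
  show "\<exists>h'. (\<forall>s. d (h, s) 0 \<le> 1 \<longrightarrow> d (h', s) 0 \<le> 1) \<and>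
      (\<forall>a s. d (hcomb p a - h, s) 0 \<le> 1 \<longleftrightarrow> d (hcomb p' a - h', s) 0 \<le> 1)"
    by (rule exI[of _ "hcomb p' u + \<nu>'"]) (simp add: \<theta> key key0)
qed

text \<open>The matching centre is \<open>h' = L h\<close>. \<open>L\<close> may distort the
  symplectic form, since only horizontal differences and heights are left to compare.\<close>

lemma spherical_factor_le_orthogonal:
  fixes p :: "'m::finite \<Rightarrow> 'n hvec"
  assumes p: "orthonormal p" and L: "orthogonal_transformation L"
    and inv: "\<And>h s. d (L h, s) 0 \<le> 1 \<longleftrightarrow> d (h, s) 0 \<le> 1"
  shows "spherical_factor d (CARD('m) + 1) (range (frame p)) \<le> spherical_factor d (CARD('m) + 1) (range (frame (L \<circ> p)))"
proof (rule spherical_factor_frame_le[OF p])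
  have lin: "linear L" using L by (simp add: orthogonal_transformation_def)
  show "orthonormal (L \<circ> p)"
    using p L by (simp add: orthonormal_def orthogonal_transformation_def)
  have "hcomb (L \<circ> p) a = L (hcomb p a)" for a
    using lin by (simp add: hcomb_def linear_sum linear_scale)
  then have "hcomb (L \<circ> p) a - L h = L (hcomb p a - h)" for a h
    using lin by (simp add: linear_diff)
  then show "\<exists>h'. (\<forall>s. d (h, s) 0 \<le> 1 \<longrightarrow> d (h', s) 0 \<le> 1) \<and>
      (\<forall>a s. d (hcomb p a - h, s) 0 \<le> 1 \<longleftrightarrow> d (hcomb (L \<circ> p) a - h', s) 0 \<le> 1)" for h
    by (intro exI[of _ "L h"]) (simp add: inv)
qed

lemma spherical_factor_le:
  fixes S S' :: "'n heis set"
  assumes sym: "vertically_symmetric (CARD('m::finite) + 1) d \<or> multiradial d" and m: "0 < CARD('m)" "CARD('m) < 2 * CARD('n)"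
    and S: "vertical_subgroup S" "dim S = CARD('m) + 1" and S': "vertical_subgroup S'" "dim S' = CARD('m) + 1"
  shows "spherical_factor d (CARD('m) + 1) S \<le> spherical_factor d (CARD('m) + 1) S'"
proof -
  obtain p :: "'m \<Rightarrow> 'n hvec" where p: "orthonormal p" "span (range p) = fst ` S" "range (frame p) = S"
    using vertical_subgroup_frame[OF S] by blast
  obtain p' :: "'m \<Rightarrow> 'n hvec" where p': "orthonormal p'" "span (range p') = fst ` S'" "range (frame p') = S'"
    using vertical_subgroup_frame[OF S'] by blast
  from sym show ?thesis
  proof
    assume "multiradial d"
    from spherical_factor_le_multiradial[OF this p(1) p'(1) m(2)] show ?thesis
      unfolding p(3) p'(3) .
  next
    assume "vertically_symmetric (CARD('m) + 1) d"
    \<comment> \<open>\<open>CARD('m) + 1\<close> is at least \<open>2\<close>, which selects the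
      second alternative of the definition, and its \<open>p - 1\<close> is
      \<open>CARD('m)\<close>.\<close>
    then obtain F where F0: "\<forall>L\<in>F. orthogonal_transformation L"
        "\<forall>S1 S2. subspace S1 \<and> dim S1 = CARD('m) \<and> subspace S2 \<and> dim S2 = CARD('m) \<longrightarrow> (\<exists>L\<in>F. L ` S1 = S2)"
        "\<forall>T. orthogonal_transformation T \<and> (\<forall>s. T (0, s) = (0, s)) \<and> (\<exists>L\<in>F. \<forall>h. T (h, 0) = (L h, 0)) \<longrightarrow>
            T ` dball d 0 1 = dball d 0 1"
      using m(1) unfolding vertically_symmetric_def by auto
    note F = F0(1)[rule_format] F0(2)[rule_format, OF conjI[OF _ conjI[OF _ conjI]]]
      F0(3)[rule_format, OF conjI[OF _ conjI]]
    obtain L where L: "L \<in> F" "L ` (fst ` S) = fst ` S'"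
      using F(2)[of "fst ` S" "fst ` S'"] vertical_subgroup_eq[OF S(1)] vertical_subgroup_eq[OF S'(1)] S(2) S'(2) by auto
    have oL: "orthogonal_transformation L" by (rule F(1)[OF L(1)])
    have lin: "linear L" using oL by (simp add: orthogonal_transformation_def)
    define T where "T = (\<lambda>x :: 'n heis. (L (fst x), snd x))"
    have "linear T"
      using lin by (intro linearI) (auto simp: T_def linear_add linear_scale)
    then have oT: "orthogonal_transformation T"
      using oL by (auto simp: orthogonal_transformation_def T_def inner_prod_def)
    have TB: "T ` dball d 0 1 = dball d 0 1"
      using L(1) linear_0[OF lin] by (intro F(3)[OF oT]) (auto simp: T_def linear_0)
    have injT: "inj T" using oT by (rule orthogonal_transformation_inj)
    have inv: "d (L h, s) 0 \<le> 1 \<longleftrightarrow> d (h, s) 0 \<le> 1" for h s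
    proof -
      have "(L h, s) \<in> dball d 0 1 \<longleftrightarrow> (h, s) \<in> dball d 0 1"
        using inj_image_mem_iff[OF injT, of "(h, s)" "dball d 0 1", unfolded TB] by (simp add: T_def)
      then show ?thesis by (simp add: dball_def d_commute)
    qed
    \<comment> \<open>\<open>L \<circ> p\<close> is again a frame of \<open>S'\<close>, so the
      factor computed with it is that of \<open>S'\<close>.\<close>
    have "span (range (L \<circ> p)) = span (L ` range p)" by (simp only: image_comp)
    also have "\<dots> = L ` span (range p)" by (rule linear_span_image[OF lin])
    also have "\<dots> = fst ` S'" by (simp only: p(2) L(2))
    finally have "range (frame (L \<circ> p)) = fst ` S' \<times> UNIV" by (simp only: range_frame)
    also have "\<dots> = S'" using vertical_subgroup_eq(2)[OF S'(1)] by (rule HOL.sym)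
    finally have "range (frame (L \<circ> p)) = S'" .
    with spherical_factor_le_orthogonal[OF p(1) oL inv] show ?thesis
      unfolding p(3) by simp
  qed
qed

lemma omega_d_eq:
  assumes sym: "vertically_symmetric (CARD('m::finite) + 1) d \<or> multiradial d" and m: "0 < CARD('m)" "CARD('m) < 2 * CARD('n)"
    and S: "vertical_subgroup S" "dim S = CARD('m) + 1"
  shows "omega_d d (CARD('m) + 1) = spherical_factor d (CARD('m) + 1) S"
  unfolding omega_d_def
proof (rule the_equality)
  show "\<forall>S'. vertical_subgroup S' \<and> dim S' = CARD('m) + 1 \<longrightarrow>
      spherical_factor d (CARD('m) + 1) S' = spherical_factor d (CARD('m) + 1) S"
    using spherical_factor_le[OF sym m] S by (blast intro: antisym)
qed (use S in blast)

end

section \<open>h-homomorphisms and gradients\<close>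

lemma h_hom_mult: "h_hom L \<Longrightarrow> L (x \<cdot> y) = L x + L y"
  by (simp add: h_hom_def hom_def heis_group_def)

lemma h_hom_dil: "h_hom L \<Longrightarrow> 0 < t \<Longrightarrow> L (dil t x) = t *\<^sub>R L x"
  by (simp add: h_hom_def)

text \<open>On the vertical axis doubling is the dilation by \<open>sqrt 2\<close>, so twice the
  value of \<open>L\<close> there equals \<open>sqrt 2\<close> times it.\<close>

lemma h_hom_vertical:
  assumes L: "h_hom L"
  shows "L (0, s) = 0"
proof -
  have "(0, s) \<cdot> (0, s) = dil (sqrt 2) (0, s)" by (simp add: prod_eq_iff)
  then have "L (0, s) + L (0, s) = sqrt 2 *\<^sub>R L (0, s)"
    using h_hom_mult[OF L, of "(0, s)" "(0, s)"] h_hom_dil[OF L, of "sqrt 2" "(0, s)"] by (metis zero_less_numeral real_sqrt_gt_0_iff)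
  then have "(2 - sqrt 2) *\<^sub>R L (0, s) = 0" by (simp add: scaleR_diff_left scaleR_2)
  moreover have "sqrt 2 < 2" by (rule real_less_lsqrt) auto
  ultimately show ?thesis by simp
qed

lemma h_hom_fst:
  assumes L: "h_hom L"
  shows "L x = L (fst x, s)"
proof -
  have "x = (fst x, s) \<cdot> (0, snd x - s)" by (simp add: prod_eq_iff)
  then show ?thesis using h_hom_mult[OF L, of "(fst x, s)" "(0, snd x - s)"] h_hom_vertical[OF L] by simp
qed

text \<open>Group product and sum differ only in the vertical coordinate, which \<open>L\<close>
  ignores; the same holds for dilations and positive multiples. Inverses give the negative
  ones.\<close>

lemma h_hom_linear:
  assumes L: "h_hom L"
  shows "linear L"
proof
  fix x y :: "'a heis" and c :: real
  have "(fst (x \<cdot> y), snd (x + y)) = x + y" by (simp add: prod_eq_iff)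
  then have "L (x \<cdot> y) = L (x + y)" using h_hom_fst[OF L, of "x \<cdot> y" "snd (x + y)"] by metis
  then show add: "L (x + y) = L x + L y" using h_hom_mult[OF L, of x y] by simp
  have L0: "L 0 = 0" using h_hom_vertical[OF L, of 0] by (simp flip: zero_prod_def)
  have neg: "L (- x) = - L x" for x
    using h_hom_mult[OF L, of x "- x"] L0 by (simp add: eq_neg_iff_add_eq_0 add.commute)
  have pos: "L (c *\<^sub>R x) = c *\<^sub>R L x" if "0 < c" for c x
    using h_hom_dil[OF L that, of x] h_hom_fst[OF L, of "dil c x" "c * snd x"] h_hom_fst[OF L, of "c *\<^sub>R x" "c * snd x"]
    by simp
  consider "c = 0" | "0 < c" | "0 < - c" by linarith
  then show "L (c *\<^sub>R x) = c *\<^sub>R L x"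
  proof cases
    case 3
    show ?thesis using pos[OF 3, of x] neg[of "c *\<^sub>R x"] by simp
  qed (simp_all add: pos L0)
qed

lemma dil_tendsto_0: "((\<lambda>t. dil t w) \<longlongrightarrow> 0) (at_right 0)"
proof -
  have "((\<lambda>t. (t *\<^sub>R fst w, t\<^sup>2 * snd w)) \<longlongrightarrow> (0 *\<^sub>R fst w, 0\<^sup>2 * snd w)) (at_right 0)"
    by (intro tendsto_intros)
  then show ?thesis by (simp add: dil_def zero_prod_def)
qed

lemma dil_nonzero: "0 < t \<Longrightarrow> dil t w = 0 \<longleftrightarrow> w = 0"
  by (auto simp: prod_eq_iff)

lemma filterlim_dil_at_0:
  assumes "w \<noteq> 0"
  shows "filterlim (\<lambda>t. dil t w) (at 0) (at_right 0)"
  unfolding filterlim_at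
proof
  show "\<forall>\<^sub>F t in at_right 0. dil t w \<in> UNIV \<and> dil t w \<noteq> 0"
    using assms by (auto simp: eventually_at_right_field dil_nonzero intro!: exI[of _ 1])
qed (rule dil_tendsto_0)

section \<open>Uniqueness of h-derivatives, gradients and Jacobians\<close>

context homogeneous_dist
begin

lemma d_norm_pos: "x \<noteq> 0 \<Longrightarrow> 0 < d x 0"
  using d_nonneg[of x 0] d_eq_0[of x 0] by linarith

text \<open>Along \<open>dil t w\<close> the normalised difference of the two candidates does not
  depend on \<open>t\<close>, and yet it is bounded by a quantity that tends to
  \<open>0\<close>.\<close>

lemma has_h_derivative_unique:
  assumes L: "has_h_derivative d f L x" and L': "has_h_derivative d f L' x"
  shows "L = L'"
proof
  fix w
  have hom: "h_hom L" "h_hom L'" using L L' by (auto simp: has_h_derivative_def)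
  show "L w = L' w"
  proof (cases "w = 0")
    case True
    then show ?thesis using h_hom_linear[OF hom(1)] h_hom_linear[OF hom(2)] by (simp add: linear_0)
  next
    case False
    let ?q = "\<lambda>L w. norm (f (x \<cdot> w) - f x - L w) / d w 0"
    have "((\<lambda>w. ?q L w + ?q L' w) \<longlongrightarrow> 0 + 0) (at 0)"
      using L L' unfolding has_h_derivative_def by (intro tendsto_add) auto
    then have lim: "((\<lambda>t. ?q L (dil t w) + ?q L' (dil t w)) \<longlongrightarrow> 0) (at_right 0)"
      using filterlim_compose[OF _ filterlim_dil_at_0[OF False]] by fastforce
    have le: "norm (L w - L' w) / d w 0 \<le> ?q L (dil t w) + ?q L' (dil t w)" if t: "0 < t" for t
    proof -
      let ?a = "f (x \<cdot> dil t w) - f x"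
      have "norm (L w - L' w) / d w 0 = norm (L (dil t w) - L' (dil t w)) / d (dil t w) 0"
        using t by (simp add: h_hom_dil[OF hom(1)] h_hom_dil[OF hom(2)] d_norm_dil scaleR_diff_right[symmetric])
      also have "L (dil t w) - L' (dil t w) = (?a - L' (dil t w)) - (?a - L (dil t w))" by simp
      also have "norm \<dots> / d (dil t w) 0 \<le> (norm (?a - L' (dil t w)) + norm (?a - L (dil t w))) / d (dil t w) 0"
        by (intro divide_right_mono norm_triangle_ineq4) simp
      finally show ?thesis by (simp add: add_divide_distrib)
    qed
    have "norm (L w - L' w) / d w 0 \<le> 0"
    proof (rule tendsto_lowerbound[OF lim])
      show "\<forall>\<^sub>F t in at_right 0. norm (L w - L' w) / d w 0 \<le> ?q L (dil t w) + ?q L' (dil t w)"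
        using le by (auto simp: eventually_at_right_field intro!: exI[of _ 1])
    qed simp
    then show ?thesis using d_norm_pos[OF False] by (simp add: divide_le_0_iff)
  qed
qed

lemma h_deriv_eq:
  assumes L: "has_h_derivative d f L x"
  shows "h_deriv d f x = L"
  unfolding h_deriv_def
proof (rule the_equality[where P="\<lambda>L. has_h_derivative d f L x", OF L])
  show "L' = L" if "has_h_derivative d f L' x" for L'
    using that L by (rule has_h_derivative_unique)
qed

lemma C1h_derivative:
  assumes "C1h d \<Omega> f" "x \<in> \<Omega>"
  shows "has_h_derivative d f (h_deriv d f x) x"
proof -
  obtain L where L: "has_h_derivative d f L x" using assms unfolding C1h_def by blast
  show ?thesis unfolding h_deriv_eq[OF L] by (rule L)
qed

lemma has_h_derivative_component:
  fixes f :: "'n heis \<Rightarrow> real^'k::finite"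
  assumes "has_h_derivative d f L x"
  shows "has_h_derivative d (\<lambda>y. f y $ i) (\<lambda>w. L w $ i) x"
  unfolding has_h_derivative_def
proof
  have L: "h_hom L" using assms by (simp add: has_h_derivative_def)
  then show "h_hom (\<lambda>w. L w $ i)"
    by (auto simp: h_hom_def hom_def heis_group_def)
  have lim: "((\<lambda>w. norm (f (x \<cdot> w) - f x - L w) / d w 0) \<longlongrightarrow> 0) (at 0)"
    using assms by (simp add: has_h_derivative_def)
  show "((\<lambda>w. norm (f (x \<cdot> w) $ i - f x $ i - L w $ i) / d w 0) \<longlongrightarrow> 0) (at 0)"
  proof (rule Lim_null_comparison[OF always_eventually lim], intro allI)
    fix w
    have "\<bar>(f (x \<cdot> w) - f x - L w) $ i\<bar> \<le> norm (f (x \<cdot> w) - f x - L w)" by (rule component_le_norm_cart)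
    then have "\<bar>f (x \<cdot> w) $ i - f x $ i - L w $ i\<bar> / d w 0 \<le> norm (f (x \<cdot> w) - f x - L w) / d w 0"
      by (intro divide_right_mono) auto
    then show "norm (norm (f (x \<cdot> w) $ i - f x $ i - L w $ i) / d w 0) \<le> norm (f (x \<cdot> w) - f x - L w) / d w 0"
      by simp
  qed
qed

text \<open>Riesz representation of the linear form \<open>l\<close>; its representing vector is
  horizontal because \<open>l\<close> vanishes on the vertical axis.\<close>

lemma grad_H_eq:
  assumes "has_h_derivative d g l x"
  shows "grad_H d g x = (\<Sum>b\<in>Basis. l b *\<^sub>R b)" "grad_H d g x \<bullet> z = l z" "snd (grad_H d g x) = 0"
proof -
  have hom: "h_hom l" using assms by (simp add: has_h_derivative_def)
  let ?u = "\<Sum>b\<in>Basis. l b *\<^sub>R b"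
  have u: "?u \<bullet> z = l z" for z
  proof -
    have "l z = l (\<Sum>b\<in>Basis. (z \<bullet> b) *\<^sub>R b)" by (simp only: euclidean_representation)
    also have "\<dots> = (\<Sum>b\<in>Basis. (z \<bullet> b) * l b)"
      using h_hom_linear[OF hom] by (simp add: linear_sum linear_scale)
    finally show ?thesis
      unfolding inner_sum_left inner_scaleR_left by (simp only: inner_commute[of z] mult.commute[of "l _"])
  qed
  have u2: "snd ?u = 0"
    using u[of "(0, 1)"] h_hom_vertical[OF hom] by (simp add: inner_prod_def)
  have "grad_H d g x = ?u"
    unfolding grad_H_def h_deriv_eq[OF assms]
  proof (rule the_equality)
    fix u' assume "u' \<in> H1 \<and> (\<forall>z. l z = u' \<bullet> z)"
    then have "(u' - ?u) \<bullet> z = 0" for z using u by (simp add: inner_diff_left)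
    from this[of "u' - ?u"] show "u' = ?u" by simp
  qed (use u u2 in \<open>auto simp: H1_def\<close>)
  then show "grad_H d g x = ?u" "grad_H d g x \<bullet> z = l z" "snd (grad_H d g x) = 0"
    using u u2 by auto
qed

lemma grad_V_eq:
  assumes g: "has_h_derivative d g l x" and v: "orthonormal_basis v V"
  shows "grad_V d V g x = (\<Sum>i\<in>UNIV. l (v i) *\<^sub>R v i)"
proof -
  have hom: "h_hom l" using g by (simp add: has_h_derivative_def)
  have V: "V = span (range v)" and on: "v i \<bullet> v j = (if i = j then 1 else 0)" for i j
    using v by (auto simp: orthonormal_basis_def)
  let ?u = "\<Sum>i\<in>UNIV. l (v i) *\<^sub>R v i"
  have uV: "?u \<in> V" unfolding V by (intro span_sum span_scale span_base rangeI)
  have u: "l z = ?u \<bullet> z" if "z \<in> V" for z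
  proof -
    have lin: "linear (\<lambda>z. ?u \<bullet> z)" by (rule bounded_linear.linear) (rule bounded_linear_inner_right)
    have uv: "l (v j) = ?u \<bullet> v j" for j
    proof -
      have "?u \<bullet> v j = (\<Sum>i\<in>UNIV. if i = j then l (v i) else 0)"
        unfolding inner_sum_left by (intro sum.cong) (auto simp: on)
      then show ?thesis by simp
    qed
    show ?thesis
    proof (rule linear_eq_on_span[OF h_hom_linear[OF hom] lin])
      show "z \<in> span (range v)" using that by (simp only: V)
      fix x assume "x \<in> range v"
      then obtain j where x: "x = v j" by blast
      show "l x = ?u \<bullet> x" unfolding x by (rule uv)
    qed
  qed
  show ?thesis
    unfolding grad_V_def h_deriv_eq[OF g]
  proof (rule the_equality)
    fix u' assume u': "u' \<in> V \<and> (\<forall>z\<in>V. l z = u' \<bullet> z)"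
    define u0 where "u0 = ?u"
    have mem: "u' - u0 \<in> V" using u' uV unfolding V u0_def by (intro span_diff) auto
    have "u' \<bullet> (u' - u0) = u0 \<bullet> (u' - u0)" 
    proof -
      have "l (u' - u0) = u' \<bullet> (u' - u0)" using u' mem by blast
      then show ?thesis using u[OF mem, folded u0_def] by linarith
    qed
    then have "(u' - u0) \<bullet> (u' - u0) = 0" unfolding inner_diff_left by linarith
    then show "u' = ?u" by (simp add: u0_def)
  qed (use u uV in blast)
qed

text \<open>In the basis \<open>v\<close> the gradients along \<open>V\<close> are the rows of the
  matrix of \<open>L\<close> on \<open>V\<close>, so their Gram matrix is that matrix times its
  transpose.\<close>

lemma J_V_eq:
  fixes f :: "'n heis \<Rightarrow> real^'k::finite" and v :: "'k \<Rightarrow> 'n heis"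
  assumes f: "has_h_derivative d f L x" and v: "orthonormal_basis v V"
  shows "J_V d V f x = \<bar>det (\<chi> i j. L (v j) $ i)\<bar>"
proof -
  have on: "v i \<bullet> v j = (if i = j then 1 else 0)" for i j
    using v by (auto simp: orthonormal_basis_def)
  let ?B = "\<chi> i j. L (v j) $ i"
  have g: "grad_V d V (\<lambda>y. f y $ i) x = (\<Sum>j\<in>UNIV. (L (v j) $ i) *\<^sub>R v j)" for i
    by (rule grad_V_eq[OF has_h_derivative_component[OF f] v])
  have "grad_V d V (\<lambda>y. f y $ i) x \<bullet> grad_V d V (\<lambda>y. f y $ j) x = (\<Sum>l\<in>UNIV. L (v l) $ i * L (v l) $ j)" for i j
  proof -
    have "grad_V d V (\<lambda>y. f y $ i) x \<bullet> v l = L (v l) $ i" for l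
    proof -
      have "grad_V d V (\<lambda>y. f y $ i) x \<bullet> v l = (\<Sum>j\<in>UNIV. if j = l then L (v j) $ i else 0)"
        unfolding g inner_sum_left by (intro sum.cong) (auto simp: on)
      then show ?thesis by simp
    qed
    then show ?thesis by (subst (2) g) (simp add: inner_sum_right mult.commute)
  qed
  then have "(\<chi> i j. grad_V d V (\<lambda>y. f y $ i) x \<bullet> grad_V d V (\<lambda>y. f y $ j) x) = ?B ** transpose ?B"
    by (simp add: vec_eq_iff matrix_matrix_mult_def transpose_def)
  then show ?thesis by (simp add: J_V_def wedge_norm_def wedge_inner_def det_mul)
qed

lemma continuous_on_det_real [continuous_intros]:
  fixes M :: "'x::topological_space \<Rightarrow> 'i::finite \<Rightarrow> 'i \<Rightarrow> real"
  assumes "\<And>i j. continuous_on S (\<lambda>x. M x i j)"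
  shows "continuous_on S (\<lambda>x. det (\<chi> i j. M x i j))"
  unfolding det_def by (simp, intro continuous_intros assms)

lemma continuous_on_h_deriv:
  assumes "C1h d \<Omega> f"
  shows "continuous_on \<Omega> (\<lambda>x. h_deriv d f x z)"
proof -
  have "continuous_on \<Omega> (h_deriv d f)" using assms by (simp add: C1h_def)
  then show ?thesis by (rule continuous_on_product_then_coordinatewise)
qed

text \<open>Both Jacobians are continuous expressions in finitely many values
  \<open>h_deriv d f x b\<close> with \<open>b\<close> fixed, so pointwise continuity of the
  differential suffices.\<close>

lemma continuous_on_J:
  fixes f :: "'n heis \<Rightarrow> real^'k::finite"
  assumes C: "C1h d \<Omega> f" and v: "orthonormal_basis (v :: 'k \<Rightarrow> 'n heis) V"
  shows "continuous_on \<Omega> (J_H d f)" "continuous_on \<Omega> (J_V d V f)"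
proof -
  have "continuous_on \<Omega> (\<lambda>x. \<bar>det (\<chi> i j. h_deriv d f x (v j) $ i)\<bar>)"
    by (intro continuous_intros continuous_on_h_deriv[OF C])
  then show "continuous_on \<Omega> (J_V d V f)"
    by (rule continuous_on_cong[OF refl, THEN iffD1, rotated]) (simp add: J_V_eq[OF C1h_derivative[OF C] v])
  let ?g = "\<lambda>x i. \<Sum>b\<in>Basis. (h_deriv d f x b $ i) *\<^sub>R (b :: 'n heis)"
  have "continuous_on \<Omega> (\<lambda>x. sqrt (det (\<chi> i j. ?g x i \<bullet> ?g x j)))"
    by (intro continuous_intros continuous_on_h_deriv[OF C])
  then show "continuous_on \<Omega> (J_H d f)"
    by (rule continuous_on_cong[OF refl, THEN iffD1, rotated])
      (simp add: J_H_def wedge_norm_def wedge_inner_def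
        grad_H_eq(1)[OF has_h_derivative_component[OF C1h_derivative[OF C]]])
qed

end

section \<open>Intrinsic graphs\<close>

locale intrinsic_graph = homogeneous_dist d
  for d :: "'n::finite heis \<Rightarrow> 'n heis \<Rightarrow> real" +
  fixes W V U :: "'n heis set" and \<phi> :: "'n heis \<Rightarrow> 'n heis"
    and p :: "'m::finite \<Rightarrow> 'n hvec" and v :: "'k::finite \<Rightarrow> 'n heis"
  assumes semi: "semidirect W V"
    and U_open: "openin (top_of_set W) U" and \<phi>_V: "\<phi> ` U \<subseteq> V"
    and uid: "unif_intrinsic_differentiable d W V U \<phi>"
    and p: "orthonormal p" and W_eq: "W = range (frame p)"
    and v: "orthonormal_basis v V"
    and card: "CARD('k) + CARD('m) = 2 * CARD('n)"
begin

lemma mem_W: "x \<in> W \<longleftrightarrow> fst x \<in> span (range p)"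
  unfolding W_eq range_frame by (simp add: mem_Times_iff)

lemma V_span: "V = span (range v)"
  using v by (simp add: orthonormal_basis_def)

lemma V_snd: "x \<in> V \<Longrightarrow> snd x = 0"
  using semi by (auto simp: semidirect_def horizontal_subgroup_def H1_def)

lemma V_subgroup: "subgroup V heis_group"
  using semi by (simp add: semidirect_def horizontal_subgroup_def homogeneous_subgroup_def)

lemma V_mult: "x \<in> V \<Longrightarrow> y \<in> V \<Longrightarrow> x \<cdot> y \<in> V"
  using subgroup.m_closed[OF V_subgroup, of x y] by (simp add: heis_group_def)

lemma V_minus: "x \<in> V \<Longrightarrow> - x \<in> V"
  using subgroup.m_inv_closed[OF V_subgroup, of x] by (simp add: hinv_eq)

lemma V_dil: "x \<in> V \<Longrightarrow> dil t x = t *\<^sub>R x"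
  by (simp add: prod_eq_iff V_snd)

lemma V_dil_mem: "x \<in> V \<Longrightarrow> dil t x \<in> V"
  unfolding V_dil unfolding V_span by (rule span_scale)

lemma W_mult: "x \<in> W \<Longrightarrow> y \<in> W \<Longrightarrow> x \<cdot> y \<in> W"
  by (simp add: mem_W span_add)

lemma W_minus: "x \<in> W \<Longrightarrow> - x \<in> W"
  by (simp add: mem_W span_neg)

lemma W_dil: "x \<in> W \<Longrightarrow> dil t x \<in> W"
  by (simp add: mem_W span_scale)

lemma W_conj: "y \<cdot> x \<cdot> (- y) \<in> W \<longleftrightarrow> x \<in> W"
  by (simp add: mem_W)

lemma W_Int_V: "x \<in> W \<Longrightarrow> x \<in> V \<Longrightarrow> x = 0"
  using semi by (auto simp: semidirect_def)

lemma zero_W: "0 \<in> W" and zero_V: "0 \<in> V"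
  using semi by (auto simp: semidirect_def)

lemma decomposition:
  obtains w x' where "w \<in> W" "x' \<in> V" "x = w \<cdot> x'"
proof -
  have "x \<in> W <#>\<^bsub>heis_group\<^esub> V" using semi by (simp add: semidirect_def)
  then show ?thesis using that by (auto simp: set_mult_def heis_group_def)
qed

lemma decomposition_unique:
  assumes "w \<in> W" "x \<in> V" "w' \<in> W" "x' \<in> V" "w \<cdot> x = w' \<cdot> x'"
  shows "w = w'" "x = x'"
proof -
  have "(- w') \<cdot> w = x' \<cdot> (- x)"
  proof -
    have "(- w') \<cdot> w = (- w') \<cdot> (w \<cdot> x) \<cdot> (- x)" by (simp add: heis_mult_assoc)
    also have "\<dots> = x' \<cdot> (- x)" using assms(5) by simp
    finally show ?thesis .
  qed
  moreover have "(- w') \<cdot> w \<in> W" "x' \<cdot> (- x) \<in> V"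
    using assms by (simp_all add: W_mult W_minus V_mult V_minus)
  ultimately have 0: "(- w') \<cdot> w = 0" "x' \<cdot> (- x) = 0" using W_Int_V by metis+
  have "w' \<cdot> ((- w') \<cdot> w) = w'" by (simp only: 0 heis_mult_zero)
  then show "w = w'" by simp
  have "x' \<cdot> (- x) \<cdot> x = x" by (simp only: 0 heis_mult_zero)
  then show "x = x'" by (simp add: heis_mult_assoc)
qed

lemma projV_eq:
  assumes "w \<in> W" "x \<in> V"
  shows "projV W V (w \<cdot> x) = x"
  unfolding projV_def
proof (rule the_equality)
  show "x \<in> V \<and> (\<exists>w'\<in>W. w \<cdot> x = w' \<cdot> x)" using assms by blast
  fix x' assume "x' \<in> V \<and> (\<exists>w'\<in>W. w \<cdot> x = w' \<cdot> x')"
  then show "x' = x" using decomposition_unique(2)[OF assms] by metis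
qed

lemma U_W: "u \<in> U \<Longrightarrow> u \<in> W"
  using openin_imp_subset[OF U_open] by blast

lemma \<phi>_in_V: "u \<in> U \<Longrightarrow> \<phi> u \<in> V"
  using \<phi>_V by blast

text \<open>With \<open>x = graph_map \<phi> u\<close>, \<open>shift u\<close> is \<open>\<sigma>\<^sub>x\<close> and \<open>\<psi> u\<close> is the translated function
  \<open>\<phi>\<^sub>y\<close> for \<open>y\<close> the inverse of \<open>x\<close>.\<close>
definition shift :: "'n heis \<Rightarrow> 'n heis \<Rightarrow> 'n heis" where
  "shift u w = u \<cdot> \<phi> u \<cdot> w \<cdot> (- \<phi> u)"

definition \<psi> :: "'n heis \<Rightarrow> 'n heis \<Rightarrow> 'n heis" where
  "\<psi> u w = (- \<phi> u) \<cdot> \<phi> (shift u w)"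

lemma shift_graph_map: "shift u w = graph_map \<phi> u \<cdot> w \<cdot> (- \<phi> u)"
  by (simp add: shift_def graph_map_def)

lemma shift_W: "u \<in> W \<Longrightarrow> w \<in> W \<Longrightarrow> shift u w \<in> W"
  by (simp add: shift_def mem_W span_add)

lemma shift_zero [simp]: "shift u 0 = u"
  by (simp add: shift_def heis_mult_assoc)

lemma graph_map_shift: "graph_map \<phi> (shift u w) = graph_map \<phi> u \<cdot> (w \<cdot> \<psi> u w)"
  by (simp add: graph_map_def \<psi>_def shift_def heis_mult_assoc)

lemma \<psi>_V: "u \<in> U \<Longrightarrow> shift u w \<in> U \<Longrightarrow> \<psi> u w \<in> V"
  by (simp add: \<psi>_def V_mult V_minus \<phi>_in_V)

text \<open>Inversion reverses the factors; conjugation brings the one in \<open>W\<close> back to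
  the front, as \<open>W\<close> is normal.\<close>

lemma projV_minus_graph_map:
  assumes "u \<in> U"
  shows "projV W V (- graph_map \<phi> u) = - \<phi> u"
proof -
  have "- graph_map \<phi> u = ((- \<phi> u) \<cdot> (- u) \<cdot> (- (- \<phi> u))) \<cdot> (- \<phi> u)"
    by (simp add: graph_map_def minus_heis_mult heis_mult_assoc)
  moreover have "(- \<phi> u) \<cdot> (- u) \<cdot> (- (- \<phi> u)) \<in> W"
    using W_conj[of "- \<phi> u" "- u"] W_minus[OF U_W[OF assms]] by blast
  ultimately show ?thesis using projV_eq V_minus[OF \<phi>_in_V[OF assms]] by metis
qed

lemma phi_tr_eq:
  assumes "u \<in> U"
  shows "phi_tr W V \<phi> (hinv (graph_map \<phi> u)) w = \<psi> u w"
proof -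
  have pg: "projV W V (graph_map \<phi> u) = \<phi> u"
    unfolding graph_map_def by (rule projV_eq[OF U_W[OF assms] \<phi>_in_V[OF assms]])
  show ?thesis
    by (simp add: phi_tr_def sigma_tr_def hinv_eq projV_minus_graph_map[OF assms] pg \<psi>_def shift_graph_map)
qed

lemma sigma_tr_mem:
  assumes u: "u \<in> U" and w: "shift u w \<in> U"
  shows "w \<in> sigma_tr W V (hinv (graph_map \<phi> u)) ` U"
proof (rule image_eqI[OF _ w])
  have "sigma_tr W V (hinv (graph_map \<phi> u)) (shift u w) = (- graph_map \<phi> u) \<cdot> (graph_map \<phi> u \<cdot> w \<cdot> (- \<phi> u)) \<cdot> \<phi> u"
    by (simp add: sigma_tr_def hinv_eq projV_minus_graph_map[OF u] shift_graph_map)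
  also have "\<dots> = w" by (simp add: heis_mult_assoc)
  finally show "w = sigma_tr W V (hinv (graph_map \<phi> u)) (shift u w)" by simp
qed

text \<open>Evaluate the outer supremum at \<open>w' = u\<close>, where the translated function is
  \<open>\<psi> u\<close>, and clear the denominator.\<close>

lemma intrinsic_derivative:
  assumes u: "u \<in> U"
  shows "\<exists>D. (\<forall>x\<in>W. D x \<in> V) \<and> (\<forall>t>0. \<forall>x\<in>W. D (dil t x) = dil t (D x)) \<and>
    (\<forall>\<epsilon>>0. \<exists>\<delta>>0. \<forall>w. shift u w \<in> U \<and> w \<noteq> 0 \<and> d w 0 < \<delta> \<longrightarrow> d (D w) (\<psi> u w) \<le> \<epsilon> * d w 0)"
proof -
  let ?I = "\<lambda>D w' \<delta>. SUP w\<in>{w \<in> sigma_tr W V (hinv (graph_map \<phi> w')) ` U. 0 < d w 0 \<and> d w 0 < \<delta>}.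
              ennreal (d (D w) (phi_tr W V \<phi> (hinv (graph_map \<phi> w')) w) / d w 0)"
  obtain D where D: "h_hom_between W V D"
      "((\<lambda>\<delta>::real. SUP w'\<in>{w'\<in>U. d (hinv u \<cdot> w') 0 < \<delta>}. ?I D w' \<delta>) \<longlongrightarrow> 0) (at_right 0)"
    using uid u unfolding unif_intrinsic_differentiable_def by blast
  have "\<exists>\<delta>>0. \<forall>w. shift u w \<in> U \<and> w \<noteq> 0 \<and> d w 0 < \<delta> \<longrightarrow> d (D w) (\<psi> u w) \<le> \<epsilon> * d w 0" if \<epsilon>: "0 < \<epsilon>" for \<epsilon>
  proof -
    have "\<forall>\<^sub>F \<delta> in at_right 0. (SUP w'\<in>{w'\<in>U. d (hinv u \<cdot> w') 0 < \<delta>}. ?I D w' \<delta>) < ennreal \<epsilon>"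
      using \<epsilon> by (intro order_tendstoD(2)[OF D(2)]) simp
    then obtain b where b: "0 < b"
        "\<forall>\<delta>>0. \<delta> < b \<longrightarrow> (SUP w'\<in>{w'\<in>U. d (hinv u \<cdot> w') 0 < \<delta>}. ?I D w' \<delta>) < ennreal \<epsilon>"
      unfolding eventually_at_right_field by blast
    define \<delta> where "\<delta> = b / 2"
    have \<delta>: "0 < \<delta>" "(SUP w'\<in>{w'\<in>U. d (hinv u \<cdot> w') 0 < \<delta>}. ?I D w' \<delta>) < ennreal \<epsilon>"
    proof -
      show "0 < \<delta>" using b(1) by (simp add: \<delta>_def)
      moreover have "\<delta> < b" using b(1) by (simp add: \<delta>_def)
      ultimately show "(SUP w'\<in>{w'\<in>U. d (hinv u \<cdot> w') 0 < \<delta>}. ?I D w' \<delta>) < ennreal \<epsilon>"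
        using b(2) by blast
    qed
    have "d (D w) (\<psi> u w) \<le> \<epsilon> * d w 0" if w: "shift u w \<in> U" "w \<noteq> 0" "d w 0 < \<delta>" for w
    proof -
      have "ennreal (d (D w) (\<psi> u w) / d w 0) \<le> ?I D u \<delta>"
        using w d_norm_pos[OF w(2)] sigma_tr_mem[OF u w(1)]
        by (intro SUP_upper2[of w]) (auto simp: phi_tr_eq[OF u])
      also have "\<dots> \<le> (SUP w'\<in>{w'\<in>U. d (hinv u \<cdot> w') 0 < \<delta>}. ?I D w' \<delta>)"
        using u \<delta>(1) by (intro SUP_upper) (auto simp: hinv_eq)
      also have "\<dots> < ennreal \<epsilon>" by (rule \<delta>(2))
      finally have "d (D w) (\<psi> u w) / d w 0 < \<epsilon>" by (simp add: ennreal_less_iff)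
      then show ?thesis using d_norm_pos[OF w(2)] by (simp add: field_simps)
    qed
    then show ?thesis using \<delta>(1) by blast
  qed
  moreover have "\<forall>x\<in>W. D x \<in> V" using D(1) by (auto simp: h_hom_between_def hom_def)
  moreover have "\<forall>t>0. \<forall>x\<in>W. D (dil t x) = dil t (D x)" using D(1) by (simp add: h_hom_between_def)
  ultimately show ?thesis by blast
qed

section \<open>Blow-up of an intrinsic graph at a point\<close>

lemma continuous_on_shift: "continuous_on S (\<lambda>w. shift u w)"
  unfolding shift_def by (intro continuous_intros)

lemma shift_in_U:
  assumes u: "u \<in> U"
  shows "\<exists>\<delta>>0. \<forall>w\<in>W. d w 0 < \<delta> \<longrightarrow> shift u w \<in> U"
proof -
  obtain T where T: "open T" "U = W \<inter> T" using U_open by (auto simp: openin_open)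
  have "open (shift u -` T)" using T(1) continuous_on_shift by (rule open_vimage)
  moreover have "0 \<in> shift u -` T" using u T(2) by simp
  ultimately obtain r where r: "0 < r" "{y. d 0 y < r} \<subseteq> shift u -` T" by (rule d_ball_subset_open)
  have "shift u w \<in> U" if "w \<in> W" "d w 0 < r" for w
  proof -
    have "w \<in> {y. d 0 y < r}" using that(2) d_commute[of w 0] by simp
    then have "shift u w \<in> T" using r(2) by blast
    then show ?thesis using T(2) shift_W[OF U_W[OF u] that(1)] by blast
  qed
  then show ?thesis using r(1) by blast
qed

text \<open>Translating the graph by the inverse of \<open>graph_map \<phi> u\<close> and dilating
  by \<open>1 / t\<close> gives the graph of \<open>rescaled u t\<close>.\<close>

definition rescaled :: "'n heis \<Rightarrow> real \<Rightarrow> 'n heis \<Rightarrow> 'n heis" where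
  "rescaled u t \<eta> = dil (1 / t) (\<psi> u (dil t \<eta>))"

lemma graph_map_blow_up:
  "0 < t \<Longrightarrow> graph_map \<phi> (shift u (dil t \<eta>)) = graph_map \<phi> u \<cdot> dil t (\<eta> \<cdot> rescaled u t \<eta>)"
  by (simp add: graph_map_shift rescaled_def dil_mult)

lemma rescaled_V: "u \<in> U \<Longrightarrow> shift u (dil t \<eta>) \<in> U \<Longrightarrow> rescaled u t \<eta> \<in> V"
  by (simp add: rescaled_def V_dil_mem \<psi>_V)

lemma \<psi>_zero: "\<psi> u 0 = 0"
  by (simp add: \<psi>_def)

text \<open>\<open>dil t\<close> shrinks the ball of radius \<open>R\<close> to radius
  \<open>t * R\<close>, where the estimate for \<open>D\<close> applies with constant
  \<open>\<epsilon> / R\<close>. Both \<open>D\<close> and \<open>\<psi> u\<close> are rescaled by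
  the same dilation, so \<open>t\<close> cancels and the bound is uniform on the ball.\<close>

lemma blow_up_uniform:
  assumes u: "u \<in> U"
    and D: "\<forall>t>0. \<forall>x\<in>W. D (dil t x) = dil t (D x)" "D 0 = 0"
      "\<forall>\<epsilon>>0. \<exists>\<delta>>0. \<forall>w. shift u w \<in> U \<and> w \<noteq> 0 \<and> d w 0 < \<delta> \<longrightarrow> d (D w) (\<psi> u w) \<le> \<epsilon> * d w 0"
    and R: "0 < R" and \<epsilon>: "0 < \<epsilon>"
  shows "\<exists>t0>0. \<forall>t \<eta>. 0 < t \<and> t < t0 \<and> \<eta> \<in> W \<and> d \<eta> 0 \<le> R \<longrightarrow>
     shift u (dil t \<eta>) \<in> U \<and> d (D \<eta>) (rescaled u t \<eta>) \<le> \<epsilon>"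
proof -
  obtain \<delta>1 where \<delta>1: "0 < \<delta>1" "\<forall>w\<in>W. d w 0 < \<delta>1 \<longrightarrow> shift u w \<in> U" using shift_in_U[OF u] by blast
  have "0 < \<epsilon> / R" using R \<epsilon> by simp
  then obtain \<delta>2 where \<delta>2: "0 < \<delta>2" "\<forall>w. shift u w \<in> U \<and> w \<noteq> 0 \<and> d w 0 < \<delta>2 \<longrightarrow> d (D w) (\<psi> u w) \<le> \<epsilon> / R * d w 0"
    using D(3) by blast
  define t0 where "t0 = min \<delta>1 \<delta>2 / R"
  have "shift u (dil t \<eta>) \<in> U \<and> d (D \<eta>) (rescaled u t \<eta>) \<le> \<epsilon>"
    if t: "0 < t" "t < t0" and \<eta>: "\<eta> \<in> W" "d \<eta> 0 \<le> R" for t \<eta>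
  proof -
    have "d (dil t \<eta>) 0 \<le> t * R" using \<eta>(2) t(1) by (simp add: d_norm_dil)
    also have "\<dots> < min \<delta>1 \<delta>2" using t R by (simp add: t0_def pos_less_divide_eq)
    finally have small: "d (dil t \<eta>) 0 < \<delta>1" "d (dil t \<eta>) 0 < \<delta>2" by simp_all
    have inU: "shift u (dil t \<eta>) \<in> U" using \<delta>1(2) small(1) W_dil[OF \<eta>(1)] by blast
    show ?thesis
    proof (cases "\<eta> = 0")
      case True
      then show ?thesis using inU D(2) \<epsilon> by (simp add: rescaled_def \<psi>_zero)
    next
      case False
      then have nz: "dil t \<eta> \<noteq> 0" using t(1) by (simp add: dil_nonzero)
      have "d (D (dil t \<eta>)) (\<psi> u (dil t \<eta>)) \<le> \<epsilon> / R * d (dil t \<eta>) 0"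
        using \<delta>2(2) inU nz small(2) by blast
      moreover have "D (dil t \<eta>) = dil t (D \<eta>)" using D(1) t(1) \<eta>(1) by blast
      moreover have "\<psi> u (dil t \<eta>) = dil t (rescaled u t \<eta>)" using t(1) by (simp add: rescaled_def)
      ultimately have "t * d (D \<eta>) (rescaled u t \<eta>) \<le> \<epsilon> / R * (t * d \<eta> 0)"
        by (simp only: d_dil[OF t(1)] d_norm_dil[OF t(1)])
      then have "t * d (D \<eta>) (rescaled u t \<eta>) \<le> t * (\<epsilon> / R * d \<eta> 0)"
        by (simp only: mult.left_commute)
      then have "d (D \<eta>) (rescaled u t \<eta>) \<le> \<epsilon> / R * d \<eta> 0" using t(1) by (rule mult_left_le_imp_le)
      also have "\<dots> \<le> \<epsilon> / R * R" using \<eta>(2) R \<epsilon> by (intro mult_left_mono) auto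
      also have "\<dots> = \<epsilon>" using R by simp
      finally show ?thesis using inU by blast
    qed
  qed
  moreover have "0 < t0" using \<delta>1(1) \<delta>2(1) R by (simp add: t0_def)
  ultimately show ?thesis by blast
qed

end

section \<open>The tangent subgroup as the kernel of the differential\<close>

lemma tendsto_heis_mult [tendsto_intros]:
  "(f \<longlongrightarrow> a) F \<Longrightarrow> (g \<longlongrightarrow> b) F \<Longrightarrow> ((\<lambda>x. f x \<cdot> g x) \<longlongrightarrow> a \<cdot> b) F"
  unfolding heis_mult_eq by (intro tendsto_intros) auto

lemma hcomb_inner:
  assumes "orthonormal q"
  shows "q j \<bullet> hcomb q a = a $ j"
proof -
  have "q j \<bullet> hcomb q a = (\<Sum>i\<in>UNIV. if i = j then a $ i else 0)"
    unfolding hcomb_def inner_sum_right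
    using assms by (intro sum.cong) (auto simp: orthonormal_def)
  then show ?thesis by simp
qed

lemma linear_hcomb:
  assumes "linear L"
  shows "L (hcomb q a, 0) = (\<Sum>j\<in>UNIV. a $ j *\<^sub>R L (q j, 0 :: real))"
proof -
  have "(hcomb q a, 0 :: real) = (\<Sum>j\<in>UNIV. a $ j *\<^sub>R (q j, 0))"
    by (simp add: prod_eq_iff fst_sum snd_sum hcomb_def)
  then show ?thesis using assms by (simp only: linear_sum linear_scale)
qed

locale defining_graph = intrinsic_graph d W V U \<phi> p v
  for d :: "'n::finite heis \<Rightarrow> 'n heis \<Rightarrow> real" and W V U \<phi>
    and p :: "'m::finite \<Rightarrow> 'n hvec" and v :: "'k::finite \<Rightarrow> 'n heis" +
  fixes f :: "'n heis \<Rightarrow> real^'k" and \<Omega> :: "'n heis set" and c0 :: "real^'k"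
  assumes C1h: "C1h d \<Omega> f" and graph_\<Omega>: "\<And>u. u \<in> U \<Longrightarrow> graph_map \<phi> u \<in> \<Omega>"
    and f_const: "\<And>u. u \<in> U \<Longrightarrow> f (graph_map \<phi> u) = c0"
    and surj_deriv: "\<And>u. u \<in> U \<Longrightarrow> surj (h_deriv d f (graph_map \<phi> u))"
begin

text \<open>Chain rule. \<open>f\<close> is constant on the graph, whose points over the direction
  \<open>\<eta>\<close> are \<open>x \<cdot> dil t (?z t)\<close> with \<open>?z t\<close> tending
  to \<open>\<eta> \<cdot> D \<eta>\<close>. By homogeneity the difference quotient at such a point
  is \<open>norm (L (?z t)) / d (?z t) 0\<close>, and it tends to \<open>0\<close>.\<close>

lemma derivative_on_graph:
  assumes u: "u \<in> U"
    and D: "\<forall>t>0. \<forall>x\<in>W. D (dil t x) = dil t (D x)" "D 0 = 0"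
      "\<forall>\<epsilon>>0. \<exists>\<delta>>0. \<forall>w. shift u w \<in> U \<and> w \<noteq> 0 \<and> d w 0 < \<delta> \<longrightarrow> d (D w) (\<psi> u w) \<le> \<epsilon> * d w 0"
    and \<eta>: "\<eta> \<in> W"
  shows "h_deriv d f (graph_map \<phi> u) (\<eta> \<cdot> D \<eta>) = 0"
proof -
  define x where "x = graph_map \<phi> u"
  define L where "L = h_deriv d f x"
  have der: "has_h_derivative d f L x"
    unfolding L_def x_def by (rule C1h_derivative[OF C1h graph_\<Omega>[OF u]])
  then have hom: "h_hom L" and lim: "((\<lambda>w. norm (f (x \<cdot> w) - f x - L w) / d w 0) \<longlongrightarrow> 0) (at 0)"
    by (auto simp: has_h_derivative_def)
  have lin: "linear L" by (rule h_hom_linear[OF hom])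
  have "L (\<eta> \<cdot> D \<eta>) = 0"
  proof (cases "\<eta> = 0")
    case True
    then show ?thesis using D(2) linear_0[OF lin] by simp
  next
    case False
    have R: "0 < d \<eta> 0" using False by (rule d_norm_pos)
    have ev: "\<forall>\<^sub>F t in at_right 0. 0 < t \<and> shift u (dil t \<eta>) \<in> U \<and> d (D \<eta>) (rescaled u t \<eta>) \<le> \<epsilon>" if "0 < \<epsilon>" for \<epsilon>
      using blow_up_uniform[OF u D R that] \<eta> unfolding eventually_at_right_field by auto
    have y: "((\<lambda>t. rescaled u t \<eta>) \<longlongrightarrow> D \<eta>) (at_right 0)"
    proof (rule topological_tendstoI)
      fix S assume "open S" "D \<eta> \<in> S"
      then obtain r where r: "0 < r" "{z. d (D \<eta>) z < r} \<subseteq> S" by (rule d_ball_subset_open)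
      have "0 < r / 2" using r(1) by simp
      from ev[OF this] show "\<forall>\<^sub>F t in at_right 0. rescaled u t \<eta> \<in> S"
      proof (rule eventually_mono)
        fix t assume "0 < t \<and> shift u (dil t \<eta>) \<in> U \<and> d (D \<eta>) (rescaled u t \<eta>) \<le> r / 2"
        then have "rescaled u t \<eta> \<in> {z. d (D \<eta>) z < r}" using r(1) by simp
        then show "rescaled u t \<eta> \<in> S" using r(2) by blast
      qed
    qed
    let ?z = "\<lambda>t. \<eta> \<cdot> rescaled u t \<eta>"
    have z: "(?z \<longlongrightarrow> \<eta> \<cdot> D \<eta>) (at_right 0)" by (intro tendsto_intros y)
    have "((\<lambda>t. (t *\<^sub>R fst (?z t), t\<^sup>2 * snd (?z t))) \<longlongrightarrow> (0 *\<^sub>R fst (\<eta> \<cdot> D \<eta>), 0\<^sup>2 * snd (\<eta> \<cdot> D \<eta>))) (at_right 0)"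
      by (intro tendsto_intros z)
    then have dz: "((\<lambda>t. dil t (?z t)) \<longlongrightarrow> 0) (at_right 0)"
      by (simp only: dil_def) (simp add: zero_prod_def)
    have nz: "\<forall>\<^sub>F t in at_right 0. 0 < t \<and> shift u (dil t \<eta>) \<in> U \<and> ?z t \<noteq> 0"
      using ev[OF zero_less_one]
    proof (rule eventually_mono)
      fix t assume t: "0 < t \<and> shift u (dil t \<eta>) \<in> U \<and> d (D \<eta>) (rescaled u t \<eta>) \<le> 1"
      \<comment> \<open>Otherwise \<open>- \<eta>\<close> would lie in \<open>V\<close>, but
        \<open>W\<close> and \<open>V\<close> meet only in \<open>0\<close>.\<close>
      have "?z t \<noteq> 0"
      proof
        assume "?z t = 0"
        then have "(- \<eta>) \<cdot> ?z t = - \<eta>" by (simp only: heis_mult_zero)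
        then have "rescaled u t \<eta> = - \<eta>" by (simp only: heis_mult_minus)
        moreover have "rescaled u t \<eta> \<in> V" using t u by (intro rescaled_V) auto
        ultimately have "- \<eta> = 0" using W_Int_V[of "- \<eta>"] W_minus[OF \<eta>] by simp
        then show False using False by simp
      qed
      then show "0 < t \<and> shift u (dil t \<eta>) \<in> U \<and> ?z t \<noteq> 0" using t by blast
    qed
    have "filterlim (\<lambda>t. dil t (?z t)) (at 0) (at_right 0)"
      unfolding filterlim_at
    proof
      show "\<forall>\<^sub>F t in at_right 0. dil t (?z t) \<in> UNIV \<and> dil t (?z t) \<noteq> 0"
        using nz by (rule eventually_mono) (simp add: dil_nonzero)
    qed (rule dz)
    from filterlim_compose[OF lim this]
    have "((\<lambda>t. norm (f (x \<cdot> dil t (?z t)) - f x - L (dil t (?z t))) / d (dil t (?z t)) 0) \<longlongrightarrow> 0) (at_right 0)" .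
    moreover have "\<forall>\<^sub>F t in at_right 0. norm (f (x \<cdot> dil t (?z t)) - f x - L (dil t (?z t))) / d (dil t (?z t)) 0
        = norm (L (?z t)) / d (?z t) 0"
      using nz
    proof (rule eventually_mono)
      fix t assume t: "0 < t \<and> shift u (dil t \<eta>) \<in> U \<and> ?z t \<noteq> 0"
      have "f (x \<cdot> dil t (?z t)) = f x"
        using t f_const[of "shift u (dil t \<eta>)"] f_const[OF u] graph_map_blow_up[of t u \<eta>] by (simp add: x_def)
      then show "norm (f (x \<cdot> dil t (?z t)) - f x - L (dil t (?z t))) / d (dil t (?z t)) 0 = norm (L (?z t)) / d (?z t) 0"
        using t by (simp add: h_hom_dil[OF hom] d_norm_dil)
    qed
    ultimately have "((\<lambda>t. norm (L (?z t)) / d (?z t) 0) \<longlongrightarrow> 0) (at_right 0)"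
      by (rule Lim_transform_eventually)
    \<comment> \<open>Multiplying by the convergent denominator makes it irrelevant whether its
      limit vanishes.\<close>
    moreover have "((\<lambda>t. d (?z t) 0) \<longlongrightarrow> d (\<eta> \<cdot> D \<eta>) 0) (at_right 0)"
      using continuous_d_norm z by (intro continuous_on_tendsto_compose[of UNIV "\<lambda>x. d x 0"]) auto
    ultimately have "((\<lambda>t. norm (L (?z t)) / d (?z t) 0 * d (?z t) 0) \<longlongrightarrow> 0 * d (\<eta> \<cdot> D \<eta>) 0) (at_right 0)"
      by (rule tendsto_mult)
    moreover have "\<forall>\<^sub>F t in at_right 0. norm (L (?z t)) / d (?z t) 0 * d (?z t) 0 = norm (L (?z t))"
      using nz by (rule eventually_mono) simp
    ultimately have "((\<lambda>t. norm (L (?z t))) \<longlongrightarrow> 0 * d (\<eta> \<cdot> D \<eta>) 0) (at_right 0)"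
      by (rule Lim_transform_eventually)
    moreover have "((\<lambda>t. norm (L (?z t))) \<longlongrightarrow> norm (L (\<eta> \<cdot> D \<eta>))) (at_right 0)"
      using lin z by (intro tendsto_norm bounded_linear.tendsto[of L]) (simp_all add: linear_conv_bounded_linear)
    ultimately have "norm (L (\<eta> \<cdot> D \<eta>)) = 0 * d (\<eta> \<cdot> D \<eta>) 0"
      using tendsto_unique trivial_limit_at_right_real by blast
    then show ?thesis by simp
  qed
  then show ?thesis by (simp add: L_def x_def)
qed

lemma orthonormal_fst_v: "orthonormal (fst \<circ> v)" and v_eq: "v i = (fst (v i), 0)"
proof -
  have vV: "v i \<in> V" for i unfolding V_span by (rule span_base) simp
  then show "v i = (fst (v i), 0)" for i using V_snd[of "v i"] by (simp add: prod_eq_iff)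
  show "orthonormal (fst \<circ> v)"
    using v V_snd[OF vV] by (simp add: orthonormal_def orthonormal_basis_def inner_prod_def)
qed

lemma mem_V: "x \<in> V \<longleftrightarrow> (\<exists>a. x = (hcomb (fst \<circ> v) a, 0))"
proof
  assume x: "x \<in> V"
  have "fst ` span (range v) = span (fst ` range v)"
    by (rule linear_span_image[symmetric]) (rule linear_fst)
  then have "fst x \<in> span (range (fst \<circ> v))" using x V_span by (auto simp: image_comp)
  then obtain a where "fst x = hcomb (fst \<circ> v) a" unfolding range_hcomb[symmetric] by blast
  then show "\<exists>a. x = (hcomb (fst \<circ> v) a, 0)" using V_snd[OF x] by (intro exI[of _ a]) (simp add: prod_eq_iff)
next
  assume "\<exists>a. x = (hcomb (fst \<circ> v) a, 0)"
  then obtain a where "x = (hcomb (fst \<circ> v) a, 0)" by blast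
  also have "\<dots> = (\<Sum>j\<in>UNIV. a $ j *\<^sub>R v j)"
    using v_eq by (simp add: prod_eq_iff fst_sum snd_sum hcomb_def)
  also have "\<dots> \<in> V" unfolding V_span by (intro span_sum span_scale span_base rangeI)
  finally show "x \<in> V" .
qed

lemma kernel_vertical:
  assumes hom: "h_hom (L :: 'n heis \<Rightarrow> real^'k)"
  shows "vertical_subgroup {z. L z = 0}"
proof -
  have lin: "linear L" by (rule h_hom_linear[OF hom])
  have "subgroup {z. L z = 0} heis_group"
  proof (rule group.subgroupI[OF heis_group_is_group])
    show "inv\<^bsub>heis_group\<^esub> a \<in> {z. L z = 0}" if "a \<in> {z. L z = 0}" for a
      using that lin by (simp add: hinv_eq linear_neg)
  qed (use linear_0[OF lin] in \<open>auto simp: heis_group_def h_hom_mult[OF hom]\<close>)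
  moreover have "closed {z. L z = 0}"
    using lin by (intro closed_Collect_eq continuous_on_const linear_continuous_on) (simp add: linear_linear)
  moreover have "\<forall>t>0. dil t ` {z. L z = 0} \<subseteq> {z. L z = 0}"
    by (auto simp: h_hom_dil[OF hom])
  moreover have "H2 \<subseteq> {z. L z = 0}"
  proof
    fix x :: "'n heis" assume "x \<in> H2"
    then have "x = (0, snd x)" by (simp add: H2_def prod_eq_iff)
    then show "x \<in> {z. L z = 0}" using h_hom_vertical[OF hom, of "snd x"] by simp
  qed
  ultimately show "vertical_subgroup {z. L z = 0}"
    by (simp add: vertical_subgroup_def homogeneous_subgroup_def)
qed

text \<open>\<open>P\<close> is the kernel of the h-derivative, and the graph of \<open>D\<close>
  parametrises it with a constant density, namely the integrand of \<open>\<mu>\<close> at this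
  point including the norm of the wedge of the bases. The claims form one block because the blow-up
  estimate and the measure identity must refer to the same \<open>D\<close>, \<open>q\<close> and
  \<open>P\<close>.\<close>

lemma tangent_structure:
  assumes u: "u \<in> U"
  defines "x \<equiv> graph_map \<phi> u"
  shows "0 < wedge_norm (case_sum v (case_option evert (\<lambda>j. (p j, 0)))) * J_H d f x / J_V d V f x \<and>
    (\<exists>D q P. (\<forall>y\<in>W. D y \<in> V) \<and> (\<forall>t>0. \<forall>y\<in>W. D (dil t y) = dil t (D y)) \<and> D 0 = 0 \<and>
      (\<forall>\<epsilon>>0. \<exists>\<delta>>0. \<forall>w. shift u w \<in> U \<and> w \<noteq> 0 \<and> d w 0 < \<delta> \<longrightarrow> d (D w) (\<psi> u w) \<le> \<epsilon> * d w 0) \<and>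
      (\<forall>y. D (frame p y) = (hcomb q (fst y), 0)) \<and>
      vertical_subgroup P \<and> dim P = CARD('m) + 1 \<and>
      (\<forall>z. hausdorff (CARD('m) + 1) (P \<inter> dball d z 1) =
        hausdorff_const TYPE((real^'m) \<times> real) *
        ennreal (wedge_norm (case_sum v (case_option evert (\<lambda>j. (p j, 0)))) * J_H d f x / J_V d V f x) *
        emeasure lborel {y :: (real^'m) \<times> real. d z (frame p y \<cdot> (hcomb q (fst y), 0)) \<le> 1}))"
proof -
  obtain D where D: "\<forall>y\<in>W. D y \<in> V" "\<forall>t>0. \<forall>y\<in>W. D (dil t y) = dil t (D y)"
      "\<forall>\<epsilon>>0. \<exists>\<delta>>0. \<forall>w. shift u w \<in> U \<and> w \<noteq> 0 \<and> d w 0 < \<delta> \<longrightarrow> d (D w) (\<psi> u w) \<le> \<epsilon> * d w 0"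
    using intrinsic_derivative[OF u] by blast
  \<comment> \<open>\<open>D 0\<close> lies in \<open>V\<close>, where \<open>dil 2\<close> is
    multiplication by \<open>2\<close>.\<close>
  have D0: "D 0 = 0"
  proof -
    have "D 0 = dil 2 (D 0)" using D(2)[rule_format, of 2 0] zero_W by simp
    also have "\<dots> = 2 *\<^sub>R D 0" using D(1) zero_W by (simp add: V_dil)
    finally have "D 0 = 2 *\<^sub>R D 0" .
    then show ?thesis by (simp add: scaleR_2)
  qed
  define L where "L = h_deriv d f x"
  have der: "has_h_derivative d f L x"
    unfolding L_def x_def by (rule C1h_derivative[OF C1h graph_\<Omega>[OF u]])
  then have hom: "h_hom L" by (simp add: has_h_derivative_def)
  have lin: "linear L" by (rule h_hom_linear[OF hom])
  have chain: "L y + L (D y) = 0" if "y \<in> W" for y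
    using derivative_on_graph[OF u D(2) D0 D(3) that] h_hom_mult[OF hom, of y "D y"] by (simp add: L_def x_def)
  define B where "B = (\<chi> i j. L (v j) $ i)"
  have LV: "L (hcomb (fst \<circ> v) a, 0) = B *v a" for a
  proof -
    have "L (hcomb (fst \<circ> v) a, 0) = (\<Sum>j\<in>UNIV. a $ j *\<^sub>R L (v j))"
      using linear_hcomb[OF lin, of "fst \<circ> v" a] v_eq by simp
    then show ?thesis by (simp add: vec_eq_iff B_def matrix_vector_mult_def mult.commute)
  qed
  \<comment> \<open>Surjectivity of \<open>L\<close> passes to its restriction to \<open>V\<close>:
    by the chain rule \<open>L\<close> takes the same value on the \<open>W\<close>-component
    \<open>w\<close> of a preimage as on \<open>- D w\<close>, which lies in
    \<open>V\<close>.\<close>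
  have "surj ((*v) B)"
    unfolding surj_def
  proof (rule allI)
    fix c
    obtain z where z: "L z = c" using surj_deriv[OF u] unfolding L_def x_def by (metis surjD)
    obtain w x' where wx: "w \<in> W" "x' \<in> V" "z = w \<cdot> x'" by (rule decomposition)
    have "x' \<cdot> (- D w) \<in> V" using wx D(1) by (intro V_mult V_minus) auto
    then obtain a where a: "x' \<cdot> (- D w) = (hcomb (fst \<circ> v) a, 0)" using mem_V by blast
    have "B *v a = L x' - L (D w)"
      using lin by (simp add: LV[symmetric] a[symmetric] h_hom_mult[OF hom] linear_neg)
    also have "\<dots> = L x' + L w" using chain[OF wx(1)] by (simp add: eq_neg_iff_add_eq_0[symmetric])
    also have "\<dots> = c" using z wx(3) h_hom_mult[OF hom, of w x'] by (simp add: add.commute)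
    finally show "\<exists>a. c = B *v a" by (intro exI[of _ a]) simp
  qed
  then obtain B' where BB': "B ** B' = mat 1"
    using matrix_right_invertible_surjective[of B] by blast
  then have B'B: "B' ** B = mat 1" by (simp add: matrix_left_right_inverse)
  have detB: "det B \<noteq> 0" using BB' by (metis det_I det_mul mult_zero_left zero_neq_one)
  have L_inj: "y = y'" if yV: "y \<in> V" "y' \<in> V" "L y = L y'" for y y'
  proof -
    obtain a a' where a: "y = (hcomb (fst \<circ> v) a, 0)" "y' = (hcomb (fst \<circ> v) a', 0)" using yV(1,2) mem_V by blast
    then have "B *v a = B *v a'" using yV(3) by (simp add: LV)
    then have "B' *v (B *v a) = B' *v (B *v a')" by simp
    then show ?thesis by (simp add: matrix_vector_mul_assoc B'B a)
  qed
  \<comment> \<open>The chain rule forces \<open>L (D y) = - L y\<close>, and \<open>L\<close> is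
    invertible on \<open>V\<close>; so these are the coordinates of \<open>D\<close> at
    \<open>(p j, 0)\<close> in the basis \<open>v\<close>.\<close>
  define r where "r j = - (B' *v L (p j, 0))" for j
  define q where "q j = hcomb (fst \<circ> v) (r j)" for j
  have qV: "(hcomb q a, 0) \<in> V" for a
  proof -
    have "(hcomb q a, 0) = (\<Sum>j\<in>UNIV. a $ j *\<^sub>R (q j, 0 :: real))"
      by (simp add: prod_eq_iff fst_sum snd_sum hcomb_def)
    also have "\<dots> \<in> V"
    proof -
      have "(q j, 0) \<in> V" for j unfolding q_def using mem_V by blast
      then show ?thesis unfolding V_span by (intro span_sum span_scale)
    qed
    finally show ?thesis .
  qed
  have Lq: "L (hcomb q a, 0) = - L (hcomb p a, 0)" for a
  proof -
    have "L (q j, 0) = - L (p j, 0)" for j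
      using BB' matrix_vector_mult_diff_distrib[of B 0 "B' *v L (p j, 0)"]
      by (simp add: q_def LV r_def matrix_vector_mul_assoc)
    then show ?thesis by (simp add: linear_hcomb[OF lin] sum_negf)
  qed
  have Dq: "D (frame p y) = (hcomb q (fst y), 0)" for y
  proof (rule L_inj)
    have yW: "frame p y \<in> W" by (simp add: W_eq)
    then show "D (frame p y) \<in> V" using D(1) by blast
    have "L (frame p y) = L (hcomb p (fst y), 0)" using h_hom_fst[OF hom, of "frame p y" 0] by (simp add: frame_def)
    then show "L (D (frame p y)) = L (hcomb q (fst y), 0)"
      using chain[OF yW] Lq[of "fst y"] by (simp add: add_eq_0_iff)
  qed (rule qV)
  \<comment> \<open>\<open>p j\<close> moved along \<open>V\<close> into the kernel. The
    \<open>w j\<close> form a basis of the horizontal part of \<open>P\<close>, in general not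
    orthonormal; the matrix \<open>A\<close> relates it to the orthonormal basis
    \<open>e\<close>.\<close>
  define w where "w j = p j + q j" for j
  have w_comb: "hcomb w a = hcomb p a + hcomb q a" for a
    by (simp add: hcomb_def w_def scaleR_add_right sum.distrib)
  have Lw: "L (hcomb w a, s) = 0" for a s
  proof -
    have "(hcomb w a, s) = (hcomb p a, 0) + (hcomb q a, 0) + (0, s)" by (simp add: w_comb)
    then have "L (hcomb w a, s) = L (hcomb p a, 0) + L (hcomb q a, 0) + L (0, s)"
      by (simp only: linear_add[OF lin])
    then show ?thesis by (simp only: Lq h_hom_vertical[OF hom]) simp
  qed
  have w_inj: "a = 0" if "hcomb w a = 0" for a
  proof -
    have "hcomb p a = hcomb q (- a)" 
    proof -
      have "hcomb p a + hcomb q a = 0" using that by (simp only: w_comb)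
      moreover have "hcomb q (- a) = - hcomb q a" using hcomb_scale[of q "-1" a] by simp
      ultimately show ?thesis by (metis eq_neg_iff_add_eq_0)
    qed
    moreover have "(hcomb p a, 0) \<in> W" by (simp add: mem_W range_hcomb[symmetric])
    ultimately have "(hcomb p a, 0 :: real) = 0" using W_Int_V qV[of "- a"] by metis
    then have "norm (hcomb p a) = 0" by (simp add: zero_prod_def)
    then show ?thesis using norm_hcomb[OF p, of a] by simp
  qed
  define P where "P = {z. L z = 0}"
  have P: "vertical_subgroup P" unfolding P_def by (rule kernel_vertical[OF hom])
  have P1: "fst ` P = range (hcomb w)"
  proof (intro equalityI subsetI)
    fix h assume "h \<in> fst ` P"
    then obtain z where z: "L z = 0" "h = fst z" by (auto simp: P_def)
    obtain y x' where yx: "y \<in> W" "x' \<in> V" "z = y \<cdot> x'" by (rule decomposition)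
    have "L y + L x' = 0" using z(1) yx(3) h_hom_mult[OF hom, of y x'] by simp
    then have "L x' = L (D y)" using chain[OF yx(1)] by (metis add_left_cancel)
    then have x': "x' = D y" using L_inj[OF yx(2)] D(1) yx(1) by blast
    obtain b where b: "y = frame p b" using yx(1) W_eq by blast
    have "h = fst (frame p b) + fst (D (frame p b))" unfolding z(2) yx(3) x' b by simp
    also have "\<dots> = hcomb w (fst b)" unfolding Dq by (simp add: w_comb frame_def)
    finally have "h = hcomb w (fst b)" .
    then show "h \<in> range (hcomb w)" by blast
  next
    fix h assume "h \<in> range (hcomb w)"
    then obtain a where "h = hcomb w a" by blast
    then have "(h, 0) \<in> P" using Lw by (simp add: P_def)
    then show "h \<in> fst ` P" by force
  qed
  have lin_w: "linear (hcomb w)"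
    by (rule linearI) (simp_all add: hcomb_add hcomb_scale)
  have inj_w: "inj (hcomb w)"
    using linear_injective_0[OF lin_w] w_inj by blast
  have dimP: "dim P = CARD('m) + 1"
  proof -
    have "dim (range (hcomb w)) = dim (UNIV :: (real^'m) set)"
      using inj_w by (intro dim_image_eq[OF lin_w]) simp
    then show ?thesis using vertical_subgroup_eq(3)[OF P] P1 by (simp add: dim_UNIV)
  qed
  obtain e :: "'m \<Rightarrow> 'n hvec" where e: "orthonormal e" "span (range e) = fst ` P" "range (frame e) = P"
    using vertical_subgroup_frame[OF P dimP] by blast
  define A where "A = (\<chi> l j. e l \<bullet> w j)"
  have wA: "hcomb w a = hcomb e (A *v a)" for a
  proof -
    have "hcomb w a \<in> range (hcomb e)" using P1 e(2) range_hcomb[of e] by auto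
    then obtain b where b: "hcomb w a = hcomb e b" by blast
    have "b $ l = (A *v a) $ l" for l
    proof -
      have "b $ l = e l \<bullet> hcomb w a" by (simp only: b hcomb_inner[OF e(1)])
      then show ?thesis by (simp add: hcomb_def inner_sum_right A_def matrix_vector_mult_def mult.commute)
    qed
    then have "b = A *v a" by (simp add: vec_eq_iff)
    then show ?thesis using b by simp
  qed
  have detA: "det A \<noteq> 0"
  proof -
    have "a = 0" if "A *v a = 0" for a using w_inj[of a] wA[of a] that by simp
    then obtain A' where "A' ** A = mat 1" using matrix_left_invertible_ker[of A] by blast
    then show ?thesis by (metis det_I det_mul mult_zero_right zero_neq_one)
  qed
  define K where "K = wedge_norm (case_sum v (case_option evert (\<lambda>j. (p j, 0))))"
  define g where "g i = grad_H d (\<lambda>y. f y $ i) x" for i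
  have g: "g i \<bullet> z = L z $ i" "snd (g i) = 0" for i z
    unfolding g_def using grad_H_eq(2,3)[OF has_h_derivative_component[OF der]] by auto
  have JV: "J_V d V f x = \<bar>det B\<bar>" unfolding B_def by (rule J_V_eq[OF der v])
  have JH: "J_H d f x = wedge_norm g" by (simp add: J_H_def g_def[abs_def])
  have dims: "CARD('k) + CARD('m) + 1 = DIM('n heis)" using card by simp
  \<comment> \<open>In the roles of the determinant identity, \<open>w\<close> is its
    \<open>u\<close>, \<open>e\<close> its \<open>q\<close>, \<open>(p j, 0)\<close> its
    \<open>w\<close> and \<open>evert\<close> its \<open>e\<close>.\<close>
  have "\<bar>det (\<chi> i j. v i \<bullet> g j)\<bar> * \<bar>det (\<chi> i j. (w i, 0 :: real) \<bullet> (e j, 0))\<bar> = K * wedge_norm g"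
    unfolding K_def
  proof (rule wedge_norm_unipotent_graph[OF dims])
    show "(e i, 0 :: real) \<bullet> (e j, 0) = (if i = j then 1 else 0)" for i j
      using e(1) by (simp add: orthonormal_def)
    have eP: "L (e j, 0) = 0" for j
    proof -
      have "e j \<in> fst ` P" unfolding e(2)[symmetric] by (rule span_base) simp
      then obtain a where "e j = hcomb w a" using P1 by blast
      then show ?thesis using Lw by simp
    qed
    show "(e j, 0) \<bullet> g i = 0" for i j using g(1)[of i "(e j, 0)"] eP by (simp add: inner_commute)
    have "(hcomb w (axis j 1), 0 :: real) = (w j, 0)" for j
    proof -
      have "hcomb w (axis j 1) = (\<Sum>i\<in>UNIV. if i = j then w i else 0)"
        unfolding hcomb_def by (intro sum.cong) (auto simp: axis_def)
      then show ?thesis by simp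
    qed
    then show "(w j, 0) \<bullet> g i = 0" for i j
      using g(1)[of i "(w j, 0)"] Lw[of "axis j 1" 0] by (simp add: inner_commute)
    show "(w j, 0) = (p j, 0) + (\<Sum>i\<in>UNIV. r j $ i *\<^sub>R v i)" for j
    proof -
      have "(\<Sum>i\<in>UNIV. r j $ i *\<^sub>R v i) = (q j, 0)"
        using v_eq by (simp add: prod_eq_iff fst_sum snd_sum q_def hcomb_def)
      then show ?thesis by (simp add: w_def)
    qed
    show "evert \<bullet> v i = 0" for i using v_eq[of i] by (simp add: evert_def inner_prod_def) (metis snd_conv)
  qed (simp_all add: evert_def inner_prod_def g(2))
  moreover have "det (\<chi> i j. v i \<bullet> g j) = det B"
    using det_transpose[of B] by (simp add: transpose_def B_def g(1)[symmetric] inner_commute)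
  moreover have "det (\<chi> i j. (w i, 0 :: real) \<bullet> (e j, 0)) = det A"
    using det_transpose[of A] by (simp add: transpose_def A_def inner_commute)
  ultimately have "\<bar>det B\<bar> * \<bar>det A\<bar> = K * J_H d f x" by (simp add: JH)
  then have A_eq: "K * J_H d f x / J_V d V f x = \<bar>det A\<bar>"
    using detB by (simp add: JV divide_eq_eq mult.commute)
  have meas: "hausdorff (CARD('m) + 1) (P \<inter> dball d z 1) =
      hausdorff_const TYPE((real^'m) \<times> real) * ennreal \<bar>det A\<bar> *
      emeasure lborel {y :: (real^'m) \<times> real. d z (frame p y \<cdot> (hcomb q (fst y), 0)) \<le> 1}" for z
  proof -
    \<comment> \<open>The group product adds half the symplectic form to the height. This depends on
      \<open>a\<close> alone, so the volume changes only by \<open>det A\<close>.\<close>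
    let ?h = "\<lambda>a. symp (hcomb p a) (hcomb q a) / 2"
    have h: "?h \<in> borel_measurable borel"
      by (intro borel_measurable_continuous_onI continuous_intros) auto
    have "closed (frame e -` dball d z 1)"
      unfolding dball_def vimage_def mem_Collect_eq by (intro closed_Collect_le continuous_intros)
    then have E: "frame e -` dball d z 1 \<in> sets borel" by (rule borel_closed)
    have "{y :: (real^'m) \<times> real. d z (frame p y \<cdot> (hcomb q (fst y), 0)) \<le> 1} =
        {(a, s). (A *v a, 1 * s + ?h a) \<in> frame e -` dball d z 1}"
      unfolding dball_def frame_def heis_mult_eq vimage_def fst_conv snd_conv
      by (auto simp: wA[symmetric] w_comb)
    then have "emeasure lborel {y :: (real^'m) \<times> real. d z (frame p y \<cdot> (hcomb q (fst y), 0)) \<le> 1} =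
        ennreal (1 / \<bar>det A\<bar>) * emeasure lborel (frame e -` dball d z 1)"
      using emeasure_lborel_graph_vimage[OF detA _ h E, of 1] by simp
    then have "ennreal \<bar>det A\<bar> * emeasure lborel {y :: (real^'m) \<times> real. d z (frame p y \<cdot> (hcomb q (fst y), 0)) \<le> 1} =
        emeasure lborel (frame e -` dball d z 1)"
      using detA by (simp add: mult.assoc[symmetric] ennreal_mult[symmetric])
    moreover have "P \<inter> dball d z 1 = frame e ` (frame e -` dball d z 1)" using e(3) by auto
    ultimately show ?thesis using hausdorff_frame[OF e(1) E] by (simp add: mult.assoc)
  qed
  show ?thesis
    unfolding K_def[symmetric] A_eq
    using detA D D0 Dq P dimP meas by (intro conjI exI[of _ D] exI[of _ q] exI[of _ P]) auto
qed

end

section \<open>The area formula\<close>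

lemma det_mat: "det (mat t :: real^'m::finite^'m) = t ^ CARD('m)"
proof -
  have "det (mat t :: real^'m^'m) = (\<Prod>i\<in>UNIV. (mat t :: real^'m^'m) $ i $ i)"
    by (rule det_diagonal) (simp add: mat_def)
  then show ?thesis by (simp add: mat_def)
qed

lemma mat_vector_mult: "mat t *v (a :: real^'m::finite) = t *\<^sub>R a"
proof -
  have "(\<Sum>j\<in>UNIV. (if i = j then t else 0) * a $ j) = (\<Sum>j\<in>UNIV. if j = i then t * a $ j else 0)" for i
    by (intro sum.cong) auto
  then show ?thesis by (simp add: vec_eq_iff matrix_vector_mult_def mat_def)
qed

lemma ennreal_mult4:
  "0 \<le> x \<Longrightarrow> 0 \<le> y \<Longrightarrow> 0 \<le> z \<Longrightarrow> 0 \<le> w \<Longrightarrow>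
    ennreal x * (ennreal y * (ennreal z * ennreal w)) = ennreal (x * (y * (z * w)))"
  by (simp add: ennreal_mult)

text \<open>The horizontal directions scale by \<open>t\<close> and the vertical one by
  \<open>t\<^sup>2\<close>, so the exponent is the homogeneous dimension of the vertical subgroup,
  one more than its linear dimension.\<close>

lemma emeasure_lborel_dilation:
  fixes E :: "((real^'m::finite) \<times> real) set"
  assumes t: "0 < t" and g: "g \<in> borel_measurable borel" and E: "E \<in> sets borel"
  shows "emeasure lborel E = ennreal (t ^ (CARD('m) + 2)) * emeasure lborel {(a, s). (t *\<^sub>R a, t\<^sup>2 * s + g a) \<in> E}"
proof -
  have t2: "t\<^sup>2 \<noteq> 0" using t by simp
  have "det (mat t :: real^'m^'m) \<noteq> 0" using t by (simp add: det_mat)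
  from emeasure_lborel_graph_vimage[OF this t2 g E]
  have eq: "emeasure lborel {(a, s). (t *\<^sub>R a, t\<^sup>2 * s + g a) \<in> E} = ennreal (1 / (t ^ CARD('m) * t\<^sup>2)) * emeasure lborel E"
    using t by (simp add: mat_vector_mult det_mat)
  have "ennreal (t ^ (CARD('m) + 2)) * ennreal (1 / (t ^ CARD('m) * t\<^sup>2)) = 1"
    using t by (subst ennreal_mult[symmetric]) (auto simp: power_add power2_eq_square)
  then show ?thesis unfolding eq by (simp add: mult.assoc[symmetric])
qed

locale area_graph = defining_graph d W V U \<phi> p v f \<Omega> c0
  for d :: "'n::finite heis \<Rightarrow> 'n heis \<Rightarrow> real" and W V U \<phi>
    and p :: "'m::finite \<Rightarrow> 'n hvec" and v :: "'k::finite \<Rightarrow> 'n heis"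
    and f :: "'n heis \<Rightarrow> real^'k" and \<Omega> c0 +
  assumes sym: "vertically_symmetric (CARD('m) + 1) d \<or> multiradial d"
    and k_le: "CARD('k) \<le> CARD('n)"
begin

definition K :: real where
  "K = wedge_norm (case_sum v (case_option evert (\<lambda>j. (p j, 0))))"

definition J :: "'n heis \<Rightarrow> real" where
  "J x = J_H d f x / J_V d V f x"

definition area_measure :: "'n heis measure" where
  "area_measure = scale_measure (ennreal K)
    (distr (density (restrict_space (hausdorff_measure (CARD('m) + 1)) U) (\<lambda>x. ennreal (J (graph_map \<phi> x))))
      borel (graph_map \<phi>))"

lemma KJ_pos: "u \<in> U \<Longrightarrow> 0 < K * J (graph_map \<phi> u)"
  using tangent_structure[of u] by (simp add: K_def J_def)

lemma K_nonneg: "0 \<le> K"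
  unfolding K_def using card by (intro wedge_norm_nonneg) simp

section \<open>Compactness bounds, continuity and measurability of the graph map\<close>

lemma bounded_frame_vimage: "bounded {y. d (frame p y) 0 \<le> R}"
proof -
  obtain b where b: "\<And>x. x \<in> {x. d x 0 \<le> R} \<Longrightarrow> norm x \<le> b"
    using bounded_norm_ball[of R] unfolding bounded_iff by blast
  have "norm y \<le> b" if "d (frame p y) 0 \<le> R" for y
  proof -
    have "frame p 0 = 0" by (simp add: frame_def zero_prod_def)
    then have "norm (frame p y) = norm y" using dist_frame[OF p, of y 0] by simp
    then show ?thesis using b[of "frame p y"] that by simp
  qed
  then show ?thesis unfolding bounded_iff by blast
qed

lemma compact_frame_vimage: "compact {y. d (frame p y) 0 \<le> R}"
proof -
  have "closed {y. d (frame p y) 0 \<le> R}" by (intro closed_Collect_le continuous_intros)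
  then show ?thesis using bounded_frame_vimage by (simp add: compact_eq_bounded_closed)
qed

lemma d_hcomb_bound: "\<exists>C. \<forall>y. d (frame p y) 0 \<le> R \<longrightarrow> d (hcomb q (fst y), 0) 0 \<le> C"
proof -
  have "continuous_on {y. d (frame p y) 0 \<le> R} (\<lambda>y. d (hcomb q (fst y), 0) 0)"
    by (intro continuous_intros)
  then have "compact ((\<lambda>y. d (hcomb q (fst y), 0) 0) ` {y. d (frame p y) 0 \<le> R})"
    using compact_frame_vimage by (rule compact_continuous_image)
  then have "bounded ((\<lambda>y. d (hcomb q (fst y), 0) 0) ` {y. d (frame p y) 0 \<le> R})" by (rule compact_imp_bounded)
  then obtain C where "\<forall>z\<in>(\<lambda>y. d (hcomb q (fst y), 0) 0) ` {y. d (frame p y) 0 \<le> R}. norm z \<le> C"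
    unfolding bounded_iff by blast
  then show ?thesis by (intro exI[of _ C]) auto
qed

text \<open>On horizontal coordinates the product is a linear map, injective because
  \<open>W\<close> and \<open>V\<close> meet in \<open>0\<close>. A bounded product thus has a
  bounded \<open>V\<close>-factor, and the triangle inequality bounds the other one. The radius
  \<open>2\<close> covers all points at distance at most \<open>1\<close> from a centre in the unit
  ball.\<close>

lemma d_proj_W_bound: "\<exists>R>0. \<forall>\<eta>\<in>W. \<forall>y\<in>V. d (\<eta> \<cdot> y) 0 \<le> 2 \<longrightarrow> d \<eta> 0 \<le> R"
proof -
  let ?h = "\<lambda>x :: (real^'m) \<times> (real^'k). hcomb p (fst x) + hcomb (fst \<circ> v) (snd x)"
  have lin: "linear ?h"
    by (rule linearI) (simp_all add: hcomb_add hcomb_scale scaleR_add_right)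
  have "inj ?h"
    unfolding linear_injective_0[OF lin]
  proof (intro allI impI)
    fix x assume x: "?h x = 0"
    let ?y = "(hcomb (fst \<circ> v) (snd x), 0 :: real)"
    have yV: "?y \<in> V" using mem_V by blast
    have "hcomb (fst \<circ> v) (snd x) = - hcomb p (fst x)" using x by (simp only: add_eq_0_iff)
    then have "- ?y = (hcomb p (fst x), 0)" by simp
    then have "- ?y \<in> W" by (simp add: mem_W range_hcomb[symmetric])
    then have 0: "- ?y = 0" using W_Int_V V_minus[OF yV] by blast
    then have "?y = 0" by (simp only: neg_equal_0_iff_equal)
    then have "hcomb (fst \<circ> v) (snd x) = 0" by (simp add: zero_prod_def)
    moreover from this have "hcomb p (fst x) = 0" using x by simp
    ultimately have "hcomb (fst \<circ> v) (snd x) = 0" "hcomb p (fst x) = 0" .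
    then have "snd x = 0" "fst x = 0"
      using norm_hcomb[OF orthonormal_fst_v, of "snd x"] norm_hcomb[OF p, of "fst x"] by simp_all
    then show "x = 0" by (simp add: prod_eq_iff)
  qed
  then obtain B where B: "0 < B" "\<And>x. B * norm x \<le> norm (?h x)"
    using linear_inj_bounded_below_pos[OF lin] by blast
  obtain b where b: "\<And>x. x \<in> {x. d x 0 \<le> 2} \<Longrightarrow> norm x \<le> b"
    using bounded_norm_ball[of 2] unfolding bounded_iff by blast
  have "compact ((\<lambda>a. d (hcomb (fst \<circ> v) a, 0) 0) ` cball 0 (b / B))"
    by (intro compact_continuous_image continuous_intros) auto
  then have "bounded ((\<lambda>a. d (hcomb (fst \<circ> v) a, 0) 0) ` cball 0 (b / B))" by (rule compact_imp_bounded)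
  then obtain C where C: "\<forall>z\<in>(\<lambda>a. d (hcomb (fst \<circ> v) a, 0) 0) ` cball 0 (b / B). norm z \<le> C"
    unfolding bounded_iff by blast
  have "d \<eta> 0 \<le> max 1 (2 + C)" if \<eta>: "\<eta> \<in> W" and y: "y \<in> V" and le: "d (\<eta> \<cdot> y) 0 \<le> 2" for \<eta> y
  proof -
    obtain x where x: "\<eta> = frame p x" using \<eta> W_eq by blast
    obtain a where a: "y = (hcomb (fst \<circ> v) a, 0)" using y mem_V by blast
    have "B * norm (fst x, a) \<le> norm (fst (\<eta> \<cdot> y))" using B(2)[of "(fst x, a)"] by (simp add: x a frame_def)
    also have "\<dots> \<le> norm (\<eta> \<cdot> y)"
      using norm_fst_le[of "fst (\<eta> \<cdot> y)" "snd (\<eta> \<cdot> y)"] by (simp only: prod.collapse)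
    also have "\<dots> \<le> b" using b le by blast
    finally have "norm (fst x, a) \<le> b / B" using B(1) by (simp add: field_simps)
    moreover have "norm a \<le> norm (fst x, a)" by (rule norm_snd_le)
    ultimately have "a \<in> cball 0 (b / B)" by simp
    then have "norm (d (hcomb (fst \<circ> v) a, 0) 0) \<le> C" using C by blast
    then have "d y 0 \<le> C" by (simp add: a)
    have "\<eta> = (\<eta> \<cdot> y) \<cdot> (- y)" by (simp add: heis_mult_assoc)
    then have "d \<eta> 0 \<le> d (\<eta> \<cdot> y) 0 + d (- y) 0" using d_norm_mult by metis
    then show ?thesis using le \<open>d y 0 \<le> C\<close> by simp
  qed
  then show ?thesis by (intro exI[of _ "max 1 (2 + C)"]) auto
qed

text \<open>The increment of the graph map from \<open>u\<close> to \<open>u'\<close> is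
  \<open>dil t (\<eta> \<cdot> rescaled u t \<eta>)\<close> with \<open>\<eta>\<close> of norm
  \<open>1\<close>. The rescaled values stay near \<open>D \<eta>\<close>, hence bounded, while
  \<open>t\<close> becomes small as \<open>u'\<close> approaches \<open>u\<close>.\<close>

lemma continuous_graph_map: "continuous_on U (graph_map \<phi>)"
  unfolding continuous_on_topological
proof (intro ballI allI impI)
  fix u S assume u: "u \<in> U" and S: "open S" "graph_map \<phi> u \<in> S"
  obtain r where r: "0 < r" "{z. d (graph_map \<phi> u) z < r} \<subseteq> S" using S by (rule d_ball_subset_open)
  obtain D q where D: "\<forall>t>0. \<forall>y\<in>W. D (dil t y) = dil t (D y)" "D 0 = 0"
      "\<forall>\<epsilon>>0. \<exists>\<delta>>0. \<forall>w. shift u w \<in> U \<and> w \<noteq> 0 \<and> d w 0 < \<delta> \<longrightarrow> d (D w) (\<psi> u w) \<le> \<epsilon> * d w 0"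
      and Dq: "\<forall>y. D (frame p y) = (hcomb q (fst y), 0)"
    using tangent_structure[OF u] by blast
  obtain C where C: "\<And>y. d (frame p y) 0 \<le> 1 \<Longrightarrow> d (hcomb q (fst y), 0) 0 \<le> C"
    using d_hcomb_bound[of 1 q] by blast
  obtain t0 where t0: "0 < t0" "\<forall>t \<eta>. 0 < t \<and> t < t0 \<and> \<eta> \<in> W \<and> d \<eta> 0 \<le> 1 \<longrightarrow>
     shift u (dil t \<eta>) \<in> U \<and> d (D \<eta>) (rescaled u t \<eta>) \<le> 1"
    using blow_up_uniform[OF u D zero_less_one zero_less_one] by blast
  \<comment> \<open>\<open>2 + C\<close> collects the norm \<open>1\<close> of
    \<open>\<eta>\<close>, the bound \<open>C\<close> for \<open>D \<eta>\<close> and the blow-up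
    error \<open>1\<close>.\<close>
  define C' where "C' = max 1 (2 + C)"
  have C': "0 < C'" "2 + C \<le> C'" by (auto simp: C'_def)
  define w where "w u' = (- \<phi> u) \<cdot> ((- u) \<cdot> u') \<cdot> \<phi> u" for u'
  have sw: "shift u (w u') = u'" for u' by (simp add: shift_def w_def heis_mult_assoc)
  have w_cont: "continuous_on UNIV w" unfolding w_def by (intro continuous_intros)
  have wu: "w u = 0" by (simp add: w_def heis_mult_assoc)
  define T where "T = w -` {z. d 0 z < min t0 (r / C')}"
  have T: "open T" "u \<in> T"
  proof -
    show "open T" unfolding T_def by (rule open_vimage[OF open_d_ball w_cont])
    show "u \<in> T" unfolding T_def using t0(1) r(1) C'(1) by (simp add: wu)
  qed
  have "graph_map \<phi> u' \<in> S" if u': "u' \<in> U" "u' \<in> T" for u'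
  proof (cases "w u' = 0")
    case True
    then show ?thesis using sw[of u'] S(2) by simp
  next
    case False
    define t where "t = d (w u') 0"
    have t: "0 < t" "t < t0" "t < r / C'"
      using False d_norm_pos u'(2) d_commute[of 0 "w u'"] by (auto simp: t_def T_def)
    define \<eta> where "\<eta> = dil (1 / t) (w u')"
    have w\<eta>: "w u' = dil t \<eta>" using t(1) by (simp add: \<eta>_def)
    have wW: "w u' \<in> W" using U_W[OF u] U_W[OF u'(1)] by (simp add: w_def mem_W span_add span_neg span_diff)
    have \<eta>W: "\<eta> \<in> W" unfolding \<eta>_def by (rule W_dil[OF wW])
    have \<eta>1: "d \<eta> 0 = 1" using t(1) by (simp add: \<eta>_def d_norm_dil t_def[symmetric])
    obtain y where y: "\<eta> = frame p y" using \<eta>W W_eq by blast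
    have "d (D \<eta>) 0 \<le> C" using C[of y] \<eta>1 Dq y by simp
    moreover have "d (D \<eta>) (rescaled u t \<eta>) \<le> 1" using t0(2) t \<eta>W \<eta>1 by simp
    ultimately have "d (rescaled u t \<eta>) 0 \<le> 1 + C"
      using d_triangle[of "rescaled u t \<eta>" 0 "D \<eta>"] d_commute[of "D \<eta>" "rescaled u t \<eta>"] by linarith
    then have le: "d (\<eta> \<cdot> rescaled u t \<eta>) 0 \<le> C'"
      using d_norm_mult[of \<eta> "rescaled u t \<eta>"] \<eta>1 C'(2) by linarith
    have "graph_map \<phi> u' = graph_map \<phi> u \<cdot> dil t (\<eta> \<cdot> rescaled u t \<eta>)"
      using graph_map_blow_up[OF t(1), of u \<eta>] sw[of u'] w\<eta> by simp
    then have "d (graph_map \<phi> u) (graph_map \<phi> u') = d (dil t (\<eta> \<cdot> rescaled u t \<eta>)) 0"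
      using d_translate[of "graph_map \<phi> u" 0 "dil t (\<eta> \<cdot> rescaled u t \<eta>)"] d_commute[of 0] by simp
    also have "\<dots> \<le> t * C'" using le t(1) by (simp add: d_norm_dil)
    also have "\<dots> < r" using t(3) C'(1) by (simp add: pos_less_divide_eq)
    finally show ?thesis using r(2) by blast
  qed
  then show "\<exists>A. open A \<and> u \<in> A \<and> (\<forall>y\<in>U. y \<in> A \<longrightarrow> graph_map \<phi> y \<in> S)"
    using T by blast
qed

lemma continuous_J: "continuous_on U (\<lambda>x. J (graph_map \<phi> x))"
proof -
  have nz: "J_V d V f (graph_map \<phi> u) \<noteq> 0" if "u \<in> U" for u
    using KJ_pos[OF that] by (auto simp: J_def)
  have sub: "graph_map \<phi> ` U \<subseteq> \<Omega>" using graph_\<Omega> by blast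
  show ?thesis
    unfolding J_def
    by (intro continuous_on_divide continuous_on_compose2[OF continuous_on_J(1)[OF C1h v] continuous_graph_map sub]
        continuous_on_compose2[OF continuous_on_J(2)[OF C1h v] continuous_graph_map sub]) (use nz in blast)
qed

lemma closed_W: "closed W"
  using semi by (simp add: semidirect_def vertical_subgroup_def homogeneous_subgroup_def)

lemma U_borel [measurable]: "U \<in> sets borel"
proof -
  obtain T where "open T" "U = W \<inter> T" using U_open by (auto simp: openin_open)
  then show ?thesis using closed_W by (auto intro: borel_closed borel_open)
qed

lemma vimage_borel:
  assumes "B \<in> sets borel"
  shows "{x \<in> U. graph_map \<phi> x \<in> B} \<in> sets borel"
proof -
  have "graph_map \<phi> \<in> borel_measurable (restrict_space borel U)"
    by (rule borel_measurable_continuous_on_restrict[OF continuous_graph_map])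
  from measurable_sets[OF this assms]
  have "graph_map \<phi> -` B \<inter> U \<in> sets (restrict_space borel U)" by (simp add: space_restrict_space)
  then have "graph_map \<phi> -` B \<inter> U \<in> sets borel"
    by (subst (asm) sets_restrict_space_iff) auto
  moreover have "graph_map \<phi> -` B \<inter> U = {x \<in> U. graph_map \<phi> x \<in> B}" by auto
  ultimately show ?thesis by simp
qed

lemma sets_area_measure [simp]: "sets area_measure = sets borel"
  by (simp add: area_measure_def)

lemma emeasure_area_measure:
  assumes B: "B \<in> sets borel"
  shows "emeasure area_measure B = ennreal K *
    (\<integral>\<^sup>+ x \<in> {x\<in>U. graph_map \<phi> x \<in> B}. ennreal (J (graph_map \<phi> x)) \<partial>hausdorff_measure (CARD('m) + 1))"
proof -
  let ?H = "hausdorff_measure (CARD('m) + 1) :: 'n heis measure"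
  let ?R = "restrict_space ?H U"
  have R: "sets ?R = sets (restrict_space borel U)" by (intro sets_restrict_space_cong) simp
  have J: "(\<lambda>x. ennreal (J (graph_map \<phi> x))) \<in> borel_measurable ?R"
    unfolding measurable_cong_sets[OF R refl]
    by (intro measurable_compose[OF borel_measurable_continuous_on_restrict[OF continuous_J]]) simp
  have \<Phi>: "graph_map \<phi> \<in> borel_measurable ?R"
    unfolding measurable_cong_sets[OF R refl]
    by (rule borel_measurable_continuous_on_restrict[OF continuous_graph_map])
  have sp: "space ?R = U" by (simp add: space_restrict_space)
  have S: "graph_map \<phi> -` B \<inter> U \<in> sets ?R" using measurable_sets[OF \<Phi> B] sp by simp
  have "emeasure area_measure B = ennreal K * emeasure (density ?R (\<lambda>x. ennreal (J (graph_map \<phi> x)))) (graph_map \<phi> -` B \<inter> U)"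
    using B \<Phi> by (simp add: area_measure_def emeasure_distr sp)
  also have "emeasure (density ?R (\<lambda>x. ennreal (J (graph_map \<phi> x)))) (graph_map \<phi> -` B \<inter> U) =
      (\<integral>\<^sup>+ x. ennreal (J (graph_map \<phi> x)) * indicator (graph_map \<phi> -` B \<inter> U) x \<partial>?R)"
    by (rule emeasure_density[OF J S])
  also have "\<dots> = (\<integral>\<^sup>+ x. ennreal (J (graph_map \<phi> x)) * indicator (graph_map \<phi> -` B \<inter> U) x * indicator U x \<partial>?H)"
    by (rule nn_integral_restrict_space) simp
  also have "\<dots> = (\<integral>\<^sup>+ x \<in> {x\<in>U. graph_map \<phi> x \<in> B}. ennreal (J (graph_map \<phi> x)) \<partial>?H)"
    by (intro nn_integral_cong) (auto split: split_indicator)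
  finally show ?thesis .
qed

lemma omega_d_graph:
  assumes "vertical_subgroup P" "dim P = CARD('m) + 1"
  shows "omega_d d (CARD('m) + 1) = spherical_factor d (CARD('m) + 1) P"
proof -
  have "0 < CARD('k)" "0 < CARD('n)" by simp_all
  then have "0 < CARD('m)" "CARD('m) < 2 * CARD('n)" using card k_le by linarith+
  then show ?thesis using omega_d_eq[OF sym] assms by blast
qed

lemma hausdorff_graph_set:
  assumes "S \<in> sets borel" "S \<subseteq> W"
  shows "emeasure (hausdorff_measure (CARD('m) + 1)) S =
    hausdorff_const TYPE((real^'m) \<times> real) * emeasure lborel (frame p -` S)"
proof -
  have "frame p -` S \<in> sets borel"
    using measurable_sets[OF borel_measurable_continuous_onI[OF continuous_on_frame[OF continuous_on_id]] assms(1), of p]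
    by simp
  moreover have "frame p ` (frame p -` S) = S" using assms(2) W_eq by auto
  ultimately show ?thesis using assms(1) hausdorff_frame[OF p, of "frame p -` S"] by (simp add: emeasure_hausdorff_measure)
qed

text \<open>In coordinates \<open>shift u\<close> after \<open>dil t\<close> is a dilation with a
  shear, followed by the translation by \<open>b\<close>. Left translation by \<open>u\<close>
  contributes half of the symplectic form to \<open>?g\<close>, and conjugation by
  \<open>\<phi> u\<close> the whole of it.\<close>

lemma emeasure_blow_up:
  assumes u: "u \<in> U" and t: "0 < t" and S: "S \<in> sets borel"
  shows "emeasure lborel (frame p -` S) =
    ennreal (t ^ (CARD('m) + 2)) * emeasure lborel {y. shift u (dil t (frame p y)) \<in> S}"
proof -
  obtain b where b: "u = frame p b" using U_W[OF u] W_eq by blast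
  let ?g = "\<lambda>a. symp (fst u) (t *\<^sub>R hcomb p a) / 2 + symp (fst (\<phi> u)) (t *\<^sub>R hcomb p a)"
  have g: "?g \<in> borel_measurable borel"
    by (intro borel_measurable_continuous_onI continuous_intros) auto
  have fS: "frame p -` S \<in> sets borel"
    using measurable_sets[OF borel_measurable_continuous_onI[OF continuous_on_frame[OF continuous_on_id]] S, of p]
    by simp
  let ?E = "(+) b -` (frame p -` S)"
  have E: "?E \<in> sets borel" using measurable_sets[of "(+) b" borel borel "frame p -` S"] fS by simp
  have "emeasure lborel (frame p -` S) = emeasure (distr lborel borel ((+) b)) (frame p -` S)"
    by (simp add: lborel_distr_plus)
  also have "\<dots> = emeasure lborel ?E" using fS by (simp add: emeasure_distr)
  also have "\<dots> = ennreal (t ^ (CARD('m) + 2)) * emeasure lborel {(a, s). (t *\<^sub>R a, t\<^sup>2 * s + ?g a) \<in> ?E}"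
    by (rule emeasure_lborel_dilation[OF t g E])
  also have "{(a, s). (t *\<^sub>R a, t\<^sup>2 * s + ?g a) \<in> ?E} = {y. shift u (dil t (frame p y)) \<in> S}"
  proof -
    have "frame p (b + (t *\<^sub>R a, t\<^sup>2 * s + ?g a)) = shift u (dil t (frame p (a, s)))" for a s
    proof -
      have "symp (fst b') (fst (\<phi> u)) = - symp (fst (\<phi> u)) (fst b')" for b' :: "'n heis" by (rule symp_swap)
      moreover have "symp h (fst (\<phi> u)) = - symp (fst (\<phi> u)) h" for h by (rule symp_swap)
      ultimately show ?thesis
        using V_snd[OF \<phi>_in_V[OF u]]
        by (simp add: prod_eq_iff shift_def b frame_def hcomb_add hcomb_scale field_simps)
    qed
    then show ?thesis by auto
  qed
  finally show ?thesis .
qed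

lemma K_pos: "u \<in> U \<Longrightarrow> 0 < K"
  using KJ_pos[of u] K_nonneg by (cases "K = 0") auto

section \<open>Density of the area measure at a point of the graph\<close>

lemma area_measure_le:
  assumes B: "B \<in> sets borel" and j: "0 \<le> j"
    and le: "\<And>u'. u' \<in> U \<Longrightarrow> graph_map \<phi> u' \<in> B \<Longrightarrow> K * J (graph_map \<phi> u') \<le> j"
  shows "emeasure area_measure B \<le> ennreal j * emeasure (hausdorff_measure (CARD('m) + 1)) {u'\<in>U. graph_map \<phi> u' \<in> B}"
proof (cases "U = {}")
  case True
  then show ?thesis unfolding emeasure_area_measure[OF B] by simp
next
  case False
  then have K: "0 < K" using K_pos by blast
  let ?H = "hausdorff_measure (CARD('m) + 1) :: 'n heis measure" and ?S = "{u'\<in>U. graph_map \<phi> u' \<in> B}"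
  have "(\<integral>\<^sup>+ x \<in> ?S. ennreal (J (graph_map \<phi> x)) \<partial>?H) \<le> (\<integral>\<^sup>+ x. ennreal (j / K) * indicator ?S x \<partial>?H)"
  proof (rule nn_integral_mono)
    fix x
    show "ennreal (J (graph_map \<phi> x)) * indicator ?S x \<le> ennreal (j / K) * indicator ?S x"
      using le[of x] K by (auto split: split_indicator intro!: ennreal_leI simp: field_simps)
  qed
  also have "\<dots> = ennreal (j / K) * emeasure ?H ?S"
    using vimage_borel[OF B] by (intro nn_integral_cmult_indicator) simp
  finally have "emeasure area_measure B \<le> ennreal K * (ennreal (j / K) * emeasure ?H ?S)"
    unfolding emeasure_area_measure[OF B] by (rule mult_left_mono) simp
  also have "\<dots> = ennreal j * emeasure ?H ?S"
    using K j by (simp add: mult.assoc[symmetric] ennreal_mult[symmetric])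
  finally show ?thesis .
qed

lemma area_measure_ge:
  assumes B: "B \<in> sets borel" and j: "0 \<le> j"
    and ge: "\<And>u'. u' \<in> U \<Longrightarrow> graph_map \<phi> u' \<in> B \<Longrightarrow> j \<le> K * J (graph_map \<phi> u')"
  shows "ennreal j * emeasure (hausdorff_measure (CARD('m) + 1)) {u'\<in>U. graph_map \<phi> u' \<in> B} \<le> emeasure area_measure B"
proof (cases "U = {}")
  case False
  then have K: "0 < K" using K_pos by blast
  let ?H = "hausdorff_measure (CARD('m) + 1) :: 'n heis measure" and ?S = "{u'\<in>U. graph_map \<phi> u' \<in> B}"
  have "ennreal (j / K) * emeasure ?H ?S = (\<integral>\<^sup>+ x. ennreal (j / K) * indicator ?S x \<partial>?H)"
    using vimage_borel[OF B] by (intro nn_integral_cmult_indicator[symmetric]) simp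
  also have "\<dots> \<le> (\<integral>\<^sup>+ x \<in> ?S. ennreal (J (graph_map \<phi> x)) \<partial>?H)"
  proof (rule nn_integral_mono)
    fix x
    show "ennreal (j / K) * indicator ?S x \<le> ennreal (J (graph_map \<phi> x)) * indicator ?S x"
      using ge[of x] K by (auto split: split_indicator intro!: ennreal_leI simp: field_simps)
  qed
  finally have "ennreal K * (ennreal (j / K) * emeasure ?H ?S) \<le> emeasure area_measure B"
    unfolding emeasure_area_measure[OF B] by (rule mult_left_mono) simp
  moreover have "ennreal K * (ennreal (j / K) * emeasure ?H ?S) = ennreal j * emeasure ?H ?S"
    using K j by (simp add: mult.assoc[symmetric] ennreal_mult[symmetric])
  ultimately show ?thesis by simp
qed simp

text \<open>In blown-up coordinates a small ball through \<open>x\<close> cuts from the graph a set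
  that lies between the slices of the tangent subgroup by concentric balls of radii
  \<open>1 - \<epsilon>\<close> and \<open>1 + \<epsilon>\<close>, while the Jacobian stays within
  \<open>\<epsilon>\<close> of its value at \<open>x\<close>. The blow-up estimate is uniform over
  the centres, as an upper density over all balls containing \<open>x\<close> demands.\<close>

lemma density_at_point:
  assumes u: "u \<in> U"
  defines "x \<equiv> graph_map \<phi> u"
  shows "\<exists>\<theta>. omega_d d (CARD('m) + 1) = ennreal \<theta> \<and> 0 < \<theta> \<and>
    (\<forall>\<theta>'. \<theta> < \<theta>' \<longrightarrow> (\<exists>r>0. \<forall>y t. 0 < t \<and> t < r \<and> d y x \<le> t \<longrightarrow>
        emeasure area_measure (dball d y t) \<le> ennreal (\<theta>' * t ^ (CARD('m) + 2)))) \<and>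
    (\<forall>\<theta>' r. 0 < \<theta>' \<longrightarrow> \<theta>' < \<theta> \<longrightarrow> 0 < r \<longrightarrow> (\<exists>y t. 0 < t \<and> t < r \<and> d y x \<le> t \<and>
        ennreal (\<theta>' * t ^ (CARD('m) + 2)) \<le> emeasure area_measure (dball d y t)))"
proof -
  let ?N = "CARD('m) + 2"
  define \<kappa> where "\<kappa> = K * J x"
  obtain D q P where D: "\<forall>y\<in>W. D y \<in> V" "\<forall>t>0. \<forall>y\<in>W. D (dil t y) = dil t (D y)" "D 0 = 0"
      "\<forall>\<epsilon>>0. \<exists>\<delta>>0. \<forall>w. shift u w \<in> U \<and> w \<noteq> 0 \<and> d w 0 < \<delta> \<longrightarrow> d (D w) (\<psi> u w) \<le> \<epsilon> * d w 0"
      and Dq: "\<forall>y. D (frame p y) = (hcomb q (fst y), 0)"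
      and P: "vertical_subgroup P" "dim P = CARD('m) + 1"
      and haus: "\<forall>z. hausdorff (CARD('m) + 1) (P \<inter> dball d z 1) =
        hausdorff_const TYPE((real^'m) \<times> real) * ennreal (K * J_H d f x / J_V d V f x) *
        emeasure lborel {y :: (real^'m) \<times> real. d z (frame p y \<cdot> (hcomb q (fst y), 0)) \<le> 1}"
    using tangent_structure[OF u] unfolding x_def K_def by blast
  have \<kappa>: "0 < \<kappa>" using KJ_pos[OF u] by (simp add: \<kappa>_def x_def)
  \<comment> \<open>The tangent subgroup as the graph of \<open>D\<close>. In these coordinates
    \<open>E z r\<close> is its slice by the ball of radius \<open>r\<close> about
    \<open>z\<close>.\<close>
  define G where "G y = frame p y \<cdot> (hcomb q (fst y), 0)" for y
  have DG: "G y = frame p y \<cdot> D (frame p y)" for y using Dq by (simp add: G_def)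
  have G_cont: "continuous_on S G" for S unfolding G_def by (intro continuous_intros)
  define c where "c = enn2real (hausdorff_const TYPE((real^'m) \<times> real))"
  have c_eq: "hausdorff_const TYPE((real^'m) \<times> real) = ennreal c"
    using hausdorff_const_finite[where 'a="(real^'m) \<times> real"] by (simp add: c_def)
  have c: "0 < c" using hausdorff_const_pos[where 'a="(real^'m) \<times> real"] by (simp add: c_eq)
  define E where "E z r = {y. d z (G y) \<le> r}" for z r
  have E_borel: "E z r \<in> sets borel" for z r
    unfolding E_def by (intro borel_closed closed_Collect_le continuous_intros G_cont)
  define m where "m z = emeasure lborel (E z 1)" for z
  have haus': "hausdorff (CARD('m) + 1) (P \<inter> dball d z 1) = ennreal (c * \<kappa>) * m z" for z
  proof -
    have "K * J_H d f x / J_V d V f x = \<kappa>" by (simp add: \<kappa>_def J_def)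
    with haus[rule_format, of z] c \<kappa> show ?thesis
      by (simp only: c_eq ennreal_mult less_imp_le m_def E_def G_def)
  qed
  obtain R where R: "0 < R" "\<forall>\<eta>\<in>W. \<forall>y\<in>V. d (\<eta> \<cdot> y) 0 \<le> 2 \<longrightarrow> d \<eta> 0 \<le> R"
    using d_proj_W_bound by blast
  have GR: "d (frame p y) 0 \<le> R" if "d (G y) 0 \<le> 2" for y
    using R(2) that D(1) unfolding DG W_eq by blast
  have E_R: "d (frame p y) 0 \<le> R" if "y \<in> E z r" "d z 0 \<le> 1" "r \<le> 1" for y z r
    using that d_triangle[of "G y" 0 z] d_commute[of "G y" z] by (intro GR) (simp add: E_def)
  \<comment> \<open>\<open>G\<close> commutes with dilations, so a slice of any radius reduces to
    one of radius \<open>1\<close> with the centre dilated.\<close>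
  have E_scale: "emeasure lborel (E z r) = ennreal (r ^ ?N) * m (dil (1 / r) z)" if r: "0 < r" for z r
  proof -
    have "G (r *\<^sub>R a, r\<^sup>2 * s + 0) = dil r (G (a, s))" for a s
      by (simp add: G_def frame_def prod_eq_iff hcomb_scale power2_eq_square algebra_simps)
    moreover have "d z (dil r y) \<le> r \<longleftrightarrow> d (dil (1 / r) z) y \<le> 1" for y
    proof -
      have "d z (dil r y) = d (dil r (dil (1 / r) z)) (dil r y)" using r by simp
      also have "\<dots> = r * d (dil (1 / r) z) y" by (rule d_dil[OF r])
      finally show ?thesis using r by simp
    qed
    ultimately have "{(a, s). (r *\<^sub>R a, r\<^sup>2 * s + 0) \<in> E z r} = E (dil (1 / r) z) 1"
      by (auto simp: E_def)
    then show ?thesis 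
      using emeasure_lborel_dilation[OF r, of "\<lambda>_. 0" "E z r"] E_borel[of z r] by (simp add: m_def)
  qed
  \<comment> \<open>The spherical factor of \<open>P\<close>. It is finite because all the slices
    lie in one compact set, and positive because the slice about \<open>0\<close> contains a
    Euclidean ball.\<close>
  define \<theta>' where "\<theta>' = (SUP z\<in>dball d 0 1. ennreal (c * \<kappa>) * m z)"
  have om: "omega_d d (CARD('m) + 1) = \<theta>'"
    unfolding omega_d_graph[OF P] spherical_factor_def haus' \<theta>'_def ..
  have m_le: "ennreal (c * \<kappa>) * m z \<le> \<theta>'" if "d z 0 \<le> 1" for z
    unfolding \<theta>'_def using that by (intro SUP_upper) (simp add: dball_def d_commute)
  have fin: "\<theta>' < \<infinity>"
  proof -
    have b: "emeasure lborel {y. d (frame p y) 0 \<le> R} < \<infinity>"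
      using bounded_frame_vimage by (rule emeasure_bounded_finite)
    have "\<theta>' \<le> ennreal (c * \<kappa>) * emeasure lborel {y. d (frame p y) 0 \<le> R}"
      unfolding \<theta>'_def m_def
    proof (intro SUP_least mult_left_mono emeasure_mono)
      fix z assume "z \<in> dball d 0 1"
      then show "E z 1 \<subseteq> {y. d (frame p y) 0 \<le> R}"
        using E_R[of _ z 1] by (auto simp: dball_def d_commute)
      show "{y. d (frame p y) 0 \<le> R} \<in> sets lborel"
        using compact_imp_closed[OF compact_frame_vimage[of R]] by (simp add: borel_closed)
    qed simp
    also have "\<dots> < \<infinity>" using b by (simp add: ennreal_mult_less_top)
    finally show ?thesis .
  qed
  define \<theta> where "\<theta> = enn2real \<theta>'"
  have \<theta>_eq: "\<theta>' = ennreal \<theta>" using fin by (simp add: \<theta>_def)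
  have "0 < m 0"
  proof -
    have "open {y. d 0 (G y) < 1}" by (intro open_Collect_less continuous_intros G_cont)
    moreover have "0 \<in> {y. d 0 (G y) < 1}" by (simp add: G_def frame_def zero_prod_def[symmetric])
    ultimately obtain e where e: "0 < e" "ball 0 e \<subseteq> {y. d 0 (G y) < 1}" by (rule openE)
    have "0 < emeasure lborel (ball (0 :: (real^'m) \<times> real) e)"
      using e(1) by (simp add: emeasure_ball)
    also have "\<dots> \<le> m 0"
      unfolding m_def using e(2) E_borel by (intro emeasure_mono) (auto simp: E_def)
    finally show ?thesis .
  qed
  then have "0 < ennreal (c * \<kappa>) * m 0" using c \<kappa> by (simp add: ennreal_zero_less_mult_iff)
  also have "\<dots> \<le> ennreal \<theta>" using m_le[of 0] \<theta>_eq by simp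
  finally have \<theta>: "0 < \<theta>" by simp
  \<comment> \<open>Closeness is measured by \<open>d\<close> at \<open>x\<close> and not at
    \<open>u\<close>, since the balls live in the ambient group.\<close>
  have J_near: "\<exists>\<rho>>0. \<forall>u'\<in>U. d x (graph_map \<phi> u') < \<rho> \<longrightarrow> \<bar>K * J (graph_map \<phi> u') - \<kappa>\<bar> < \<epsilon>" if \<epsilon>: "0 < \<epsilon>" for \<epsilon>
  proof -
    have x\<Omega>: "x \<in> \<Omega>" and op: "open \<Omega>"
      using graph_\<Omega>[OF u] C1h by (auto simp: x_def C1h_def)
    have "isCont (J_H d f) x" "isCont (J_V d V f) x"
      using continuous_on_J[OF C1h v] x\<Omega> by (auto simp: continuous_on_eq_continuous_at[OF op])
    moreover have "J_V d V f x \<noteq> 0" using \<kappa> by (auto simp: \<kappa>_def J_def)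
    ultimately have "isCont (\<lambda>z. K * (J_H d f z / J_V d V f z)) x"
      by (intro continuous_mult continuous_const continuous_divide) auto
    moreover have "open (ball \<kappa> \<epsilon>)" "K * (J_H d f x / J_V d V f x) \<in> ball \<kappa> \<epsilon>"
      using \<epsilon> by (auto simp: \<kappa>_def J_def)
    ultimately obtain S where S: "open S" "x \<in> S" "\<forall>z\<in>S. K * (J_H d f z / J_V d V f z) \<in> ball \<kappa> \<epsilon>"
      unfolding continuous_at_open by blast
    obtain \<rho> where \<rho>: "0 < \<rho>" "{z. d x z < \<rho>} \<subseteq> S" using S(1,2) by (rule d_ball_subset_open)
    have "\<bar>K * J (graph_map \<phi> u') - \<kappa>\<bar> < \<epsilon>" if "d x (graph_map \<phi> u') < \<rho>" for u'
    proof -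
      have "graph_map \<phi> u' \<in> S" using that \<rho>(2) by blast
      then show ?thesis using S(3) by (auto simp: J_def dist_real_def abs_minus_commute)
    qed
    then show ?thesis using \<rho>(1) by blast
  qed
  have shift_borel: "{\<eta>. shift u (dil t (frame p \<eta>)) \<in> S} \<in> sets borel" if "S \<in> sets borel" for S t
  proof -
    have "continuous_on UNIV (\<lambda>\<eta>. shift u (dil t (frame p \<eta>)))" unfolding shift_def by (intro continuous_intros)
    from measurable_sets[OF borel_measurable_continuous_onI[OF this] that] show ?thesis by (simp add: vimage_def)
  qed
  \<comment> \<open>The factor \<open>c\<close> occurs here and in \<open>haus'\<close> alike, so it
    disappears when the two are compared.\<close>
  have H_eq: "emeasure (hausdorff_measure (CARD('m) + 1)) {u'\<in>U. graph_map \<phi> u' \<in> dball d y t} =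
      ennreal (c * t ^ ?N) * emeasure lborel {\<eta>. shift u (dil t (frame p \<eta>)) \<in> {u'\<in>U. graph_map \<phi> u' \<in> dball d y t}}"
    if t: "0 < t" for y t
  proof -
    have S: "{u'\<in>U. graph_map \<phi> u' \<in> dball d y t} \<in> sets borel" by (rule vimage_borel[OF borel_dball])
    show ?thesis
      using hausdorff_graph_set[OF S] emeasure_blow_up[OF u t S] U_W c t
      by (simp add: c_eq ennreal_mult mult.assoc subset_eq)
  qed
  have rescale: "d (x \<cdot> dil t z) (graph_map \<phi> (shift u (dil t \<eta>))) = t * d z (\<eta> \<cdot> rescaled u t \<eta>)" if "0 < t" for t z \<eta>
    unfolding graph_map_blow_up[OF that] x_def[symmetric] by (simp add: d_dil[OF that])
  show ?thesis
  proof (rule exI[of _ \<theta>], intro conjI allI impI)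
    show "0 < \<theta>" by (rule \<theta>)
    show "omega_d d (CARD('m) + 1) = ennreal \<theta>" by (simp only: om \<theta>_eq)
  next
    fix \<theta>1 assume \<theta>1: "\<theta> < \<theta>1"
    \<comment> \<open>\<open>\<kappa> + \<epsilon>\<close> bounds the weighted Jacobian,
      \<open>(1 + \<epsilon>) ^ ?N\<close> is the growth of the slice, and
      \<open>\<theta> / \<kappa>\<close> bounds \<open>c\<close> times the unit slice. Their product
      tends to \<open>\<theta>\<close>.\<close>
    have "((\<lambda>\<epsilon>. (\<kappa> + \<epsilon>) * (1 + \<epsilon>) ^ ?N * (\<theta> / \<kappa>)) \<longlongrightarrow> (\<kappa> + 0) * (1 + 0) ^ ?N * (\<theta> / \<kappa>)) (at_right 0)"
      by (intro tendsto_intros)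
    then have "\<forall>\<^sub>F \<epsilon> in at_right 0. (\<kappa> + \<epsilon>) * (1 + \<epsilon>) ^ ?N * (\<theta> / \<kappa>) < \<theta>1"
      using \<theta>1 \<kappa> by (intro order_tendstoD(2)) auto
    then obtain e0 where e0: "0 < e0" "\<forall>\<epsilon>>0. \<epsilon> < e0 \<longrightarrow> (\<kappa> + \<epsilon>) * (1 + \<epsilon>) ^ ?N * (\<theta> / \<kappa>) < \<theta>1"
      unfolding eventually_at_right_field by blast
    define \<epsilon> where "\<epsilon> = e0 / 2"
    have \<epsilon>: "0 < \<epsilon>" "(\<kappa> + \<epsilon>) * (1 + \<epsilon>) ^ ?N * (\<theta> / \<kappa>) < \<theta>1" using e0 by (auto simp: \<epsilon>_def)
    obtain \<rho> where \<rho>: "0 < \<rho>" "\<forall>u'\<in>U. d x (graph_map \<phi> u') < \<rho> \<longrightarrow> \<bar>K * J (graph_map \<phi> u') - \<kappa>\<bar> < \<epsilon>"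
      using J_near[OF \<epsilon>(1)] by blast
    obtain t0 where t0: "0 < t0" "\<forall>t \<eta>. 0 < t \<and> t < t0 \<and> \<eta> \<in> W \<and> d \<eta> 0 \<le> R \<longrightarrow>
        shift u (dil t \<eta>) \<in> U \<and> d (D \<eta>) (rescaled u t \<eta>) \<le> \<epsilon>"
      using blow_up_uniform[OF u D(2,3,4) R(1) \<epsilon>(1)] by blast
    \<comment> \<open>\<open>\<rho> / 2\<close> suffices because the points of the ball lie within
      \<open>2 * t\<close> of \<open>x\<close>.\<close>
    have "emeasure area_measure (dball d y t) \<le> ennreal (\<theta>1 * t ^ ?N)"
      if t: "0 < t" "t < min t0 (\<rho> / 2)" and y: "d y x \<le> t" for y t
    proof -
      define z where "z = dil (1 / t) ((- x) \<cdot> y)"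
      have yz: "y = x \<cdot> dil t z" using t(1) by (simp add: z_def)
      have z: "d z 0 \<le> 1"
      proof -
        have "d y x = d (x \<cdot> dil t z) (x \<cdot> 0)" by (simp add: yz)
        also have "\<dots> = t * d z 0" using d_norm_dil[OF t(1)] by (simp only: d_translate)
        finally show ?thesis using y t(1) by simp
      qed
      let ?S = "{u'\<in>U. graph_map \<phi> u' \<in> dball d y t}"
      have sub: "{\<eta>. shift u (dil t (frame p \<eta>)) \<in> ?S} \<subseteq> E z (1 + \<epsilon>)"
      proof
        fix \<eta> assume "\<eta> \<in> {\<eta>. shift u (dil t (frame p \<eta>)) \<in> ?S}"
        then have inU: "shift u (dil t (frame p \<eta>)) \<in> U" and le: "d y (graph_map \<phi> (shift u (dil t (frame p \<eta>)))) \<le> t"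
          by (auto simp: dball_def)
        let ?y = "rescaled u t (frame p \<eta>)"
        have 1: "d z (frame p \<eta> \<cdot> ?y) \<le> 1" using le t(1) unfolding yz rescale[OF t(1)] by simp
        then have "d (frame p \<eta> \<cdot> ?y) 0 \<le> 2"
          using d_triangle[of "frame p \<eta> \<cdot> ?y" 0 z] d_commute[of z "frame p \<eta> \<cdot> ?y"] z by linarith
        moreover have "?y \<in> V" using inU by (rule rescaled_V[OF u])
        moreover have fW: "frame p \<eta> \<in> W" by (simp add: W_eq)
        ultimately have "d (frame p \<eta>) 0 \<le> R" using R(2) by blast
        then have "d (D (frame p \<eta>)) ?y \<le> \<epsilon>" using t0(2) t fW by simp
        then have "d (frame p \<eta> \<cdot> ?y) (G \<eta>) \<le> \<epsilon>" unfolding DG d_translate by (simp only: d_commute)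
        then show "\<eta> \<in> E z (1 + \<epsilon>)"
          using d_triangle[of z "G \<eta>" "frame p \<eta> \<cdot> ?y"] 1 by (simp add: E_def)
      qed
      \<comment> \<open>Dilating the slice back to radius \<open>1\<close> moves its centre to
        \<open>z'\<close>, which is still in the unit ball, so that \<open>m_le\<close>
        applies.\<close>
      define z' where "z' = dil (1 / (1 + \<epsilon>)) z"
      have z': "d z' 0 \<le> 1"
      proof -
        have "d z' 0 = 1 / (1 + \<epsilon>) * d z 0" unfolding z'_def using \<epsilon>(1) by (intro d_norm_dil) simp
        also have "\<dots> \<le> 1 * 1" using z \<epsilon>(1) by (intro mult_mono) auto
        finally show ?thesis by simp
      qed
      have mle: "ennreal (c * \<kappa>) * m z' \<le> ennreal \<theta>" using m_le[OF z'] \<theta>_eq by simp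
      have "m z' \<noteq> Orderings.top" using mle c \<kappa> by (auto simp: ennreal_mult_top top_unique)
      then obtain a where a: "0 \<le> a" "m z' = ennreal a" by (cases "m z'") auto
      have ca: "c * a \<le> \<theta> / \<kappa>"
      proof -
        have "ennreal (c * \<kappa> * a) \<le> ennreal \<theta>" using mle a c \<kappa> by (simp add: ennreal_mult)
        then have "c * \<kappa> * a \<le> \<theta>" using \<theta> by (simp add: ennreal_le_iff)
        then show ?thesis using \<kappa> by (simp add: pos_le_divide_eq mult.commute mult.left_commute)
      qed
      have "emeasure area_measure (dball d y t) \<le> ennreal (\<kappa> + \<epsilon>) * emeasure (hausdorff_measure (CARD('m) + 1)) ?S"
      proof (rule area_measure_le[OF borel_dball])
        fix u' assume u': "u' \<in> U" "graph_map \<phi> u' \<in> dball d y t"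
        then have "d y (graph_map \<phi> u') \<le> t" by (simp add: dball_def)
        then have "d x (graph_map \<phi> u') < \<rho>"
          using d_triangle[of x "graph_map \<phi> u'" y] d_commute[of x y] y t(2) by linarith
        then have "\<bar>K * J (graph_map \<phi> u') - \<kappa>\<bar> < \<epsilon>" using \<rho>(2) u'(1) by blast
        then show "K * J (graph_map \<phi> u') \<le> \<kappa> + \<epsilon>" by linarith
      qed (use \<kappa> \<epsilon> in simp)
      also have "\<dots> \<le> ennreal (\<kappa> + \<epsilon>) * (ennreal (c * t ^ ?N) * emeasure lborel (E z (1 + \<epsilon>)))"
        unfolding H_eq[OF t(1)] using sub E_borel by (intro mult_left_mono emeasure_mono) auto
      also have "emeasure lborel (E z (1 + \<epsilon>)) = ennreal ((1 + \<epsilon>) ^ ?N) * ennreal a"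
        using E_scale[of "1 + \<epsilon>" z] \<epsilon>(1) a(2) by (simp add: z'_def)
      also have "ennreal (\<kappa> + \<epsilon>) * (ennreal (c * t ^ ?N) * (ennreal ((1 + \<epsilon>) ^ ?N) * ennreal a)) =
          ennreal (((\<kappa> + \<epsilon>) * (1 + \<epsilon>) ^ ?N) * (c * a) * t ^ ?N)"
      proof -
        have "ennreal (\<kappa> + \<epsilon>) * (ennreal (c * t ^ ?N) * (ennreal ((1 + \<epsilon>) ^ ?N) * ennreal a)) =
            ennreal ((\<kappa> + \<epsilon>) * ((c * t ^ ?N) * ((1 + \<epsilon>) ^ ?N * a)))"
          using \<kappa> \<epsilon>(1) c t(1) a(1) by (intro ennreal_mult4) auto
        also have "(\<kappa> + \<epsilon>) * ((c * t ^ ?N) * ((1 + \<epsilon>) ^ ?N * a)) = ((\<kappa> + \<epsilon>) * (1 + \<epsilon>) ^ ?N) * (c * a) * t ^ ?N"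
          by (simp only: ac_simps)
        finally show ?thesis .
      qed
      also have "\<dots> \<le> ennreal (\<theta>1 * t ^ ?N)"
      proof (intro ennreal_leI mult_right_mono)
        have "(\<kappa> + \<epsilon>) * (1 + \<epsilon>) ^ ?N * (c * a) \<le> (\<kappa> + \<epsilon>) * (1 + \<epsilon>) ^ ?N * (\<theta> / \<kappa>)"
          using ca \<kappa> \<epsilon>(1) by (intro mult_left_mono) auto
        then show "(\<kappa> + \<epsilon>) * (1 + \<epsilon>) ^ ?N * (c * a) \<le> \<theta>1" using \<epsilon>(2) by linarith
      qed (use t in simp)
      finally show ?thesis .
    qed
    then show "\<exists>r>0. \<forall>y t. 0 < t \<and> t < r \<and> d y x \<le> t \<longrightarrow>
        emeasure area_measure (dball d y t) \<le> ennreal (\<theta>1 * t ^ ?N)"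
      using t0(1) \<rho>(1) by (intro exI[of _ "min t0 (\<rho> / 2)"]) auto
  next
    fix \<theta>1 r :: real assume \<theta>1: "0 < \<theta>1" "\<theta>1 < \<theta>" and r: "0 < r"
    show "\<exists>y t. 0 < t \<and> t < r \<and> d y x \<le> t \<and>
        ennreal (\<theta>1 * t ^ ?N) \<le> emeasure area_measure (dball d y t)"
    proof -
      \<comment> \<open>A nearly optimal centre is enough, so attainment of the supremum is not at
        issue.\<close>
      have "ennreal \<theta>1 < (SUP z\<in>dball d 0 1. ennreal (c * \<kappa>) * m z)"
        unfolding \<theta>'_def[symmetric] \<theta>_eq using \<theta>1 by (simp add: ennreal_less_iff)
      then obtain z where z: "d z 0 \<le> 1" "ennreal \<theta>1 < ennreal (c * \<kappa>) * m z"
        unfolding less_SUP_iff by (auto simp: dball_def d_commute)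
      have "ennreal (c * \<kappa>) * m z \<le> ennreal \<theta>" using m_le[OF z(1)] \<theta>_eq by simp
      then have "m z \<noteq> Orderings.top" using c \<kappa> by (auto simp: ennreal_mult_top top_unique)
      then obtain a where a: "0 \<le> a" "m z = ennreal a" by (cases "m z") auto
      have a\<theta>: "\<theta>1 < c * \<kappa> * a"
        using z(2) a c \<kappa> \<theta>1(1) by (simp add: ennreal_mult[symmetric] ennreal_less_iff)
      have "((\<lambda>\<epsilon>. (\<kappa> - \<epsilon>) * (1 - \<epsilon>) ^ ?N * (c * a)) \<longlongrightarrow> (\<kappa> - 0) * (1 - 0) ^ ?N * (c * a)) (at_right 0)"
        by (intro tendsto_intros)
      then have "\<forall>\<^sub>F \<epsilon> in at_right 0. \<theta>1 < (\<kappa> - \<epsilon>) * (1 - \<epsilon>) ^ ?N * (c * a)"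
        using a\<theta> by (intro order_tendstoD(1)) (auto simp: ac_simps)
      then obtain e0 where e0: "0 < e0" "\<forall>\<epsilon>>0. \<epsilon> < e0 \<longrightarrow> \<theta>1 < (\<kappa> - \<epsilon>) * (1 - \<epsilon>) ^ ?N * (c * a)"
        unfolding eventually_at_right_field by blast
      define \<epsilon> where "\<epsilon> = min (e0 / 2) (min (1 / 2) (\<kappa> / 2))"
      have \<epsilon>: "0 < \<epsilon>" "\<epsilon> < 1" "\<epsilon> < \<kappa>" "\<epsilon> < e0" using e0(1) \<kappa> by (auto simp: \<epsilon>_def min_def)
      have \<epsilon>\<theta>: "\<theta>1 < (\<kappa> - \<epsilon>) * (1 - \<epsilon>) ^ ?N * (c * a)" using e0(2) \<epsilon> by blast
      obtain \<rho> where \<rho>: "0 < \<rho>" "\<forall>u'\<in>U. d x (graph_map \<phi> u') < \<rho> \<longrightarrow> \<bar>K * J (graph_map \<phi> u') - \<kappa>\<bar> < \<epsilon>"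
        using J_near[OF \<epsilon>(1)] by blast
      obtain t0 where t0: "0 < t0" "\<forall>t \<eta>. 0 < t \<and> t < t0 \<and> \<eta> \<in> W \<and> d \<eta> 0 \<le> R \<longrightarrow>
          shift u (dil t \<eta>) \<in> U \<and> d (D \<eta>) (rescaled u t \<eta>) \<le> \<epsilon>"
        using blow_up_uniform[OF u D(2,3,4) R(1) \<epsilon>(1)] by blast
      define t where "t = min r (min t0 (\<rho> / 2)) / 2"
      have t: "0 < t" "t < r" "t < t0" "t < \<rho> / 2" using r t0(1) \<rho>(1) by (auto simp: t_def min_def)
      \<comment> \<open>The slice is shrunk to radius \<open>s\<close> to leave room for the blow-up
        error \<open>\<epsilon>\<close>. Shrinking the centre by the same dilation makes its volume
        that of the unit slice times \<open>s ^ ?N\<close> and keeps \<open>y\<close> within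
        \<open>t\<close> of \<open>x\<close>.\<close>
      define s where "s = 1 - \<epsilon>"
      have s: "0 < s" "s \<le> 1" "s + \<epsilon> = 1" using \<epsilon> by (auto simp: s_def)
      define z' where "z' = dil s z"
      have z's: "d z' 0 \<le> s"
        using d_norm_dil[OF s(1), of z] mult_left_mono[OF z(1), of s] s(1) by (simp add: z'_def)
      define y where "y = x \<cdot> dil t z'"
      have yx: "d y x \<le> t"
      proof -
        have "d y x = d (x \<cdot> dil t z') (x \<cdot> 0)" by (simp add: y_def)
        also have "\<dots> = t * d z' 0" using d_norm_dil[OF t(1)] by (simp only: d_translate)
        also have "\<dots> \<le> t * 1" using z's s(2) t(1) by (intro mult_left_mono) auto
        finally show ?thesis by simp
      qed
      let ?S = "{u'\<in>U. graph_map \<phi> u' \<in> dball d y t}"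
      have sub: "E z' s \<subseteq> {\<eta>. shift u (dil t (frame p \<eta>)) \<in> ?S}"
      proof
        fix \<eta> assume \<eta>: "\<eta> \<in> E z' s"
        let ?y = "rescaled u t (frame p \<eta>)"
        have fW: "frame p \<eta> \<in> W" by (simp add: W_eq)
        have "d (frame p \<eta>) 0 \<le> R" using E_R[OF \<eta>] z's s(2) by simp
        then have inU: "shift u (dil t (frame p \<eta>)) \<in> U" and "d (D (frame p \<eta>)) ?y \<le> \<epsilon>"
          using t0(2) t fW by blast+
        then have "d (G \<eta>) (frame p \<eta> \<cdot> ?y) \<le> \<epsilon>" unfolding DG d_translate by simp
        moreover have "d z' (G \<eta>) \<le> s" using \<eta> by (simp add: E_def)
        ultimately have "d z' (frame p \<eta> \<cdot> ?y) \<le> 1"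
          using d_triangle[of z' "frame p \<eta> \<cdot> ?y" "G \<eta>"] s(3) by linarith
        then have "d y (graph_map \<phi> (shift u (dil t (frame p \<eta>)))) \<le> t"
          unfolding y_def rescale[OF t(1)] using t(1) by simp
        then show "\<eta> \<in> {\<eta>. shift u (dil t (frame p \<eta>)) \<in> ?S}" using inU by (simp add: dball_def)
      qed
      have "ennreal (\<theta>1 * t ^ ?N) \<le> ennreal (((\<kappa> - \<epsilon>) * (1 - \<epsilon>) ^ ?N) * (c * a) * t ^ ?N)"
        using \<epsilon>\<theta> t(1) by (intro ennreal_leI mult_right_mono) auto
      also have "\<dots> = ennreal (\<kappa> - \<epsilon>) * (ennreal (c * t ^ ?N) * (ennreal (s ^ ?N) * ennreal a))"
      proof -
        have "((\<kappa> - \<epsilon>) * (1 - \<epsilon>) ^ ?N) * (c * a) * t ^ ?N = (\<kappa> - \<epsilon>) * ((c * t ^ ?N) * (s ^ ?N * a))"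
          unfolding s_def by (simp only: ac_simps)
        also have "ennreal \<dots> = ennreal (\<kappa> - \<epsilon>) * (ennreal (c * t ^ ?N) * (ennreal (s ^ ?N) * ennreal a))"
          using \<epsilon> c t(1) a(1) s(1) by (intro ennreal_mult4[symmetric]) auto
        finally show ?thesis .
      qed
      also have "ennreal (s ^ ?N) * ennreal a = emeasure lborel (E z' s)"
        using E_scale[OF s(1), of z'] s(1) a(2) by (simp add: z'_def)
      also have "ennreal (\<kappa> - \<epsilon>) * (ennreal (c * t ^ ?N) * emeasure lborel (E z' s)) \<le>
          ennreal (\<kappa> - \<epsilon>) * emeasure (hausdorff_measure (CARD('m) + 1)) ?S"
        unfolding H_eq[OF t(1)]
        using sub shift_borel[OF vimage_borel[OF borel_dball]] by (intro mult_left_mono emeasure_mono) auto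
      also have "\<dots> \<le> emeasure area_measure (dball d y t)"
      proof (rule area_measure_ge[OF borel_dball])
        fix u' assume u': "u' \<in> U" "graph_map \<phi> u' \<in> dball d y t"
        then have "d y (graph_map \<phi> u') \<le> t" by (simp add: dball_def)
        then have "d x (graph_map \<phi> u') < \<rho>"
          using d_triangle[of x "graph_map \<phi> u'" y] d_commute[of x y] yx t(4) by linarith
        then have "\<bar>K * J (graph_map \<phi> u') - \<kappa>\<bar> < \<epsilon>" using \<rho>(2) u'(1) by blast
        then show "\<kappa> - \<epsilon> \<le> K * J (graph_map \<phi> u')" by linarith
      qed (use \<epsilon> in simp)
      finally show ?thesis using t(1,2) yx by blast
    qed
  qed
qed

theorem area_formula:
  assumes B: "B \<in> sets borel"
  shows "emeasure area_measure B =
    omega_d d (CARD('m) + 1) * spherical d (CARD('m) + 2) (graph_map \<phi> ` U \<inter> B)"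
\<comment> \<open>Without a point of the graph there is no tangent subgroup from which
  \<open>omega_d\<close> is seen to be finite and positive; both sides vanish.\<close>
proof (cases "U = {}")
  case True
  then show ?thesis unfolding emeasure_area_measure[OF B] by (simp add: spherical_def)
next
  case False
  then obtain u0 where u0: "u0 \<in> U" by blast
  \<comment> \<open>The density found at a point is the real value of \<open>omega_d\<close>, and so
    it is the same at all points.\<close>
  define \<theta> where "\<theta> = enn2real (omega_d d (CARD('m) + 1))"
  have dens: "omega_d d (CARD('m) + 1) = ennreal \<theta> \<and> 0 < \<theta> \<and>
    (\<forall>\<theta>'. \<theta> < \<theta>' \<longrightarrow> (\<exists>r>0. \<forall>y t. 0 < t \<and> t < r \<and> d y x \<le> t \<longrightarrow>
        emeasure area_measure (dball d y t) \<le> ennreal (\<theta>' * t ^ (CARD('m) + 2)))) \<and>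
    (\<forall>\<theta>' r. 0 < \<theta>' \<longrightarrow> \<theta>' < \<theta> \<longrightarrow> 0 < r \<longrightarrow> (\<exists>y t. 0 < t \<and> t < r \<and> d y x \<le> t \<and>
        ennreal (\<theta>' * t ^ (CARD('m) + 2)) \<le> emeasure area_measure (dball d y t)))"
    if x: "x \<in> graph_map \<phi> ` U" for x
  proof -
    obtain u where u: "u \<in> U" "x = graph_map \<phi> u" using x by blast
    obtain \<theta>0 where \<theta>0: "omega_d d (CARD('m) + 1) = ennreal \<theta>0 \<and> 0 < \<theta>0 \<and>
      (\<forall>\<theta>'. \<theta>0 < \<theta>' \<longrightarrow> (\<exists>r>0. \<forall>y t. 0 < t \<and> t < r \<and> d y x \<le> t \<longrightarrow>
          emeasure area_measure (dball d y t) \<le> ennreal (\<theta>' * t ^ (CARD('m) + 2)))) \<and>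
      (\<forall>\<theta>' r. 0 < \<theta>' \<longrightarrow> \<theta>' < \<theta>0 \<longrightarrow> 0 < r \<longrightarrow> (\<exists>y t. 0 < t \<and> t < r \<and> d y x \<le> t \<and>
          ennreal (\<theta>' * t ^ (CARD('m) + 2)) \<le> emeasure area_measure (dball d y t)))"
      using density_at_point[OF u(1)] unfolding u(2) by (rule exE)
    then have \<theta>_eq: "\<theta> = \<theta>0" by (simp add: \<theta>_def)
    show ?thesis unfolding \<theta>_eq by (rule \<theta>0)
  qed
  have x0: "graph_map \<phi> u0 \<in> graph_map \<phi> ` U" using u0 by blast
  have om: "omega_d d (CARD('m) + 1) = ennreal \<theta>" and \<theta>: "0 < \<theta>"
    using dens[OF x0] by blast+
  have up: "\<exists>r>0. \<forall>y t. 0 < t \<and> t < r \<and> d y x \<le> t \<longrightarrow>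
        emeasure area_measure (dball d y t) \<le> ennreal (\<theta>' * t ^ (CARD('m) + 2))"
    if "x \<in> graph_map \<phi> ` U" "\<theta> < \<theta>'" for x \<theta>'
    using dens[OF that(1), THEN conjunct2, THEN conjunct2, THEN conjunct1, rule_format, OF that(2)] .
  have lo: "\<exists>y t. 0 < t \<and> t < r \<and> d y x \<le> t \<and>
        ennreal (\<theta>' * t ^ (CARD('m) + 2)) \<le> emeasure area_measure (dball d y t)"
    if "x \<in> graph_map \<phi> ` U" "0 < \<theta>'" "\<theta>' < \<theta>" "0 < r" for x \<theta>' r
    using dens[OF that(1), THEN conjunct2, THEN conjunct2, THEN conjunct2, rule_format, OF that(2-4)] .
  \<comment> \<open>Local finiteness comes from the upper density bound, applied to a ball centred
    at \<open>x\<close>.\<close>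
  have fin: "\<exists>T. open T \<and> x \<in> T \<and> emeasure area_measure T < \<infinity>" if x: "x \<in> graph_map \<phi> ` U" for x
  proof -
    have "\<theta> < \<theta> + 1" by simp
    from up[OF x this] obtain r where r: "0 < r" "\<forall>y t. 0 < t \<and> t < r \<and> d y x \<le> t \<longrightarrow>
        emeasure area_measure (dball d y t) \<le> ennreal ((\<theta> + 1) * t ^ (CARD('m) + 2))" by blast
    have "emeasure area_measure {z. d x z < r / 2} \<le> emeasure area_measure (dball d x (r / 2))"
      by (intro emeasure_mono) (auto simp: dball_def[symmetric] borel_dball, auto simp: dball_def)
    also have "\<dots> \<le> ennreal ((\<theta> + 1) * (r / 2) ^ (CARD('m) + 2))"
      using r(2)[rule_format, of "r / 2" x] r(1) by simp
    also have "\<dots> < \<infinity>" by simp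
    finally show ?thesis using r(1) open_d_ball[of x "r / 2"] by (intro exI[of _ "{z. d x z < r / 2}"]) simp
  qed
  have conc: "emeasure area_measure N = 0" if N: "N \<in> sets borel" "N \<inter> graph_map \<phi> ` U = {}" for N
  proof -
    have "{x \<in> U. graph_map \<phi> x \<in> N} = {}" using N(2) by blast
    then show ?thesis by (simp add: emeasure_area_measure[OF N(1)])
  qed
  show ?thesis
    unfolding om by (rule spherical_density[OF sets_area_measure \<theta> fin conc up lo B])
qed

end

theorem theorem1p3:
  fixes d :: "'n::finite heis \<Rightarrow> 'n heis \<Rightarrow> real"
    and W V U \<Sigma> \<Omega> :: "'n heis set"
    and \<phi> :: "'n heis \<Rightarrow> 'n heis"
    and f :: "'n heis \<Rightarrow> real^'k::finite"
    and v :: "'k \<Rightarrow> 'n heis"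
    and w :: "'m::finite \<Rightarrow> 'n heis"
    and \<mu> :: "'n heis set \<Rightarrow> ennreal"
    and n k :: nat
  assumes n: "n = CARD('n)"
    and k: "k = CARD('k)" "1 \<le> k" "k \<le> n"
    and m: "CARD('m) = 2 * n - k"
    and WV: "semidirect W V" "dim V = k"
    and d: "homogeneous_distance d"
    and sym: "vertically_symmetric (2 * n + 1 - k) d \<or> multiradial d"
    and \<Sigma>: "parametrized_H_regular_surface TYPE('k) d W V U \<phi> \<Sigma>"
    and f: "defining_function d V U \<Sigma> \<Omega> f"
    and v: "orthonormal_basis v V"
    and w: "orthonormal_basis (case_option evert w) W"
    and \<mu>: "\<And>B. B \<in> sets borel \<Longrightarrow>
      \<mu> B = ennreal (wedge_norm (case_sum v (case_option evert w))) *
        (\<integral>\<^sup>+ x \<in> {x\<in>U. graph_map \<phi> x \<in> B}.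
           ennreal (J_H d f (graph_map \<phi> x) / J_V d V f (graph_map \<phi> x))
         \<partial>hausdorff_measure (2 * n + 1 - k))"
  shows "(\<forall>B\<in>sets borel.
        \<mu> B = omega_d d (2 * n + 1 - k) * restr (spherical d (2 * n + 2 - k)) \<Sigma> B) \<and>
      (\<forall>B\<in>sets borel.
        restr (spherical_d d (2 * n + 2 - k)) \<Sigma> B = \<mu> B \<and>
        \<mu> B = emeasure
          (scale_measure (ennreal (wedge_norm (case_sum v (case_option evert w))))
            (distr
              (density (restrict_space (hausdorff_measure (2 * n + 1 - k)) U)
                (\<lambda>x. ennreal (J_H d f (graph_map \<phi> x) / J_V d V f (graph_map \<phi> x))))
              borel (graph_map \<phi>))) B)"
proof -
  \<comment> \<open>The \<open>w j\<close> are orthogonal to \<open>evert\<close>, hence horizontal,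
    so their first components carry all the information.\<close>
  define p where "p = fst \<circ> w"
  have on: "case_option evert w i \<bullet> case_option evert w j = (if i = j then 1 else 0)" for i j
    using w by (simp add: orthonormal_basis_def)
  have w_snd: "snd (w j) = 0" for j
    using on[of None "Some j"] by (simp add: evert_def inner_prod_def)
  have w_eq: "w = (\<lambda>j. (p j, 0))"
    by (rule ext) (simp add: p_def prod_eq_iff w_snd)
  have p: "orthonormal p"
    using on[of "Some _" "Some _"] by (simp add: orthonormal_def w_eq)
  have W: "W = range (frame p)"
  proof -
    have W_span: "W = span (range (case_option evert w))"
      using w by (simp add: orthonormal_basis_def)
    have rng: "range (case_option evert w) = insert evert (range w)"
      by (simp add: UNIV_option_conv image_image)
    show ?thesis
    proof
      have "range (frame p) = span (range p) \<times> UNIV" by (rule range_frame)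
      moreover have "subspace (span (range p) \<times> (UNIV :: real set))" by (intro subspace_Times) auto
      ultimately have sub: "subspace (range (frame p))" by simp
      have "range (case_option evert w) \<subseteq> range (frame p)"
        unfolding rng range_frame by (auto simp: evert_def w_eq span_zero intro: span_base)
      then show "W \<subseteq> range (frame p)" unfolding W_span by (rule span_minimal[OF _ sub])
      show "range (frame p) \<subseteq> W"
      proof
        fix x assume "x \<in> range (frame p)"
        then obtain a s where "x = frame p (a, s)" by auto
        also have "\<dots> = (\<Sum>j\<in>UNIV. a $ j *\<^sub>R w j) + s *\<^sub>R evert"
          by (simp add: frame_def hcomb_def prod_eq_iff fst_sum snd_sum w_eq evert_def)
        also have "\<dots> \<in> W"
          unfolding W_span rng by (intro span_add span_sum span_scale span_base) auto
        finally show "x \<in> W" .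
      qed
    qed
  qed
  have card: "CARD('k) + CARD('m) = 2 * CARD('n)" using n k m by simp
  \<comment> \<open>The linear and the homogeneous dimension of \<open>W\<close>. Subtraction of
    natural numbers is exact here as \<open>k \<le> n\<close>.\<close>
  have N: "2 * n + 1 - k = CARD('m) + 1" "2 * n + 2 - k = CARD('m) + 2" using n k m by simp_all
  \<comment> \<open>The level of \<open>f\<close> that contains the graph; it becomes the constant
    \<open>c0\<close> of the locale.\<close>
  obtain x0 where x0: "{x\<in>\<Omega>. f x = f x0} \<inter> (U <#>\<^bsub>heis_group\<^esub> V) = \<Sigma>"
    using f unfolding defining_function_def by blast
  have \<Sigma>_eq: "\<Sigma> = graph_map \<phi> ` U"
    using \<Sigma> by (simp add: parametrized_H_regular_surface_def)
  interpret area_graph d W V U \<phi> p v f \<Omega> "f x0"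
  proof
    show "homogeneous_distance d" by (rule d)
    show "semidirect W V" by (rule WV(1))
    show "openin (top_of_set W) U" "\<phi> ` U \<subseteq> V" "unif_intrinsic_differentiable d W V U \<phi>"
      using \<Sigma> by (simp_all add: parametrized_H_regular_surface_def)
    show "orthonormal p" "W = range (frame p)" "orthonormal_basis v V" by (fact p W v)+
    show "CARD('k) + CARD('m) = 2 * CARD('n)" by (rule card)
    show "C1h d \<Omega> f" using f by (simp add: defining_function_def)
    show "graph_map \<phi> u \<in> \<Omega>" "f (graph_map \<phi> u) = f x0" "surj (h_deriv d f (graph_map \<phi> u))" if "u \<in> U" for u
    proof -
      have "graph_map \<phi> u \<in> \<Sigma>" using that \<Sigma>_eq by blast
      then show "graph_map \<phi> u \<in> \<Omega>" "f (graph_map \<phi> u) = f x0" "surj (h_deriv d f (graph_map \<phi> u))"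
        using f x0 by (auto simp: defining_function_def)
    qed
    show "vertically_symmetric (CARD('m) + 1) d \<or> multiradial d" using sym by (simp only: N)
    show "CARD('k) \<le> CARD('n)" using n k by simp
  qed
  have K_eq: "wedge_norm (case_sum v (case_option evert w)) = K"
    unfolding w_eq by (rule K_def[symmetric])
  have \<mu>_area: "\<mu> B = emeasure area_measure B" if "B \<in> sets borel" for B
    unfolding \<mu>[OF that] emeasure_area_measure[OF that] K_eq N J_def ..
  have M_eq: "scale_measure (ennreal (wedge_norm (case_sum v (case_option evert w))))
            (distr
              (density (restrict_space (hausdorff_measure (2 * n + 1 - k)) U)
                (\<lambda>x. ennreal (J_H d f (graph_map \<phi> x) / J_V d V f (graph_map \<phi> x))))
              borel (graph_map \<phi>)) = area_measure"
    unfolding area_measure_def K_eq N J_def ..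
  have formula: "\<mu> B = omega_d d (2 * n + 1 - k) * restr (spherical d (2 * n + 2 - k)) \<Sigma> B" if "B \<in> sets borel" for B
    unfolding \<mu>_area[OF that] area_formula[OF that] N restr_def \<Sigma>_eq ..
  \<comment> \<open>\<open>spherical_d\<close> takes \<open>omega_d\<close> at its exponent minus
    one, which is \<open>2 * n + 1 - k\<close>.\<close>
  moreover have "restr (spherical_d d (2 * n + 2 - k)) \<Sigma> B = omega_d d (2 * n + 1 - k) * restr (spherical d (2 * n + 2 - k)) \<Sigma> B" for B
    by (simp add: restr_def spherical_d_def N)
  ultimately show ?thesis unfolding M_eq using \<mu>_area by simp
qed

end
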